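(* Let $K_n$ be the complete graph on $n$ vertices and $J(K_n)\subset S=\mathsf{k}[X_1,\dots,X_n]$ its cover ideal. Then for all $s\ge 1$ and $i\ge 0$, the Betti numbers of $J(K_n)^s$ are given by $$\beta_i^S(J(K_n)^s)=\binom{n-1}{i}\binom{n-1-i+s}{n-1}.$$
   Context: $\mathsf{k}$ is a field. The cover ideal of the complete graph $K_n$ on $[n]=\{1,\dots,n\}$ is $J(K_n)=\left\langle \prod_{j\ne i}X_j: i\in[n]\right\rangle$. (In general, the cover ideal of a graph $G$ on $[n]$ is generated by the monomials $\prod_{i\in C}X_i$, where $C$ runs over the minimal subsets of $[n]$ meeting every edge of $G$.) Here $\beta_i^S(M)=\dim_{\mathsf{k}}\operatorname{Tor}_i^S(M,\mathsf{k})$ is the $i$-th (total) Betti number of $M$. The right-hand side is $0$ when $i>n-1$, since $\binom{n-1}{i}=0$. *)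

theory Defs
  imports
    "HOL-Algebra.Ideal_Product"
    "HOL-Library.Poly_Mapping"
    "HOL-Library.Extended_Nat"
    "Jordan_Normal_Form.VS_Connect"
begin

text \<open>
  Modules are the records of HOL-Algebra, taken over a commutative ring \<open>R\<close>. The ring
  fields \<open>mult\<close> and \<open>one\<close> of a module record play no role and are left \<open>undefined\<close>.
\<close>

section \<open>Quotients, free modules and tensor products\<close>

definition quot_module :: "('a, 'm) module \<Rightarrow> 'm set \<Rightarrow> ('a, 'm set) module" where
  "quot_module M N =
     \<lparr> carrier = a_rcosets\<^bsub>M\<^esub> N, mult = undefined, one = undefined, zero = N, add = set_add M,
       smult = (\<lambda>r X. \<Union>x\<in>X. N +>\<^bsub>M\<^esub> (r \<odot>\<^bsub>M\<^esub> x)) \<rparr>"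

text \<open>The free module on a set \<open>B\<close>, as finitely supported functions.\<close>

definition free_module :: "('a, 'r) ring_scheme \<Rightarrow> 'b set \<Rightarrow> ('a, 'b \<Rightarrow> 'a) module" where
  "free_module R B =
     \<lparr> carrier = {f. range f \<subseteq> carrier R \<and> finite {b. f b \<noteq> \<zero>\<^bsub>R\<^esub>} \<and> {b. f b \<noteq> \<zero>\<^bsub>R\<^esub>} \<subseteq> B},
       mult = undefined, one = undefined,
       zero = (\<lambda>_. \<zero>\<^bsub>R\<^esub>), add = (\<lambda>f g b. f b \<oplus>\<^bsub>R\<^esub> g b),
       smult = (\<lambda>r f b. r \<otimes>\<^bsub>R\<^esub> f b) \<rparr>"

definition free_gen :: "('a, 'r) ring_scheme \<Rightarrow> 'b \<Rightarrow> 'b \<Rightarrow> 'a" where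
  "free_gen R b = (\<lambda>c. if c = b then \<one>\<^bsub>R\<^esub> else \<zero>\<^bsub>R\<^esub>)"

text \<open>
  \<open>M \<otimes>\<^sub>R N\<close> is the free module on \<open>M \<times> N\<close> modulo the submodule of bilinear relations.
\<close>

definition tensor_free ::
    "('a, 'r) ring_scheme \<Rightarrow> ('a, 'm) module \<Rightarrow> ('a, 'n) module \<Rightarrow> ('a, 'm \<times> 'n \<Rightarrow> 'a) module" where
  "tensor_free R M N = free_module R (carrier M \<times> carrier N)"

definition tensor_relations ::
    "('a, 'r) ring_scheme \<Rightarrow> ('a, 'm) module \<Rightarrow> ('a, 'n) module \<Rightarrow> ('m \<times> 'n \<Rightarrow> 'a) set" where
  "tensor_relations R M N =
     (let F = tensor_free R M N; e = free_gen R in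
        {e (x \<oplus>\<^bsub>M\<^esub> x', y) \<ominus>\<^bsub>F\<^esub> (e (x, y) \<oplus>\<^bsub>F\<^esub> e (x', y)) |x x' y.
            x \<in> carrier M \<and> x' \<in> carrier M \<and> y \<in> carrier N} \<union>
        {e (x, y \<oplus>\<^bsub>N\<^esub> y') \<ominus>\<^bsub>F\<^esub> (e (x, y) \<oplus>\<^bsub>F\<^esub> e (x, y')) |x y y'.
            x \<in> carrier M \<and> y \<in> carrier N \<and> y' \<in> carrier N} \<union>
        {e (r \<odot>\<^bsub>M\<^esub> x, y) \<ominus>\<^bsub>F\<^esub> r \<odot>\<^bsub>F\<^esub> e (x, y) |r x y.
            r \<in> carrier R \<and> x \<in> carrier M \<and> y \<in> carrier N} \<union>
        {e (x, r \<odot>\<^bsub>N\<^esub> y) \<ominus>\<^bsub>F\<^esub> r \<odot>\<^bsub>F\<^esub> e (x, y) |r x y.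
            r \<in> carrier R \<and> x \<in> carrier M \<and> y \<in> carrier N})"

definition tensor_rel_module ::
    "('a, 'r) ring_scheme \<Rightarrow> ('a, 'm) module \<Rightarrow> ('a, 'n) module \<Rightarrow> ('m \<times> 'n \<Rightarrow> 'a) set" where
  "tensor_rel_module R M N =
     LinearCombinations.module.span R (tensor_free R M N) (tensor_relations R M N)"

definition tensor ::
    "('a, 'r) ring_scheme \<Rightarrow> ('a, 'm) module \<Rightarrow> ('a, 'n) module \<Rightarrow> ('a, ('m \<times> 'n \<Rightarrow> 'a) set) module"
  where
  "tensor R M N = quot_module (tensor_free R M N) (tensor_rel_module R M N)"

text \<open>
  The map \<open>\<phi> \<otimes> N : M \<otimes>\<^sub>R N \<rightarrow> M' \<otimes>\<^sub>R N\<close> induced by \<open>\<phi> : M \<rightarrow> M'\<close>. All representatives \<open>f\<close> of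
  the class \<open>X\<close> give the same coset, so the union is just that coset.
\<close>

definition tensor_map ::
    "('a, 'r) ring_scheme \<Rightarrow> ('a, 'n) module \<Rightarrow> ('a, 'm') module \<Rightarrow> ('m \<Rightarrow> 'm') \<Rightarrow>
     ('m \<times> 'n \<Rightarrow> 'a) set \<Rightarrow> ('m' \<times> 'n \<Rightarrow> 'a) set" where
  "tensor_map R N M' \<phi> X =
     (let F = tensor_free R M' N in
        \<Union>f\<in>X. tensor_rel_module R M' N +>\<^bsub>F\<^esub>
          (\<Oplus>\<^bsub>F\<^esub>p\<in>{p. f p \<noteq> \<zero>\<^bsub>R\<^esub>}. f p \<odot>\<^bsub>F\<^esub> free_gen R (\<phi> (fst p), snd p)))"


section \<open>Homology and Tor\<close>

text \<open>A chain complex is a family of modules \<open>C i\<close> with maps \<open>d i : C (i + 1) \<rightarrow> C i\<close>.\<close>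

definition homology ::
    "(nat \<Rightarrow> ('a, 'm) module) \<Rightarrow> (nat \<Rightarrow> 'm \<Rightarrow> 'm) \<Rightarrow> nat \<Rightarrow> ('a, 'm set) module" where
  "homology C d i =
     quot_module
       (C i \<lparr> carrier := (case i of 0 \<Rightarrow> carrier (C 0)
                          | Suc j \<Rightarrow> a_kernel (C (Suc j)) (C j) (d j)) \<rparr>)
       (d i ` carrier (C (Suc i)))"

definition is_free_module :: "('a, 'r) ring_scheme \<Rightarrow> ('a, 'm) module \<Rightarrow> bool" where
  "is_free_module R M \<longleftrightarrow> Module.module R M \<and>
     (\<exists>B \<subseteq> carrier M. \<not> LinearCombinations.module.lin_dep R M B \<and>
        LinearCombinations.module.span R M B = carrier M)"

definition free_resolution ::
    "('a, 'r) ring_scheme \<Rightarrow> ('a, 'm) module \<Rightarrow>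
     (nat \<Rightarrow> ('a, 'f) module) \<Rightarrow> (nat \<Rightarrow> 'f \<Rightarrow> 'f) \<Rightarrow> ('f \<Rightarrow> 'm) \<Rightarrow> bool" where
  "free_resolution R M F d \<epsilon> \<longleftrightarrow>
     (\<forall>i. is_free_module R (F i)) \<and>
     (\<forall>i. mod_hom R (F (Suc i)) (F i) (d i)) \<and>
     mod_hom R (F 0) M \<epsilon> \<and>
     \<epsilon> ` carrier (F 0) = carrier M \<and>
     d 0 ` carrier (F (Suc 0)) = a_kernel (F 0) M \<epsilon> \<and>
     (\<forall>i. d (Suc i) ` carrier (F (Suc (Suc i))) = a_kernel (F (Suc i)) (F i) (d i))"

text \<open>
  \<open>Tor\<^sub>i\<^sup>R(M, N)\<close> is the homology of \<open>F \<otimes>\<^sub>R N\<close> for a chosen free resolution \<open>F\<close> of \<open>M\<close>. The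
  carriers of the resolution live in the type of lists over \<open>'a + 'm\<close>. That type is infinite
  and at least as large as \<open>R\<close> and \<open>M\<close>, so up to isomorphism it contains the free module on
  any of its subsets; hence every \<open>R\<close>-module \<open>M\<close> has such a resolution.
\<close>

definition Tor ::
    "('a, 'r) ring_scheme \<Rightarrow> ('a, 'm) module \<Rightarrow> ('a, 'n) module \<Rightarrow> nat \<Rightarrow>
     ('a, (('a + 'm) list \<times> 'n \<Rightarrow> 'a) set set) module" where
  "Tor R M N i =
     (let (F, d, \<epsilon>) =
            (SOME (F :: nat \<Rightarrow> ('a, ('a + 'm) list) module, d, \<epsilon>). free_resolution R M F d \<epsilon>)
      in homology (\<lambda>j. tensor R (F j) N) (\<lambda>j. tensor_map R N (F j) (d j)) i)"


section \<open>Polynomial rings and Betti numbers\<close>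

type_synonym 'k mpoly = "(nat \<Rightarrow>\<^sub>0 nat) \<Rightarrow>\<^sub>0 'k"

text \<open>The polynomial ring over the field \<open>'k\<close> in the variables \<open>X\<^sub>i\<close>, \<open>i \<in> V\<close>.\<close>

definition poly_ring :: "nat set \<Rightarrow> ('k::field) mpoly ring" where
  "poly_ring V = class_ring \<lparr> carrier := {p. \<forall>m \<in> Poly_Mapping.keys p. Poly_Mapping.keys m \<subseteq> V} \<rparr>"

definition var :: "nat \<Rightarrow> ('k::field) mpoly" where
  "var i = Poly_Mapping.single (Poly_Mapping.single i 1) 1"

text \<open>The field as a module over the polynomial ring, every variable acting as \<open>0\<close>.\<close>

definition residue_module :: "(('k::field) mpoly, 'k) module" where
  "residue_module =
     \<lparr> carrier = UNIV, mult = undefined, one = undefined, zero = 0, add = (+),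
       smult = (\<lambda>p c. Poly_Mapping.lookup p 0 * c) \<rparr>"

definition restrict_scalars :: "('b \<Rightarrow> 'a) \<Rightarrow> ('a, 'm) module \<Rightarrow> ('b, 'm) module" where
  "restrict_scalars h M =
     \<lparr> carrier = carrier M, mult = undefined, one = undefined, zero = zero M, add = add M,
       smult = (\<lambda>c. smult M (h c)) \<rparr>"

definition edim :: "('b, 'r) ring_scheme \<Rightarrow> ('b, 'm) module \<Rightarrow> enat" where
  "edim K V = (if vectorspace.fin_dim K V then enat (vectorspace.dim K V) else \<infinity>)"

text \<open>Scalars act on \<open>Tor\<close> through the constant polynomials \<open>Poly_Mapping.single 0 c\<close>.\<close>

definition betti :: "nat set \<Rightarrow> (('k::field) mpoly, 'm) module \<Rightarrow> nat \<Rightarrow> enat" where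
  "betti V M i =
     edim class_ring (restrict_scalars (Poly_Mapping.single 0) (Tor (poly_ring V) M residue_module i))"

definition ideal_module :: "('a, 'r) ring_scheme \<Rightarrow> 'a set \<Rightarrow> ('a, 'a) module" where
  "ideal_module R I =
     \<lparr> carrier = I, mult = undefined, one = undefined, zero = \<zero>\<^bsub>R\<^esub>, add = add R,
       smult = mult R \<rparr>"

definition ideal_power :: "('a, 'r) ring_scheme \<Rightarrow> 'a set \<Rightarrow> nat \<Rightarrow> 'a set" where
  "ideal_power R I s = I [^]\<^bsub>ideals_set R\<^esub> s"


section \<open>Cover ideals\<close>

text \<open>A graph is given by its vertex set \<open>V\<close> and its set \<open>E\<close> of two-element subsets of \<open>V\<close>.\<close>

definition complete_graph :: "nat set \<Rightarrow> nat set set" where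
  "complete_graph V = {{i, j} |i j. i \<in> V \<and> j \<in> V \<and> i \<noteq> j}"

definition vertex_cover :: "nat set \<Rightarrow> nat set set \<Rightarrow> nat set \<Rightarrow> bool" where
  "vertex_cover V E C \<longleftrightarrow> C \<subseteq> V \<and> (\<forall>e \<in> E. C \<inter> e \<noteq> {})"

definition minimal_vertex_cover :: "nat set \<Rightarrow> nat set set \<Rightarrow> nat set \<Rightarrow> bool" where
  "minimal_vertex_cover V E C \<longleftrightarrow>
     vertex_cover V E C \<and> (\<forall>C' \<subset> C. \<not> vertex_cover V E C')"

definition cover_ideal :: "nat set \<Rightarrow> nat set set \<Rightarrow> ('k::field) mpoly set" where
  "cover_ideal V E =
     genideal (poly_ring V) {\<Prod>i\<in>C. var i |C. minimal_vertex_cover V E C}"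

lemma minimal_vertex_cover_complete_graph:
  assumes "V \<noteq> {}"
  shows "minimal_vertex_cover V (complete_graph V) C \<longleftrightarrow> (\<exists>i\<in>V. C = V - {i})"
proof -
  have cover: "vertex_cover V (complete_graph V) D \<longleftrightarrow>
      D \<subseteq> V \<and> (\<forall>i\<in>V. \<forall>j\<in>V. i \<noteq> j \<longrightarrow> i \<in> D \<or> j \<in> D)" for D
    unfolding vertex_cover_def complete_graph_def by auto
  have cov: "vertex_cover V (complete_graph V) (V - {i})" for i
    unfolding cover by auto
  show ?thesis
  proof
    assume C: "minimal_vertex_cover V (complete_graph V) C"
    then have sub: "C \<subseteq> V" and pair: "\<And>i j. i \<in> V \<Longrightarrow> j \<in> V \<Longrightarrow> i \<noteq> j \<Longrightarrow> i \<in> C \<or> j \<in> C"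
      unfolding minimal_vertex_cover_def cover by blast+
    from C have min: "\<not> D \<subset> C" if "vertex_cover V (complete_graph V) D" for D
      using that unfolding minimal_vertex_cover_def by blast
    have "C \<noteq> V" using assms min[OF cov] by blast
    then obtain i where i: "i \<in> V" "i \<notin> C" using sub by blast
    then have "V - {i} \<subseteq> C" using pair[of i] by blast
    then have "C = V - {i}" using sub i by blast
    then show "\<exists>i\<in>V. C = V - {i}" using i by blast
  next
    assume "\<exists>i\<in>V. C = V - {i}"
    then obtain i where i: "i \<in> V" "C = V - {i}" by blast
    have "\<not> vertex_cover V (complete_graph V) D" if D: "D \<subset> C" for D
    proof
      assume "vertex_cover V (complete_graph V) D"
      then have *: "\<And>j. j \<in> V \<Longrightarrow> i \<noteq> j \<Longrightarrow> i \<in> D \<or> j \<in> D"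
        unfolding cover using i(1) by blast
      obtain j where "j \<in> C" "j \<notin> D" using D by blast
      moreover have "i \<notin> D" using D i by blast
      ultimately show False using *[of j] i by blast
    qed
    then show "minimal_vertex_cover V (complete_graph V) C"
      unfolding minimal_vertex_cover_def using cov i by blast
  qed
qed

lemma cover_ideal_complete_graph:
  assumes "V \<noteq> {}"
  shows "cover_ideal V (complete_graph V) =
         (genideal (poly_ring V) {\<Prod>j\<in>V - {i}. var j |i. i \<in> V} :: ('k::field) mpoly set)"
proof -
  have "{\<Prod>j\<in>C. var j |C. \<exists>i\<in>V. C = V - {i}} = {\<Prod>j\<in>V - {i}. (var j :: 'k mpoly) |i. i \<in> V}"
    by blast
  then show ?thesis
    unfolding cover_ideal_def minimal_vertex_cover_complete_graph[OF assms] by simp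
qed

end

theory Submission
  imports Defs
begin

text \<open>
  Let \<open>S\<close> be the polynomial ring and let \<open>I(k, s)\<close> be the extension to \<open>S\<close> of the \<open>s\<close>-th power of
  the cover ideal of the complete graph on the first \<open>k\<close> vertices. This is a monomial ideal: the
  monomial with exponents \<open>m\<close> lies in it iff the numbers \<open>max 0 (s - m\<^sub>j)\<close>, \<open>1 \<le> j \<le> k\<close>, add up to at
  most \<open>s\<close> (\<open>cover_power\<close>, \<open>ideal_power_cover_power\<close>). With \<open>P = X\<^sub>1 \<cdots> X\<^sub>k\<close> and \<open>Y\<close> the next variable,
  the exponent criterion gives a short exact sequence

    \<open>0 \<rightarrow> I(k, t) \<rightarrow> I(k + 1, t) \<oplus> I(k, t + 1) \<rightarrow> I(k + 1, t + 1) \<rightarrow> 0\<close>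

  whose maps are \<open>a \<mapsto> (Y\<^sup>t\<^sup>+\<^sup>1 a, - P a)\<close> and \<open>(x, y) \<mapsto> P x + Y\<^sup>t\<^sup>+\<^sup>1 y\<close>
  (\<open>cover_power_split\<close>, \<open>cover_power_syzygy\<close>). The components of the first map factor as
  \<open>Y \<cdot> Y\<^sup>t\<close> and \<open>- X\<^sub>1 \<cdot> (X\<^sub>2 \<cdots> X\<^sub>k)\<close>, where already \<open>Y\<^sup>t\<close> and \<open>X\<^sub>2 \<cdots> X\<^sub>k\<close> map between the ideals in
  question. So the first map is a combination of homomorphisms with coefficients in the maximal
  ideal, and the mapping cone built from minimal resolutions of the first two terms is again
  minimal (\<open>minimal_resolution_cone\<close>). The ranks of the cone give

    \<open>\<beta>\<^sub>i(I(k + 1, t + 1)) = \<beta>\<^sub>i(I(k + 1, t)) + \<beta>\<^sub>i(I(k, t + 1)) + \<beta>\<^sub>i\<^sub>-\<^sub>1(I(k, t))\<close>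

  with \<open>I(1, s) = I(k, 0) = S\<close> as initial values, and Pascal's rule shows that the product of
  binomial coefficients satisfies the same recursion (\<open>rank_recursion\<close>).

  The Betti numbers are defined by an unspecified free resolution \<open>F\<close> of the module, so the ranks
  of a minimal resolution \<open>G\<close> have to be related to the homology of \<open>F \<otimes> K\<close>. Here \<open>K = S / \<mm>\<close> with
  the ideal \<open>\<mm>\<close> generated by the variables. The module \<open>M \<otimes> K\<close> is \<open>M / \<mm>M\<close>, naturally in \<open>M\<close>
  (\<open>tensor_one_eq_zero_iff\<close>, \<open>tensor_map_tensor_one\<close>). The comparison theorem gives
  chain maps between \<open>F\<close> and \<open>G\<close> that are inverse up to homotopy; modulo \<open>\<mm>\<close> the differentials of \<open>G\<close> vanish, so the homology is \<open>G\<^sub>i / \<mm>G\<^sub>i\<close>, a vector space whose dimension is the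
  rank of \<open>G\<^sub>i\<close> (\<open>edim_homology_minimal\<close>).
\<close>

section \<open>Modules and their homomorphisms\<close>

lemma (in abelian_group) minus_eq_zero_iff:
  assumes "x \<in> carrier G" "y \<in> carrier G"
  shows "x \<ominus> y = \<zero> \<longleftrightarrow> x = y"
  using assms minus_equality[of x "\<ominus> y"] by (auto simp: a_minus_def r_neg)

lemma (in abelian_group) minus_minus_cancel:
  assumes "x \<in> carrier G" "y \<in> carrier G"
  shows "x \<ominus> (x \<ominus> y) = y"
  using assms by (simp add: a_minus_def minus_add r_neg2)

lemma (in abelian_group) minus_zero_right:
  assumes "x \<in> carrier G"
  shows "x \<ominus> \<zero> = x"
proof -
  have "x \<ominus> x = \<zero>" using assms by (simp only: minus_eq_zero_iff)
  then show ?thesis using minus_minus_cancel[OF assms assms] by (simp only:)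
qed

lemma mod_homI:
  assumes "Module.module R M" "Module.module R N"
    and "\<And>x. x \<in> carrier M \<Longrightarrow> f x \<in> carrier N"
    and "\<And>x y. x \<in> carrier M \<Longrightarrow> y \<in> carrier M \<Longrightarrow> f (x \<oplus>\<^bsub>M\<^esub> y) = f x \<oplus>\<^bsub>N\<^esub> f y"
    and "\<And>r x. r \<in> carrier R \<Longrightarrow> x \<in> carrier M \<Longrightarrow> f (r \<odot>\<^bsub>M\<^esub> x) = r \<odot>\<^bsub>N\<^esub> f x"
  shows "mod_hom R M N f"
  using assms by (simp add: mod_hom_def mod_hom_axioms_def module_hom_def)

lemma mod_homD:
  assumes "mod_hom R M N f"
  shows "Module.module R M" "Module.module R N"
    and "\<And>x. x \<in> carrier M \<Longrightarrow> f x \<in> carrier N"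
    and "\<And>x y. x \<in> carrier M \<Longrightarrow> y \<in> carrier M \<Longrightarrow> f (x \<oplus>\<^bsub>M\<^esub> y) = f x \<oplus>\<^bsub>N\<^esub> f y"
    and "\<And>r x. r \<in> carrier R \<Longrightarrow> x \<in> carrier M \<Longrightarrow> f (r \<odot>\<^bsub>M\<^esub> x) = r \<odot>\<^bsub>N\<^esub> f x"
    and "f \<zero>\<^bsub>M\<^esub> = \<zero>\<^bsub>N\<^esub>"
    and "\<And>x y. x \<in> carrier M \<Longrightarrow> y \<in> carrier M \<Longrightarrow> f (x \<ominus>\<^bsub>M\<^esub> y) = f x \<ominus>\<^bsub>N\<^esub> f y"
proof -
  interpret mod_hom R M N f by fact
  show "Module.module R M" "Module.module R N" ..
  show "\<And>x. x \<in> carrier M \<Longrightarrow> f x \<in> carrier N"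
    and "\<And>x y. x \<in> carrier M \<Longrightarrow> y \<in> carrier M \<Longrightarrow> f (x \<oplus>\<^bsub>M\<^esub> y) = f x \<oplus>\<^bsub>N\<^esub> f y"
    and "\<And>r x. r \<in> carrier R \<Longrightarrow> x \<in> carrier M \<Longrightarrow> f (r \<odot>\<^bsub>M\<^esub> x) = r \<odot>\<^bsub>N\<^esub> f x"
    and "f \<zero>\<^bsub>M\<^esub> = \<zero>\<^bsub>N\<^esub>"
    and "\<And>x y. x \<in> carrier M \<Longrightarrow> y \<in> carrier M \<Longrightarrow> f (x \<ominus>\<^bsub>M\<^esub> y) = f x \<ominus>\<^bsub>N\<^esub> f y"
    by simp_all
qed

lemma mod_hom_comp:
  assumes "mod_hom R M N f" "mod_hom R N P g"
  shows "mod_hom R M P (\<lambda>x. g (f x))"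
  using mod_homD[OF assms(1)] mod_homD[OF assms(2)] by (intro mod_homI) simp_all

lemma mod_hom_id: "Module.module R M \<Longrightarrow> mod_hom R M M (\<lambda>x. x)"
  by (intro mod_homI) simp_all

lemma mod_hom_diff:
  assumes f: "mod_hom R M N f" and g: "mod_hom R M N g"
  shows "mod_hom R M N (\<lambda>x. f x \<ominus>\<^bsub>N\<^esub> g x)"
proof -
  interpret N: Module.module R N by (rule mod_homD[OF f])
  show ?thesis
  proof (rule mod_homI)
    fix x y assume "x \<in> carrier M" "y \<in> carrier M"
    then show "f (x \<oplus>\<^bsub>M\<^esub> y) \<ominus>\<^bsub>N\<^esub> g (x \<oplus>\<^bsub>M\<^esub> y) = (f x \<ominus>\<^bsub>N\<^esub> g x) \<oplus>\<^bsub>N\<^esub> (f y \<ominus>\<^bsub>N\<^esub> g y)"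
      using mod_homD[OF f] mod_homD[OF g]
      by (simp add: a_minus_def N.minus_add N.a_ac)
  next
    fix r x assume "r \<in> carrier R" "x \<in> carrier M"
    then show "f (r \<odot>\<^bsub>M\<^esub> x) \<ominus>\<^bsub>N\<^esub> g (r \<odot>\<^bsub>M\<^esub> x) = r \<odot>\<^bsub>N\<^esub> (f x \<ominus>\<^bsub>N\<^esub> g x)"
      using mod_homD[OF f] mod_homD[OF g]
      by (simp add: a_minus_def N.smult_r_distr N.smult_r_minus)
  qed (use mod_homD[OF f] mod_homD[OF g] in simp_all)
qed

lemma mod_hom_inv_into:
  assumes f: "mod_hom R M N f" and bij: "bij_betw f (carrier M) (carrier N)"
  shows "mod_hom R N M (inv_into (carrier M) f)"
proof -
  interpret M: Module.module R M by (rule mod_homD[OF f])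
  have inv: "inv_into (carrier M) f y \<in> carrier M" "f (inv_into (carrier M) f y) = y"
    if "y \<in> carrier N" for y
    using that bij by (auto simp: bij_betw_def intro: inv_into_into f_inv_into_f)
  have eq: "inv_into (carrier M) f y = x" if "x \<in> carrier M" "f x = y" for x y
    using that bij by (auto simp: bij_betw_def)
  show ?thesis
    by (rule mod_homI) (auto intro!: eq simp: inv mod_homD[OF f])
qed

lemma mod_hom_add:
  assumes f: "mod_hom R M N f" and g: "mod_hom R M N g"
  shows "mod_hom R M N (\<lambda>x. f x \<oplus>\<^bsub>N\<^esub> g x)"
proof -
  interpret N: Module.module R N by (rule mod_homD[OF f])
  show ?thesis
    by (rule mod_homI) (auto simp: mod_homD[OF f] mod_homD[OF g] N.add.m_ac N.smult_r_distr)
qed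

lemma mod_hom_neg:
  assumes f: "mod_hom R M N f"
  shows "mod_hom R M N (\<lambda>x. \<ominus>\<^bsub>N\<^esub> f x)"
proof -
  interpret N: Module.module R N by (rule mod_homD[OF f])
  show ?thesis
    by (rule mod_homI) (auto simp: mod_homD[OF f] N.minus_add N.smult_r_minus)
qed

lemma mod_hom_smult:
  assumes f: "mod_hom R M N f" and r: "r \<in> carrier R"
  shows "mod_hom R M N (\<lambda>x. r \<odot>\<^bsub>N\<^esub> f x)"
proof -
  interpret N: Module.module R N by (rule mod_homD[OF f])
  show ?thesis
    by (rule mod_homI)
      (auto simp: mod_homD[OF f] r N.smult_r_distr N.smult_assoc1[symmetric] N.R.m_comm[OF r])
qed

lemma mod_hom_zero:
  assumes "Module.module R M" "Module.module R N"
  shows "mod_hom R M N (\<lambda>_. \<zero>\<^bsub>N\<^esub>)"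
proof -
  interpret N: Module.module R N by fact
  show ?thesis by (rule mod_homI[OF assms]) auto
qed

lemma restrict_scalars_simps [simp]:
  "carrier (restrict_scalars h M) = carrier M" "\<zero>\<^bsub>restrict_scalars h M\<^esub> = \<zero>\<^bsub>M\<^esub>"
  "x \<oplus>\<^bsub>restrict_scalars h M\<^esub> y = x \<oplus>\<^bsub>M\<^esub> y" "c \<odot>\<^bsub>restrict_scalars h M\<^esub> x = h c \<odot>\<^bsub>M\<^esub> x"
  by (simp_all add: restrict_scalars_def)

text \<open>
  The module axioms are equations, so they pass to any surjective image under which the operations
  correspond. Quotients, transported copies and the cycles of a tensor product are recognised as
  modules in this way.
\<close>

lemma module_image:
  assumes M: "Module.module R M" and surj: "f ` carrier M = carrier N"
    and add: "\<And>x y. x \<in> carrier M \<Longrightarrow> y \<in> carrier M \<Longrightarrow> f (x \<oplus>\<^bsub>M\<^esub> y) = f x \<oplus>\<^bsub>N\<^esub> f y"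
    and smult: "\<And>r x. r \<in> carrier R \<Longrightarrow> x \<in> carrier M \<Longrightarrow> f (r \<odot>\<^bsub>M\<^esub> x) = r \<odot>\<^bsub>N\<^esub> f x"
    and zero: "f \<zero>\<^bsub>M\<^esub> = \<zero>\<^bsub>N\<^esub>"
  shows "mod_hom R M N f"
proof -
  interpret M: Module.module R M by fact
  note S = add[symmetric] smult[symmetric] zero[symmetric]
  have "Module.module R N"
  proof (rule module_criteria, goal_cases)
    case 4
    show ?case
    proof
      fix v assume "v \<in> carrier N"
      then obtain x where x: "x \<in> carrier M" "v = f x" using surj by blast
      then have "v \<oplus>\<^bsub>N\<^esub> f (\<ominus>\<^bsub>M\<^esub> x) = \<zero>\<^bsub>N\<^esub>" by (simp add: S M.r_neg)
      then show "\<exists>neg_v\<in>carrier N. v \<oplus>\<^bsub>N\<^esub> neg_v = \<zero>\<^bsub>N\<^esub>" using x surj by blast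
    qed
  qed (auto simp: M.R.cring_axioms surj[symmetric] S M.add.m_ac M.smult_l_distr M.smult_r_distr M.smult_assoc1)
  then show ?thesis using M add smult surj by (intro mod_homI) auto
qed

text \<open>
  A copy of a module inside another type. It moves resolutions into the type over which \<open>Tor\<close>
  chooses them.
\<close>

definition transport :: "('m \<Rightarrow> 'c) \<Rightarrow> ('a, 'm) module \<Rightarrow> ('a, 'c) module" where
  "transport f M = \<lparr> carrier = f ` carrier M, mult = undefined, one = undefined, zero = f \<zero>\<^bsub>M\<^esub>,
     add = (\<lambda>x y. f (inv_into (carrier M) f x \<oplus>\<^bsub>M\<^esub> inv_into (carrier M) f y)),
     smult = (\<lambda>r x. f (r \<odot>\<^bsub>M\<^esub> inv_into (carrier M) f x)) \<rparr>"

lemma transport_hom: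
  assumes "Module.module R M" "inj_on f (carrier M)"
  shows "mod_hom R M (transport f M) f" "bij_betw f (carrier M) (carrier (transport f M))"
proof -
  show "bij_betw f (carrier M) (carrier (transport f M))"
    using assms(2) by (simp add: bij_betw_def transport_def)
  show "mod_hom R M (transport f M) f"
    by (rule module_image[OF assms(1)]) (simp_all add: transport_def inv_into_f_f[OF assms(2)])
qed

lemma submodule_abelian_subgroup:
  assumes "submodule R N M"
  shows "abelian_subgroup N M"
proof -
  interpret submodule R N M by fact
  interpret M: Module.module R M by (rule module)
  have "\<ominus>\<^bsub>M\<^esub> x \<in> N" if "x \<in> N" for x
  proof -
    have "(\<ominus>\<^bsub>R\<^esub> \<one>\<^bsub>R\<^esub>) \<odot>\<^bsub>M\<^esub> x \<in> N" using that by (intro smult_closed) auto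
    moreover have "(\<ominus>\<^bsub>R\<^esub> \<one>\<^bsub>R\<^esub>) \<odot>\<^bsub>M\<^esub> x = \<ominus>\<^bsub>M\<^esub> x"
      using that subset by (subst M.smult_l_minus) auto
    ultimately show ?thesis by simp
  qed
  then have "subgroup N (add_monoid M)"
    using subset by (intro M.add.subgroupI) (auto simp: a_inv_def intro: zero_closed)
  then show ?thesis
    by (intro abelian_subgroupI3 additive_subgroup.intro M.abelian_group_axioms)
qed

text \<open>
  The scalar action on a quotient is a union over the representatives of a coset. All of them
  contribute the same coset, because \<open>r \<odot> h\<close> stays in \<open>N\<close> for \<open>h\<close> in \<open>N\<close>.
\<close>

lemma quot_module_hom:
  assumes N: "submodule R N M"
  shows "mod_hom R M (quot_module M N) (\<lambda>x. N +>\<^bsub>M\<^esub> x)"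
    and "(\<lambda>x. N +>\<^bsub>M\<^esub> x) ` carrier M = carrier (quot_module M N)"
    and "x \<in> carrier M \<Longrightarrow> N +>\<^bsub>M\<^esub> x = \<zero>\<^bsub>quot_module M N\<^esub> \<longleftrightarrow> x \<in> N"
proof -
  interpret submodule R N M by fact
  interpret M: Module.module R M by (rule module)
  interpret abelian_subgroup N M by (rule submodule_abelian_subgroup[OF N])
  show surj: "(\<lambda>x. N +>\<^bsub>M\<^esub> x) ` carrier M = carrier (quot_module M N)"
    by (auto simp: quot_module_def A_RCOSETS_def')
  have coset: "N +>\<^bsub>M\<^esub> x = N \<longleftrightarrow> x \<in> N" if "x \<in> carrier M" for x
    using that a_rcos_self[of x] a_rcos_const[of x] by auto
  show "x \<in> carrier M \<Longrightarrow> N +>\<^bsub>M\<^esub> x = \<zero>\<^bsub>quot_module M N\<^esub> \<longleftrightarrow> x \<in> N"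
    using coset by (simp add: quot_module_def)
  show "mod_hom R M (quot_module M N) (\<lambda>x. N +>\<^bsub>M\<^esub> x)"
  proof (rule module_image[OF module surj])
    show "N +>\<^bsub>M\<^esub> (x \<oplus>\<^bsub>M\<^esub> y) = (N +>\<^bsub>M\<^esub> x) \<oplus>\<^bsub>quot_module M N\<^esub> (N +>\<^bsub>M\<^esub> y)"
      if "x \<in> carrier M" "y \<in> carrier M" for x y
      using a_rcos_sum[OF that] by (simp add: quot_module_def)
    show "N +>\<^bsub>M\<^esub> \<zero>\<^bsub>M\<^esub> = \<zero>\<^bsub>quot_module M N\<^esub>"
      using coset[of "\<zero>\<^bsub>M\<^esub>"] by (simp add: quot_module_def)
    fix r x assume r: "r \<in> carrier R" and x: "x \<in> carrier M"
    have const: "N +>\<^bsub>M\<^esub> (r \<odot>\<^bsub>M\<^esub> y) = N +>\<^bsub>M\<^esub> (r \<odot>\<^bsub>M\<^esub> x)" if "y \<in> N +>\<^bsub>M\<^esub> x" for y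
    proof -
      obtain h where h: "h \<in> N" "y = h \<oplus>\<^bsub>M\<^esub> x" using \<open>y \<in> _\<close> by (auto simp: a_r_coset_def')
      then have hM: "h \<in> carrier M" using subset by auto
      have "N +>\<^bsub>M\<^esub> (r \<odot>\<^bsub>M\<^esub> y) = N +>\<^bsub>M\<^esub> (r \<odot>\<^bsub>M\<^esub> h \<oplus>\<^bsub>M\<^esub> r \<odot>\<^bsub>M\<^esub> x)"
        using r x h hM by (simp add: M.smult_r_distr)
      also have "\<dots> = N +>\<^bsub>M\<^esub> (r \<odot>\<^bsub>M\<^esub> h) +>\<^bsub>M\<^esub> (r \<odot>\<^bsub>M\<^esub> x)"
        using r x hM subset by (intro M.a_coset_add_assoc[symmetric]) auto
      also have "N +>\<^bsub>M\<^esub> (r \<odot>\<^bsub>M\<^esub> h) = N" using coset r h hM by auto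
      finally show ?thesis .
    qed
    show "N +>\<^bsub>M\<^esub> (r \<odot>\<^bsub>M\<^esub> x) = r \<odot>\<^bsub>quot_module M N\<^esub> (N +>\<^bsub>M\<^esub> x)"
      using UN_constant_eq[OF a_rcos_self[OF x] ballI[OF const]] by (simp add: quot_module_def)
  qed
qed

lemma ideal_module_simps [simp]:
  "carrier (ideal_module R I) = I" "\<zero>\<^bsub>ideal_module R I\<^esub> = \<zero>\<^bsub>R\<^esub>"
  "x \<oplus>\<^bsub>ideal_module R I\<^esub> y = x \<oplus>\<^bsub>R\<^esub> y" "r \<odot>\<^bsub>ideal_module R I\<^esub> x = r \<otimes>\<^bsub>R\<^esub> x"
  by (simp_all add: ideal_module_def)

lemma ideal_module_module:
  assumes "cring R" "ideal I R"
  shows "Module.module R (ideal_module R I)"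
proof -
  interpret R: cring R by fact
  interpret I: ideal I R by fact
  show ?thesis
  proof (rule module_criteria, goal_cases)
    case 4
    show ?case
    proof
      fix v assume "v \<in> carrier (ideal_module R I)"
      then show "\<exists>neg_v\<in>carrier (ideal_module R I). v \<oplus>\<^bsub>ideal_module R I\<^esub> neg_v = \<zero>\<^bsub>ideal_module R I\<^esub>"
        by (intro bexI[of _ "\<ominus>\<^bsub>R\<^esub> v"]) (auto simp: R.r_neg)
    qed
  qed (auto simp: assms(1) R.add.m_ac R.m_assoc R.l_distr R.r_distr I.I_l_closed)
qed

lemma mult_mod_hom:
  assumes R: "cring R" and I: "ideal I R" and J: "ideal J R" and q: "q \<in> carrier R"
    and sub: "\<And>p. p \<in> I \<Longrightarrow> q \<otimes>\<^bsub>R\<^esub> p \<in> J"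
  shows "mod_hom R (ideal_module R I) (ideal_module R J) (\<lambda>p. q \<otimes>\<^bsub>R\<^esub> p)"
proof -
  interpret R: cring R by fact
  interpret I: ideal I R by fact
  show ?thesis
    by (rule mod_homI[OF ideal_module_module[OF R I] ideal_module_module[OF R J]])
      (auto simp: sub q R.r_distr R.m_lcomm)
qed

section \<open>Free modules\<close>

lemma free_moduleD:
  assumes "f \<in> carrier (free_module R B)"
  shows "f b \<in> carrier R" "finite {b. f b \<noteq> \<zero>\<^bsub>R\<^esub>}" "{b. f b \<noteq> \<zero>\<^bsub>R\<^esub>} \<subseteq> B"
    and "\<And>b. b \<notin> B \<Longrightarrow> f b = \<zero>\<^bsub>R\<^esub>"
  using assms by (auto simp: free_module_def)

lemma free_moduleI:
  assumes "\<And>b. f b \<in> carrier R" "finite A" "\<And>b. b \<notin> A \<Longrightarrow> f b = \<zero>\<^bsub>R\<^esub>" "\<And>b. b \<notin> B \<Longrightarrow> f b = \<zero>\<^bsub>R\<^esub>"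
  shows "f \<in> carrier (free_module R B)"
proof -
  have "{b. f b \<noteq> \<zero>\<^bsub>R\<^esub>} \<subseteq> A" "{b. f b \<noteq> \<zero>\<^bsub>R\<^esub>} \<subseteq> B" using assms(3,4) by auto
  then show ?thesis using assms(1,2) finite_subset by (auto simp: free_module_def)
qed

lemma free_module_simps [simp]:
  "\<zero>\<^bsub>free_module R B\<^esub> = (\<lambda>_. \<zero>\<^bsub>R\<^esub>)"
  "f \<oplus>\<^bsub>free_module R B\<^esub> g = (\<lambda>b. f b \<oplus>\<^bsub>R\<^esub> g b)"
  "r \<odot>\<^bsub>free_module R B\<^esub> f = (\<lambda>b. r \<otimes>\<^bsub>R\<^esub> f b)"
  by (simp_all add: free_module_def)

lemma free_module_module:
  assumes "cring R"
  shows "Module.module R (free_module R B)"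
proof -
  interpret cring R by fact
  have neg: "(\<lambda>b. \<ominus>\<^bsub>R\<^esub> v b) \<in> carrier (free_module R B)" if "v \<in> carrier (free_module R B)" for v
    using free_moduleD[OF that] by (intro free_moduleI[of _ _ "{b. v b \<noteq> \<zero>\<^bsub>R\<^esub>}"]) auto
  have add: "(\<lambda>b. v b \<oplus>\<^bsub>R\<^esub> w b) \<in> carrier (free_module R B)"
    if "v \<in> carrier (free_module R B)" "w \<in> carrier (free_module R B)" for v w
    using free_moduleD[OF that(1)] free_moduleD[OF that(2)]
    by (intro free_moduleI[of _ _ "{b. v b \<noteq> \<zero>\<^bsub>R\<^esub>} \<union> {b. w b \<noteq> \<zero>\<^bsub>R\<^esub>}"]) auto
  have smult: "(\<lambda>b. r \<otimes>\<^bsub>R\<^esub> v b) \<in> carrier (free_module R B)"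
    if "r \<in> carrier R" "v \<in> carrier (free_module R B)" for r v
    using free_moduleD[OF that(2)] that(1)
    by (intro free_moduleI[of _ _ "{b. v b \<noteq> \<zero>\<^bsub>R\<^esub>}"]) auto
  have zero: "(\<lambda>_. \<zero>\<^bsub>R\<^esub>) \<in> carrier (free_module R B)"
    by (intro free_moduleI[of _ _ "{}"]) auto
  show ?thesis
  proof (rule module_criteria, goal_cases)
    case 4
    show ?case
    proof
      fix v assume v: "v \<in> carrier (free_module R B)"
      show "\<exists>neg_v\<in>carrier (free_module R B). v \<oplus>\<^bsub>free_module R B\<^esub> neg_v = \<zero>\<^bsub>free_module R B\<^esub>"
        by (rule bexI[OF _ neg[OF v]]) (simp add: free_moduleD(1)[OF v] r_neg)
    qed
  qed (auto simp: assms zero intro!: add smult dest: free_moduleD(1) simp: add.m_ac m_assoc l_distr r_distr free_moduleD(1))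
qed

lemma free_gen_closed:
  assumes "cring R" "b \<in> B"
  shows "free_gen R b \<in> carrier (free_module R B)"
proof -
  interpret cring R by fact
  show ?thesis using assms(2)
    by (intro free_moduleI[of _ _ "{b}"]) (auto simp: free_gen_def)
qed

text \<open>
  A finitely supported function arises from zero by adding one multiple of a generator for each
  point of its support.
\<close>

lemma free_module_induct [consumes 2, case_names zero step]:
  assumes R: "cring R" and f: "f \<in> carrier (free_module R B)"
    and zero: "P (\<lambda>_. \<zero>\<^bsub>R\<^esub>)"
    and step: "\<And>r b g. r \<in> carrier R \<Longrightarrow> b \<in> B \<Longrightarrow> g \<in> carrier (free_module R B) \<Longrightarrow> P g \<Longrightarrow>
      P (r \<odot>\<^bsub>free_module R B\<^esub> free_gen R b \<oplus>\<^bsub>free_module R B\<^esub> g)"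
  shows "P f"
proof -
  interpret cring R by fact
  have "P f" if "finite S" "{b. f b \<noteq> \<zero>\<^bsub>R\<^esub>} \<subseteq> S" "f \<in> carrier (free_module R B)" for S f
    using that
  proof (induction S arbitrary: f rule: finite_induct)
    case empty
    then have "f = (\<lambda>_. \<zero>\<^bsub>R\<^esub>)" by auto
    then show ?case using zero by simp
  next
    case (insert b S)
    show ?case
    proof (cases "f b = \<zero>\<^bsub>R\<^esub>")
      case True
      then show ?thesis using insert by auto
    next
      case False
      define g where "g = f(b := \<zero>\<^bsub>R\<^esub>)"
      note D = free_moduleD[OF insert.prems(2)]
      have g: "g \<in> carrier (free_module R B)" unfolding g_def
        using D by (intro free_moduleI[of _ _ "{b. f b \<noteq> \<zero>\<^bsub>R\<^esub>}"]) (auto split: if_splits)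
      have "P g" using insert.prems(1) by (intro insert.IH[OF _ g]) (auto simp: g_def)
      moreover have "b \<in> B" using D False by auto
      ultimately have "P (f b \<odot>\<^bsub>free_module R B\<^esub> free_gen R b \<oplus>\<^bsub>free_module R B\<^esub> g)"
        using D g by (intro step) auto
      also have "f b \<odot>\<^bsub>free_module R B\<^esub> free_gen R b \<oplus>\<^bsub>free_module R B\<^esub> g = f"
        using D by (auto simp: free_gen_def g_def fun_eq_iff)
      finally show ?thesis .
    qed
  qed
  then show ?thesis using free_moduleD[OF f] f by blast
qed

text \<open>
  The linear extension of \<open>n\<close> from the generators to the free module. The sum runs over the support,
  so that the sum inside \<open>tensor_map\<close> is an instance of it.
\<close>

definition free_ext ::
    "('a, 'r) ring_scheme \<Rightarrow> ('a, 'm, 'q) module_scheme \<Rightarrow> ('b \<Rightarrow> 'm) \<Rightarrow> ('b \<Rightarrow> 'a) \<Rightarrow> 'm" where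
  "free_ext R N n f = (\<Oplus>\<^bsub>N\<^esub>b\<in>{b. f b \<noteq> \<zero>\<^bsub>R\<^esub>}. f b \<odot>\<^bsub>N\<^esub> n b)"

lemma free_ext_eq:
  assumes N: "Module.module R N" and n: "\<And>b. b \<in> B \<Longrightarrow> n b \<in> carrier N"
    and f: "f \<in> carrier (free_module R B)" and A: "finite A" "{b. f b \<noteq> \<zero>\<^bsub>R\<^esub>} \<subseteq> A" "A \<subseteq> B"
  shows "free_ext R N n f = (\<Oplus>\<^bsub>N\<^esub>b\<in>A. f b \<odot>\<^bsub>N\<^esub> n b)"
proof -
  interpret Module.module R N by fact
  note D = free_moduleD[OF f]
  have nA: "n b \<in> carrier N" if "b \<in> A" for b using n A that by auto
  show ?thesis unfolding free_ext_def
    by (rule add.finprod_mono_neutral_cong_left) (use A D nA in auto)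
qed

lemma free_ext_hom:
  assumes N: "Module.module R N" and n: "\<And>b. b \<in> B \<Longrightarrow> n b \<in> carrier N"
  shows "mod_hom R (free_module R B) N (free_ext R N n)"
proof -
  interpret N: Module.module R N by fact
  have F: "Module.module R (free_module R B)" by (rule free_module_module) (rule N.R.cring_axioms)
  interpret F: Module.module R "free_module R B" by (rule F)
  show ?thesis
  proof (rule mod_homI[OF F N])
    fix f assume f: "f \<in> carrier (free_module R B)"
    note D = free_moduleD[OF f]
    show "free_ext R N n f \<in> carrier N" unfolding free_ext_def
      by (rule N.finsum_closed) (use D n in auto)
  next
    fix f g assume f: "f \<in> carrier (free_module R B)" and g: "g \<in> carrier (free_module R B)"
    note Df = free_moduleD[OF f] and Dg = free_moduleD[OF g]
    let ?A = "{b. f b \<noteq> \<zero>\<^bsub>R\<^esub>} \<union> {b. g b \<noteq> \<zero>\<^bsub>R\<^esub>}"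
    have A: "finite ?A" "?A \<subseteq> B" using Df Dg by auto
    have "free_ext R N n (f \<oplus>\<^bsub>free_module R B\<^esub> g) = (\<Oplus>\<^bsub>N\<^esub>b\<in>?A. (f \<oplus>\<^bsub>free_module R B\<^esub> g) b \<odot>\<^bsub>N\<^esub> n b)"
      by (rule free_ext_eq[OF N n]) (use F.add.m_closed[OF f g] A in auto)
    also have "\<dots> = (\<Oplus>\<^bsub>N\<^esub>b\<in>?A. f b \<odot>\<^bsub>N\<^esub> n b \<oplus>\<^bsub>N\<^esub> g b \<odot>\<^bsub>N\<^esub> n b)"
      by (rule N.finsum_cong') (use A n Df(1) Dg(1) in \<open>auto simp: N.smult_l_distr\<close>)
    also have "\<dots> = (\<Oplus>\<^bsub>N\<^esub>b\<in>?A. f b \<odot>\<^bsub>N\<^esub> n b) \<oplus>\<^bsub>N\<^esub> (\<Oplus>\<^bsub>N\<^esub>b\<in>?A. g b \<odot>\<^bsub>N\<^esub> n b)"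
      by (rule N.finsum_addf) (use A n Df(1) Dg(1) in auto)
    also have "(\<Oplus>\<^bsub>N\<^esub>b\<in>?A. f b \<odot>\<^bsub>N\<^esub> n b) = free_ext R N n f"
      by (rule free_ext_eq[OF N n f, symmetric]) (use A in auto)
    also have "(\<Oplus>\<^bsub>N\<^esub>b\<in>?A. g b \<odot>\<^bsub>N\<^esub> n b) = free_ext R N n g"
      by (rule free_ext_eq[OF N n g, symmetric]) (use A in auto)
    finally show "free_ext R N n (f \<oplus>\<^bsub>free_module R B\<^esub> g) = free_ext R N n f \<oplus>\<^bsub>N\<^esub> free_ext R N n g" .
  next
    fix r f assume r: "r \<in> carrier R" and f: "f \<in> carrier (free_module R B)"
    note Df = free_moduleD[OF f]
    let ?A = "{b. f b \<noteq> \<zero>\<^bsub>R\<^esub>}"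
    have "free_ext R N n (r \<odot>\<^bsub>free_module R B\<^esub> f) = (\<Oplus>\<^bsub>N\<^esub>b\<in>?A. (r \<odot>\<^bsub>free_module R B\<^esub> f) b \<odot>\<^bsub>N\<^esub> n b)"
      by (rule free_ext_eq[OF N n]) (use F.smult_closed[OF r f] Df r in auto)
    also have "\<dots> = (\<Oplus>\<^bsub>N\<^esub>b\<in>?A. r \<odot>\<^bsub>N\<^esub> (f b \<odot>\<^bsub>N\<^esub> n b))"
      by (rule N.finsum_cong') (use n Df r in \<open>auto simp: N.smult_assoc1\<close>)
    also have "\<dots> = r \<odot>\<^bsub>N\<^esub> free_ext R N n f" unfolding free_ext_def
      by (rule N.finsum_smult_ldistr[symmetric]) (use n Df r in auto)
    finally show "free_ext R N n (r \<odot>\<^bsub>free_module R B\<^esub> f) = r \<odot>\<^bsub>N\<^esub> free_ext R N n f" .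
  qed
qed

lemma free_ext_gen:
  assumes N: "Module.module R N" and n: "\<And>b. b \<in> B \<Longrightarrow> n b \<in> carrier N" and b: "b \<in> B"
  shows "free_ext R N n (free_gen R b) = n b"
proof -
  interpret N: Module.module R N by fact
  have "free_ext R N n (free_gen R b) = (\<Oplus>\<^bsub>N\<^esub>c\<in>{b}. free_gen R b c \<odot>\<^bsub>N\<^esub> n c)"
    by (rule free_ext_eq[OF N n free_gen_closed[OF N.R.cring_axioms b]])
      (use b in \<open>auto simp: free_gen_def\<close>)
  also have "\<dots> = n b" using n b by (simp add: free_gen_def)
  finally show ?thesis .
qed

lemma free_hom_eqI:
  assumes h: "mod_hom R (free_module R B) N h" and h': "mod_hom R (free_module R B) N h'"
    and gen: "\<And>b. b \<in> B \<Longrightarrow> h (free_gen R b) = h' (free_gen R b)"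
    and f: "f \<in> carrier (free_module R B)"
  shows "h f = h' f"
proof -
  note H = mod_homD[OF h] and H' = mod_homD[OF h']
  interpret N: Module.module R N by (rule H)
  interpret F: Module.module R "free_module R B" by (rule H)
  show ?thesis using N.R.cring_axioms f
  proof (induction rule: free_module_induct)
    case zero
    then show ?case using H(6) H'(6) by simp
  next
    case (step r b g)
    have e: "free_gen R b \<in> carrier (free_module R B)" by (rule free_gen_closed[OF N.R.cring_axioms step(2)])
    show ?case using step e F.smult_closed[OF step(1) e]
      by (simp only: H(4,5) H'(4,5) gen)
  qed
qed

lemma free_ext_unique:
  assumes h: "mod_hom R (free_module R B) N h" and f: "f \<in> carrier (free_module R B)"
  shows "h f = free_ext R N (\<lambda>b. h (free_gen R b)) f"
proof (rule free_hom_eqI[OF h _ _ f])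
  note H = mod_homD[OF h]
  interpret N: Module.module R N by (rule H)
  have c: "\<And>b. b \<in> B \<Longrightarrow> h (free_gen R b) \<in> carrier N"
    by (intro H(3) free_gen_closed N.R.cring_axioms)
  show "mod_hom R (free_module R B) N (free_ext R N (\<lambda>b. h (free_gen R b)))"
    by (rule free_ext_hom) (use H c in auto)
  show "h (free_gen R b) = free_ext R N (\<lambda>b. h (free_gen R b)) (free_gen R b)" if "b \<in> B" for b
    by (rule free_ext_gen[OF H(2) c that, symmetric])
qed

text \<open>
  A basis identifies the module with the finitely supported functions on it: spanning gives
  surjectivity, linear independence injectivity. Maps out of the module can then be built with
  \<open>free_ext\<close>.
\<close>

lemma is_free_moduleE:
  assumes "is_free_module R M"
  obtains B where "B \<subseteq> carrier M" "bij_betw (free_ext R M (\<lambda>b. b)) (carrier (free_module R B)) (carrier M)"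
proof -
  from assms obtain B where M: "Module.module R M" and B: "B \<subseteq> carrier M"
    and li: "\<not> LinearCombinations.module.lin_dep R M B"
    and span: "LinearCombinations.module.span R M B = carrier M"
    unfolding is_free_module_def by blast
  interpret M: Module.module R M by fact
  have F: "Module.module R (free_module R B)" by (rule free_module_module) (rule M.R.cring_axioms)
  interpret F: Module.module R "free_module R B" by (rule F)
  let ?h = "free_ext R M (\<lambda>b. b)"
  have hom: "mod_hom R (free_module R B) M ?h"
    by (rule free_ext_hom[OF M]) (use B in auto)
  note H = mod_homD[OF hom]
  have "inj_on ?h (carrier (free_module R B))"
  proof (rule inj_onI)
    fix f g assume f: "f \<in> carrier (free_module R B)" and g: "g \<in> carrier (free_module R B)"
      and eq: "?h f = ?h g"
    let ?k = "f \<ominus>\<^bsub>free_module R B\<^esub> g"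
    have k: "?k \<in> carrier (free_module R B)" using f g by simp
    have "?h ?k = \<zero>\<^bsub>M\<^esub>" using f g eq H by (simp add: M.r_neg a_minus_def[of M])
    then have 0: "M.lincomb ?k {b. ?k b \<noteq> \<zero>\<^bsub>R\<^esub>} = \<zero>\<^bsub>M\<^esub>"
      by (simp only: M.lincomb_def free_ext_def)
    have "?k b = \<zero>\<^bsub>R\<^esub>" for b
    proof (rule ccontr)
      assume b: "?k b \<noteq> \<zero>\<^bsub>R\<^esub>"
      have "M.lin_dep B"
        by (rule M.lin_dep_crit[OF _ _ _ _ b 0]) (use free_moduleD[OF k] b in auto)
      then show False using li by simp
    qed
    then have "?k = \<zero>\<^bsub>free_module R B\<^esub>" by (simp add: fun_eq_iff)
    then show "f = g" using f g by (simp only: F.minus_eq_zero_iff)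
  qed
  moreover have "carrier M \<subseteq> ?h ` carrier (free_module R B)"
  proof
    fix x assume "x \<in> carrier M"
    then have "x \<in> M.span B" by (simp only: span)
    then obtain a A where A: "finite A" "A \<subseteq> B" "a \<in> A \<rightarrow> carrier R" and x: "x = M.lincomb a A"
      by (auto simp: M.span_def)
    define f where "f = (\<lambda>b. if b \<in> A then a b else \<zero>\<^bsub>R\<^esub>)"
    have f: "f \<in> carrier (free_module R B)"
      by (rule free_moduleI[of _ _ A]) (use A in \<open>auto simp: f_def\<close>)
    have "?h f = (\<Oplus>\<^bsub>M\<^esub>b\<in>A. f b \<odot>\<^bsub>M\<^esub> b)"
      by (rule free_ext_eq[OF M _ f]) (use A B in \<open>auto simp: f_def\<close>)
    also have "\<dots> = x" unfolding x M.lincomb_def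
      by (rule M.finsum_cong') (use A B in \<open>auto simp: f_def\<close>)
    finally show "x \<in> ?h ` carrier (free_module R B)" using f by blast
  qed
  ultimately have "bij_betw ?h (carrier (free_module R B)) (carrier M)"
    using H(3) by (auto simp: bij_betw_def)
  then show ?thesis using that B by blast
qed

text \<open>
  Conversely, an isomorphism from a free module carries the generators to a basis: a linear
  combination of their images is the image of the function of its coefficients.
\<close>

lemma free_image_basis:
  assumes h: "mod_hom R (free_module R B) M h"
    and bij: "bij_betw h (carrier (free_module R B)) (carrier M)" and one: "\<one>\<^bsub>R\<^esub> \<noteq> \<zero>\<^bsub>R\<^esub>"
  defines "S \<equiv> (\<lambda>b. h (free_gen R b)) ` B"
  shows "S \<subseteq> carrier M" "\<not> LinearCombinations.module.lin_dep R M S"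
    "LinearCombinations.module.span R M S = carrier M" "inj_on (\<lambda>b. h (free_gen R b)) B"
proof -
  note H = mod_homD[OF h]
  interpret M: Module.module R M by (rule H)
  let ?n = "\<lambda>b. h (free_gen R b)"
  have n: "\<And>b. b \<in> B \<Longrightarrow> ?n b \<in> carrier M"
    by (intro H(3) free_gen_closed M.R.cring_axioms)
  show S: "S \<subseteq> carrier M" unfolding S_def using n by auto
  show inj: "inj_on ?n B"
  proof (rule inj_onI)
    fix b c assume bc: "b \<in> B" "c \<in> B" "?n b = ?n c"
    then have "free_gen R b = free_gen R c"
      using bij free_gen_closed[OF M.R.cring_axioms, of _ B] by (auto simp: bij_betw_def inj_on_def)
    then show "b = c" using one by (auto simp: free_gen_def fun_eq_iff split: if_splits)
  qed
  have rep: "\<exists>f \<in> carrier (free_module R B). h f = M.lincomb a A \<and> (\<forall>b\<in>B. ?n b \<in> A \<longrightarrow> f b = a (?n b))"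
    if A: "finite A" "A \<subseteq> S" "a \<in> A \<rightarrow> carrier R" for a A
  proof -
    define C where "C = {b\<in>B. ?n b \<in> A}"
    have nC: "?n ` C = A" using A unfolding C_def S_def by auto
    have injC: "inj_on ?n C" using inj by (rule inj_on_subset) (auto simp: C_def)
    have finC: "finite C" using A(1) nC injC by (metis finite_imageD)
    define f where "f = (\<lambda>b. if b \<in> C then a (?n b) else \<zero>\<^bsub>R\<^esub>)"
    have f: "f \<in> carrier (free_module R B)"
      by (rule free_moduleI[of _ _ C]) (use A finC in \<open>auto simp: f_def C_def\<close>)
    have "h f = free_ext R M ?n f" by (rule free_ext_unique[OF h f])
    also have "\<dots> = (\<Oplus>\<^bsub>M\<^esub>b\<in>C. f b \<odot>\<^bsub>M\<^esub> ?n b)"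
      by (rule free_ext_eq[OF H(2) n f]) (use finC in \<open>auto simp: f_def C_def\<close>)
    also have "\<dots> = (\<Oplus>\<^bsub>M\<^esub>b\<in>C. a (?n b) \<odot>\<^bsub>M\<^esub> ?n b)"
      by (rule M.finsum_cong') (use A n in \<open>auto simp: f_def C_def\<close>)
    also have "\<dots> = (\<Oplus>\<^bsub>M\<^esub>v\<in>?n ` C. a v \<odot>\<^bsub>M\<^esub> v)"
      by (rule M.add.finprod_reindex[symmetric]) (use injC A n in \<open>auto simp: C_def\<close>)
    finally show ?thesis using f nC by (intro bexI[of _ f]) (auto simp: M.lincomb_def f_def C_def)
  qed
  show "\<not> LinearCombinations.module.lin_dep R M S"
  proof
    assume "M.lin_dep S"
    then obtain A a v where A: "finite A" "A \<subseteq> S" "a \<in> A \<rightarrow> carrier R"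
      and 0: "M.lincomb a A = \<zero>\<^bsub>M\<^esub>" and v: "v \<in> A" "a v \<noteq> \<zero>\<^bsub>R\<^esub>"
      unfolding M.lin_dep_def by blast
    from rep[OF A] obtain f where f: "f \<in> carrier (free_module R B)" "h f = \<zero>\<^bsub>M\<^esub>"
      and fa: "\<forall>b\<in>B. ?n b \<in> A \<longrightarrow> f b = a (?n b)" using 0 by auto
    have "f = \<zero>\<^bsub>free_module R B\<^esub>"
      using bij f H(1,6) unfolding bij_betw_def inj_on_def
      by (metis Module.module.axioms(2) abelian_group.axioms(1) abelian_monoid.zero_closed)
    moreover obtain b where "b \<in> B" "v = ?n b" using v A by (auto simp: S_def)
    ultimately show False using fa v by auto
  qed
  show "LinearCombinations.module.span R M S = carrier M"
  proof
    show "M.span S \<subseteq> carrier M" by (rule M.span_is_subset2[OF S])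
    show "carrier M \<subseteq> M.span S"
    proof
      fix x assume "x \<in> carrier M"
      then obtain f where f: "f \<in> carrier (free_module R B)" "x = h f"
        using bij by (auto simp: bij_betw_def)
      note D = free_moduleD[OF f(1)]
      let ?C = "{b. f b \<noteq> \<zero>\<^bsub>R\<^esub>}"
      have injC: "inj_on ?n ?C" using inj D(3) by (rule inj_on_subset)
      define a where "a = (\<lambda>v. f (inv_into ?C ?n v))"
      have a: "a (?n b) = f b" if "b \<in> ?C" for b
        unfolding a_def by (simp only: inv_into_f_f[OF injC that])
      have "x = free_ext R M ?n f" unfolding f(2) by (rule free_ext_unique[OF h f(1)])
      also have "\<dots> = (\<Oplus>\<^bsub>M\<^esub>b\<in>?C. a (?n b) \<odot>\<^bsub>M\<^esub> ?n b)" unfolding free_ext_def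
        by (rule M.finsum_cong') (use n D in \<open>auto simp: a\<close>)
      also have "\<dots> = (\<Oplus>\<^bsub>M\<^esub>v\<in>?n ` ?C. a v \<odot>\<^bsub>M\<^esub> v)"
        by (rule M.add.finprod_reindex[symmetric]) (use injC n D in \<open>auto simp: a\<close>)
      finally have "x = M.lincomb a (?n ` ?C)" by (simp add: M.lincomb_def)
      moreover have "a \<in> ?n ` ?C \<rightarrow> carrier R" using D by (auto simp: a)
      ultimately show "x \<in> M.span S" using D(2,3) unfolding M.span_def S_def
        by (intro CollectI exI[of _ a] exI[of _ "?n ` ?C"]) auto
    qed
  qed
qed

lemma is_free_moduleI:
  assumes h: "mod_hom R (free_module R B) M h"
    and bij: "bij_betw h (carrier (free_module R B)) (carrier M)" and one: "\<one>\<^bsub>R\<^esub> \<noteq> \<zero>\<^bsub>R\<^esub>"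
  shows "is_free_module R M"
  unfolding is_free_module_def
  using free_image_basis(1-3)[OF h bij one] mod_homD(2)[OF h] by blast

lemma is_free_module_iso:
  assumes M: "is_free_module R M" and f: "mod_hom R M N f" "bij_betw f (carrier M) (carrier N)"
    and one: "\<one>\<^bsub>R\<^esub> \<noteq> \<zero>\<^bsub>R\<^esub>"
  shows "is_free_module R N"
proof -
  from is_free_moduleE[OF M] obtain B where B: "B \<subseteq> carrier M"
    and bij: "bij_betw (free_ext R M (\<lambda>b. b)) (carrier (free_module R B)) (carrier M)" .
  have e: "mod_hom R (free_module R B) M (free_ext R M (\<lambda>b. b))"
    by (rule free_ext_hom[OF mod_homD(1)[OF f(1)]]) (use B in auto)
  show ?thesis
    by (rule is_free_moduleI[OF mod_hom_comp[OF e f(1)] _ one])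
      (use bij_betw_trans[OF bij f(2)] in \<open>simp add: comp_def\<close>)
qed

text \<open>
  A linear isomorphism from the functions on a finite set exhibits a basis with one vector for each
  point.
\<close>

lemma edim_eq_card_basis:
  fixes W :: "('k::field, 'm) module"
  assumes h: "mod_hom class_ring (free_module class_ring B) W h"
    and bij: "bij_betw h (carrier (free_module class_ring B)) (carrier W)" and B: "finite B"
  shows "edim class_ring W = enat (card B)"
proof -
  have one: "\<one>\<^bsub>(class_ring :: 'k ring)\<^esub> \<noteq> \<zero>\<^bsub>class_ring\<^esub>" by simp
  note S = free_image_basis[OF h bij one]
  interpret W: vectorspace "class_ring :: 'k ring" W
    by (intro vectorspace.intro mod_homD(2)[OF h] class_field)
  let ?S = "(\<lambda>b. h (free_gen class_ring b)) ` B"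
  have "W.basis ?S" using S(1-3) by (simp add: W.basis_def)
  moreover have "finite ?S" using B by simp
  ultimately have "W.dim = card ?S" "W.fin_dim"
    using W.dim_basis[of ?S] by (auto simp: W.fin_dim_def W.basis_def)
  then show ?thesis using S(4) by (simp add: edim_def card_image)
qed

section \<open>Free resolutions and the comparison theorem\<close>

text \<open>
  Free modules are projective: choose preimages for the values on a basis and extend linearly.
\<close>

lemma free_module_lift:
  assumes F: "is_free_module R F" and p: "mod_hom R G N p" and h: "mod_hom R F N h"
    and im: "\<And>x. x \<in> carrier F \<Longrightarrow> h x \<in> p ` carrier G"
  obtains f where "mod_hom R F G f" "\<And>x. x \<in> carrier F \<Longrightarrow> p (f x) = h x"
proof -
  note P = mod_homD[OF p] and H = mod_homD[OF h]
  interpret F: Module.module R F by (rule H)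
  from is_free_moduleE[OF F] obtain B where B: "B \<subseteq> carrier F"
    and bij: "bij_betw (free_ext R F (\<lambda>b. b)) (carrier (free_module R B)) (carrier F)" .
  let ?e = "free_ext R F (\<lambda>b. b)"
  let ?L = "free_module R B"
  let ?i = "inv_into (carrier ?L) ?e"
  have e: "mod_hom R ?L F ?e" by (rule free_ext_hom[OF H(1)]) (use B in auto)
  have i: "mod_hom R F ?L ?i" by (rule mod_hom_inv_into[OF e bij])
  have "\<exists>n. \<forall>b\<in>B. n b \<in> carrier G \<and> p (n b) = h b"
  proof (rule bchoice, rule ballI)
    fix b assume "b \<in> B"
    then have "h b \<in> p ` carrier G" using im B by blast
    then show "\<exists>y. y \<in> carrier G \<and> p y = h b" by (auto simp: image_iff)
  qed
  then obtain n where n: "\<And>b. b \<in> B \<Longrightarrow> n b \<in> carrier G" "\<And>b. b \<in> B \<Longrightarrow> p (n b) = h b" by blast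
  let ?g = "free_ext R G n"
  have g: "mod_hom R ?L G ?g" by (rule free_ext_hom[OF P(1) n(1)])
  have pg: "p (?g l) = h (?e l)" if "l \<in> carrier ?L" for l
  proof (rule free_hom_eqI[OF mod_hom_comp[OF g p] mod_hom_comp[OF e h] _ that])
    fix b assume b: "b \<in> B"
    have "?e (free_gen R b) = b" by (rule free_ext_gen[OF H(1) _ b]) (use B in auto)
    moreover have "?g (free_gen R b) = n b" by (rule free_ext_gen[OF P(1) n(1) b])
    ultimately show "p (?g (free_gen R b)) = h (?e (free_gen R b))" using n(2)[OF b] by simp
  qed
  show thesis
  proof (rule that[of "\<lambda>x. ?g (?i x)"])
    show "mod_hom R F G (\<lambda>x. ?g (?i x))" by (rule mod_hom_comp[OF i g])
    fix x assume x: "x \<in> carrier F"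
    have "?e (?i x) = x" by (rule bij_betw_inv_into_right[OF bij x])
    then show "p (?g (?i x)) = h x" using pg[OF mod_homD(3)[OF i x]] by simp
  qed
qed

lemma free_resolutionD:
  assumes "free_resolution R M F d \<epsilon>"
  shows "is_free_module R (F i)" "mod_hom R (F (Suc i)) (F i) (d i)" "mod_hom R (F 0) M \<epsilon>"
    and "\<epsilon> ` carrier (F 0) = carrier M"
    and "x \<in> carrier (F (Suc 0)) \<Longrightarrow> \<epsilon> (d 0 x) = \<zero>\<^bsub>M\<^esub>"
    and "x \<in> carrier (F (Suc (Suc i))) \<Longrightarrow> d i (d (Suc i) x) = \<zero>\<^bsub>F i\<^esub>"
    and "y \<in> carrier (F 0) \<Longrightarrow> \<epsilon> y = \<zero>\<^bsub>M\<^esub> \<Longrightarrow> y \<in> d 0 ` carrier (F (Suc 0))"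
    and "z \<in> carrier (F (Suc i)) \<Longrightarrow> d i z = \<zero>\<^bsub>F i\<^esub> \<Longrightarrow> z \<in> d (Suc i) ` carrier (F (Suc (Suc i)))"
proof -
  note A = assms[unfolded free_resolution_def a_kernel_def']
  show "is_free_module R (F i)" "mod_hom R (F (Suc i)) (F i) (d i)" "mod_hom R (F 0) M \<epsilon>"
    "\<epsilon> ` carrier (F 0) = carrier M" using A by blast+
  have 0: "d 0 ` carrier (F (Suc 0)) = {x \<in> carrier (F 0). \<epsilon> x = \<zero>\<^bsub>M\<^esub>}"
    and S: "d (Suc i) ` carrier (F (Suc (Suc i))) = {x \<in> carrier (F (Suc i)). d i x = \<zero>\<^bsub>F i\<^esub>}"
    using A by blast+
  show "x \<in> carrier (F (Suc 0)) \<Longrightarrow> \<epsilon> (d 0 x) = \<zero>\<^bsub>M\<^esub>"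
    "y \<in> carrier (F 0) \<Longrightarrow> \<epsilon> y = \<zero>\<^bsub>M\<^esub> \<Longrightarrow> y \<in> d 0 ` carrier (F (Suc 0))" using 0 by blast+
  show "x \<in> carrier (F (Suc (Suc i))) \<Longrightarrow> d i (d (Suc i) x) = \<zero>\<^bsub>F i\<^esub>"
    "z \<in> carrier (F (Suc i)) \<Longrightarrow> d i z = \<zero>\<^bsub>F i\<^esub> \<Longrightarrow> z \<in> d (Suc i) ` carrier (F (Suc (Suc i)))"
    using S by blast+
qed

text \<open>
  Projectivity lifts the homomorphism one degree at a time. The invariant carried along is that the
  component constructed last maps boundaries to boundaries; this is what the next lifting step needs,
  and it follows for the next component from exactness of the target.
\<close>

lemma resolution_lift:
  assumes F: "free_resolution R M F d \<epsilon>" and G: "free_resolution R N G d' \<epsilon>'"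
    and phi: "mod_hom R M N \<phi>"
  obtains u where "\<And>i. mod_hom R (F i) (G i) (u i)"
    and "\<And>x. x \<in> carrier (F 0) \<Longrightarrow> \<epsilon>' (u 0 x) = \<phi> (\<epsilon> x)"
    and "\<And>i x. x \<in> carrier (F (Suc i)) \<Longrightarrow> d' i (u (Suc i) x) = u i (d i x)"
proof -
  note DF = free_resolutionD[OF F] and DG = free_resolutionD[OF G]
  have dF: "d i x \<in> carrier (F i)" if "x \<in> carrier (F (Suc i))" for i x
    by (rule mod_homD(3)[OF DF(2) that])
  let ?P = "\<lambda>n u. mod_hom R (F n) (G n) u \<and> (n = 0 \<longrightarrow> (\<forall>x\<in>carrier (F 0). \<epsilon>' (u x) = \<phi> (\<epsilon> x))) \<and>
      (\<forall>x\<in>carrier (F (Suc n)). u (d n x) \<in> d' n ` carrier (G (Suc n)))"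
  let ?Q = "\<lambda>n u v. \<forall>x\<in>carrier (F (Suc n)). d' n (v x) = u (d n x)"
  have "\<exists>u. ?P 0 u"
  proof -
    have im: "\<phi> (\<epsilon> x) \<in> \<epsilon>' ` carrier (G 0)" if "x \<in> carrier (F 0)" for x
      unfolding DG(4) by (rule mod_homD(3)[OF mod_hom_comp[OF DF(3) phi] that])
    obtain u where u: "mod_hom R (F 0) (G 0) u" "\<And>x. x \<in> carrier (F 0) \<Longrightarrow> \<epsilon>' (u x) = \<phi> (\<epsilon> x)"
      by (rule free_module_lift[OF DF(1)[of 0] DG(3) mod_hom_comp[OF DF(3) phi] im]) blast+
    have "u (d 0 x) \<in> d' 0 ` carrier (G (Suc 0))" if x: "x \<in> carrier (F (Suc 0))" for x
    proof (rule DG(7))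
      show "u (d 0 x) \<in> carrier (G 0)" by (rule mod_homD(3)[OF u(1) dF[OF x]])
      show "\<epsilon>' (u (d 0 x)) = \<zero>\<^bsub>N\<^esub>"
        using u(2)[OF dF[OF x]] DF(5)[OF x] mod_homD(6)[OF phi] by simp
    qed
    then show ?thesis using u by blast
  qed
  moreover have "\<exists>v. ?P (Suc n) v \<and> ?Q n u v" if u: "?P n u" for n u
  proof -
    have hom: "mod_hom R (F n) (G n) u" using u by blast
    have im: "u (d n x) \<in> d' n ` carrier (G (Suc n))" if "x \<in> carrier (F (Suc n))" for x
      using u that by simp
    obtain v where v: "mod_hom R (F (Suc n)) (G (Suc n)) v"
      "\<And>x. x \<in> carrier (F (Suc n)) \<Longrightarrow> d' n (v x) = u (d n x)"
      by (rule free_module_lift[OF DF(1) DG(2)[of n] mod_hom_comp[OF DF(2) hom] im]) blast+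
    have "v (d (Suc n) x) \<in> d' (Suc n) ` carrier (G (Suc (Suc n)))"
      if x: "x \<in> carrier (F (Suc (Suc n)))" for x
    proof (rule DG(8))
      show "v (d (Suc n) x) \<in> carrier (G (Suc n))" by (rule mod_homD(3)[OF v(1) dF[OF x]])
      show "d' n (v (d (Suc n) x)) = \<zero>\<^bsub>G n\<^esub>"
        using v(2)[OF dF[OF x]] DF(6)[OF x] mod_homD(6)[OF hom] by simp
    qed
    then show ?thesis using v by blast
  qed
  ultimately have "\<exists>u. \<forall>n. ?P n (u n) \<and> ?Q n (u n) (u (Suc n))"
    by (rule dependent_nat_choice)
  then obtain u where u: "\<forall>n. ?P n (u n) \<and> ?Q n (u n) (u (Suc n))" ..
  show thesis
  proof (rule that[of u])
    show "mod_hom R (F i) (G i) (u i)" for i using u[THEN spec[of _ i]] by (elim conjE)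
    show "\<epsilon>' (u 0 x) = \<phi> (\<epsilon> x)" if "x \<in> carrier (F 0)" for x
      using u[THEN spec[of _ 0]] that by simp
    show "d' i (u (Suc i) x) = u i (d i x)" if "x \<in> carrier (F (Suc i))" for i x
      using u[THEN spec[of _ i]] that by simp
  qed
qed

text \<open>
  A chain map over zero is null-homotopic. In the recursion the component \<open>h\<close> constructed last
  satisfies \<open>d' h d = u d\<close>, so that \<open>u - h d\<close> takes its values in the cycles one degree higher and can
  be lifted through the next differential.
\<close>

lemma resolution_homotopy:
  assumes F: "free_resolution R M F d \<epsilon>" and G: "free_resolution R N G d' \<epsilon>'"
    and u: "\<And>i. mod_hom R (F i) (G i) (u i)"
    and u0: "\<And>x. x \<in> carrier (F 0) \<Longrightarrow> \<epsilon>' (u 0 x) = \<zero>\<^bsub>N\<^esub>"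
    and ud: "\<And>i x. x \<in> carrier (F (Suc i)) \<Longrightarrow> d' i (u (Suc i) x) = u i (d i x)"
  obtains h where "\<And>i. mod_hom R (F i) (G (Suc i)) (h i)"
    and "\<And>x. x \<in> carrier (F 0) \<Longrightarrow> u 0 x = d' 0 (h 0 x)"
    and "\<And>i x. x \<in> carrier (F (Suc i)) \<Longrightarrow>
      u (Suc i) x \<ominus>\<^bsub>G (Suc i)\<^esub> h i (d i x) = d' (Suc i) (h (Suc i) x)"
proof -
  note DF = free_resolutionD[OF F] and DG = free_resolutionD[OF G]
  have dF: "d i x \<in> carrier (F i)" if "x \<in> carrier (F (Suc i))" for i x
    by (rule mod_homD(3)[OF DF(2) that])
  let ?P = "\<lambda>n h. mod_hom R (F n) (G (Suc n)) h \<and> (n = 0 \<longrightarrow> (\<forall>x\<in>carrier (F 0). u 0 x = d' 0 (h x))) \<and>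
      (\<forall>x\<in>carrier (F (Suc n)). d' n (h (d n x)) = u n (d n x))"
  let ?Q = "\<lambda>n h h'. \<forall>x\<in>carrier (F (Suc n)). u (Suc n) x \<ominus>\<^bsub>G (Suc n)\<^esub> h (d n x) = d' (Suc n) (h' x)"
  have "\<exists>h. ?P 0 h"
  proof -
    have im0: "u 0 x \<in> d' 0 ` carrier (G (Suc 0))" if "x \<in> carrier (F 0)" for x
      by (rule DG(7)[OF mod_homD(3)[OF u that] u0[OF that]])
    obtain h where h: "mod_hom R (F 0) (G (Suc 0)) h" "\<And>x. x \<in> carrier (F 0) \<Longrightarrow> d' 0 (h x) = u 0 x"
      by (rule free_module_lift[OF DF(1)[of 0] DG(2)[of 0] u[of 0] im0]) blast+
    moreover have "\<forall>x\<in>carrier (F (Suc 0)). d' 0 (h (d 0 x)) = u 0 (d 0 x)"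
      using h(2) dF by simp
    ultimately show ?thesis by (intro exI[of _ h]) simp
  qed
  moreover have "\<exists>h'. ?P (Suc n) h' \<and> ?Q n h h'" if h: "?P n h" for n h
  proof -
    have hom: "mod_hom R (F n) (G (Suc n)) h" using h by blast
    let ?w = "\<lambda>x. u (Suc n) x \<ominus>\<^bsub>G (Suc n)\<^esub> h (d n x)"
    interpret G: Module.module R "G n" by (rule mod_homD(2)[OF u])
    interpret G1: Module.module R "G (Suc n)" by (rule mod_homD(2)[OF u])
    have w: "mod_hom R (F (Suc n)) (G (Suc n)) ?w"
      by (rule mod_hom_diff[OF u mod_hom_comp[OF DF(2) hom]])
    have im: "?w x \<in> d' (Suc n) ` carrier (G (Suc (Suc n)))" if x: "x \<in> carrier (F (Suc n))" for x
    proof (rule DG(8))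
      show "?w x \<in> carrier (G (Suc n))" by (rule mod_homD(3)[OF w x])
      have c: "u (Suc n) x \<in> carrier (G (Suc n))" "h (d n x) \<in> carrier (G (Suc n))"
        "u n (d n x) \<in> carrier (G n)"
        using mod_homD(3)[OF u x] mod_homD(3)[OF hom dF[OF x]] mod_homD(3)[OF u dF[OF x]] by auto
      have "d' n (?w x) = d' n (u (Suc n) x) \<ominus>\<^bsub>G n\<^esub> d' n (h (d n x))"
        by (rule mod_homD(7)[OF DG(2) c(1,2)])
      also have "\<dots> = u n (d n x) \<ominus>\<^bsub>G n\<^esub> u n (d n x)" using ud[OF x] h x by simp
      also have "\<dots> = \<zero>\<^bsub>G n\<^esub>" using c(3) by (simp add: G.minus_eq_zero_iff)
      finally show "d' n (?w x) = \<zero>\<^bsub>G n\<^esub>" .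
    qed
    obtain h' where h': "mod_hom R (F (Suc n)) (G (Suc (Suc n))) h'"
      "\<And>x. x \<in> carrier (F (Suc n)) \<Longrightarrow> d' (Suc n) (h' x) = ?w x"
      by (rule free_module_lift[OF DF(1)[of "Suc n"] DG(2)[of "Suc n"] w im]) blast+
    have "d' (Suc n) (h' (d (Suc n) x)) = u (Suc n) (d (Suc n) x)"
      if x: "x \<in> carrier (F (Suc (Suc n)))" for x
      using h'(2)[OF dF[OF x]] DF(6)[OF x] mod_homD(6)[OF hom] mod_homD(3)[OF u dF[OF x]]
      by (simp add: a_minus_def)
    then show ?thesis using h' by (intro exI[of _ h']) simp
  qed
  ultimately have "\<exists>h. \<forall>n. ?P n (h n) \<and> ?Q n (h n) (h (Suc n))"
    by (rule dependent_nat_choice)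
  then obtain h where h: "\<forall>n. ?P n (h n) \<and> ?Q n (h n) (h (Suc n))" ..
  show thesis
  proof (rule that[of h])
    show "mod_hom R (F i) (G (Suc i)) (h i)" for i using h[THEN spec[of _ i]] by (elim conjE)
    show "u 0 x = d' 0 (h 0 x)" if "x \<in> carrier (F 0)" for x
      using h[THEN spec[of _ 0]] that by simp
    show "u (Suc i) x \<ominus>\<^bsub>G (Suc i)\<^esub> h i (d i x) = d' (Suc i) (h (Suc i) x)"
      if "x \<in> carrier (F (Suc i))" for i x
      using h[THEN spec[of _ i]] that by simp
  qed
qed

text \<open>
  Provides a resolution in the type over which \<open>Tor\<close> chooses: the terms of a given resolution need only
  inject into that type.
\<close>

lemma free_resolution_transport:
  assumes G: "free_resolution R M G d \<epsilon>" and inj: "\<And>i. inj_on (e i) (carrier (G i))"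
    and one: "\<one>\<^bsub>R\<^esub> \<noteq> \<zero>\<^bsub>R\<^esub>"
  shows "\<exists>d' \<epsilon>'. free_resolution R M (\<lambda>i. transport (e i) (G i)) d' \<epsilon>'"
proof -
  note D = free_resolutionD[OF G]
  let ?F = "\<lambda>i. transport (e i) (G i)"
  let ?c = "\<lambda>i. inv_into (carrier (G i)) (e i)"
  have Gm: "Module.module R (G i)" for i by (rule mod_homD(2)[OF D(2)])
  note e = transport_hom[OF Gm inj]
  note c = mod_hom_inv_into[OF e]
  have carr: "carrier (?F i) = e i ` carrier (G i)" for i by (simp add: transport_def)
  have ce: "?c i (e i x) = x" if "x \<in> carrier (G i)" for i x
    by (rule inv_into_f_f[OF inj that])
  have ez: "e i x = \<zero>\<^bsub>?F i\<^esub> \<longleftrightarrow> x = \<zero>\<^bsub>G i\<^esub>" if "x \<in> carrier (G i)" for i x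
  proof -
    interpret Module.module R "G i" by (rule Gm)
    show ?thesis using inj_onD[OF inj, of i x "\<zero>\<^bsub>G i\<^esub>"] that by (auto simp: transport_def)
  qed
  have ez0: "e i \<zero>\<^bsub>G i\<^esub> = \<zero>\<^bsub>?F i\<^esub>" for i by (simp add: transport_def)
  have dG: "d i x \<in> carrier (G i)" if "x \<in> carrier (G (Suc i))" for i x
    by (rule mod_homD(3)[OF D(2) that])
  let ?d = "\<lambda>i x. e i (d i (?c (Suc i) x))" and ?\<epsilon> = "\<lambda>x. \<epsilon> (?c 0 x)"
  have img: "?d i ` carrier (?F (Suc i)) = e i ` d i ` carrier (G (Suc i))" for i
    unfolding carr image_image by (intro image_cong refl) (simp add: ce)
  have ker0: "a_kernel (?F 0) M ?\<epsilon> = e 0 ` a_kernel (G 0) M \<epsilon>"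
    unfolding a_kernel_def' carr by (auto simp: ce)
  have kerS: "a_kernel (?F (Suc i)) (?F i) (?d i) = e (Suc i) ` a_kernel (G (Suc i)) (G i) (d i)" for i
    unfolding a_kernel_def' carr by (auto simp: ce ez ez0 dG)
  have "free_resolution R M ?F ?d ?\<epsilon>"
    unfolding free_resolution_def
  proof (intro conjI allI)
    show "is_free_module R (?F i)" for i by (rule is_free_module_iso[OF D(1) e one])
    show "mod_hom R (?F (Suc i)) (?F i) (?d i)" for i
      by (rule mod_hom_comp[OF mod_hom_comp[OF c D(2)] e(1)])
    show "mod_hom R (?F 0) M ?\<epsilon>" by (rule mod_hom_comp[OF c D(3)])
    show "?\<epsilon> ` carrier (?F 0) = carrier M"
      unfolding carr image_image D(4)[symmetric] by (intro image_cong refl) (simp add: ce)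
    show "?d 0 ` carrier (?F (Suc 0)) = a_kernel (?F 0) M ?\<epsilon>"
      unfolding img ker0 using G by (simp add: free_resolution_def)
    show "?d (Suc i) ` carrier (?F (Suc (Suc i))) = a_kernel (?F (Suc i)) (?F i) (?d i)" for i
      unfolding img kerS using G by (simp add: free_resolution_def)
  qed
  then show ?thesis by blast
qed

section \<open>Tensoring with the residue field\<close>

text \<open>
  For evaluation of polynomials at the origin this is \<open>residue_module\<close>.
\<close>

definition residue :: "('a \<Rightarrow> 'k::field) \<Rightarrow> ('a, 'k) module" where
  "residue aug = \<lparr> carrier = UNIV, mult = undefined, one = undefined, zero = 0, add = (+),
       smult = (\<lambda>p c. aug p * c) \<rparr>"

lemma residue_simps [simp]:
  "carrier (residue aug) = UNIV" "a \<oplus>\<^bsub>residue aug\<^esub> b = a + b" "r \<odot>\<^bsub>residue aug\<^esub> b = aug r * b"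
  by (simp_all add: residue_def)

lemma tensor_relationsI:
  fixes R :: "('a, 'r) ring_scheme" and M :: "('a, 'm) module" and K :: "('a, 'n) module"
  defines "T \<equiv> tensor_free R M K" and "e \<equiv> free_gen R :: 'm \<times> 'n \<Rightarrow> 'm \<times> 'n \<Rightarrow> 'a"
  assumes x: "x \<in> carrier M" and c: "c \<in> carrier K"
  shows "x' \<in> carrier M \<Longrightarrow>
      e (x \<oplus>\<^bsub>M\<^esub> x', c) \<ominus>\<^bsub>T\<^esub> (e (x, c) \<oplus>\<^bsub>T\<^esub> e (x', c)) \<in> tensor_relations R M K"
    and "r \<in> carrier R \<Longrightarrow> e (r \<odot>\<^bsub>M\<^esub> x, c) \<ominus>\<^bsub>T\<^esub> r \<odot>\<^bsub>T\<^esub> e (x, c) \<in> tensor_relations R M K"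
    and "r \<in> carrier R \<Longrightarrow> e (x, r \<odot>\<^bsub>K\<^esub> c) \<ominus>\<^bsub>T\<^esub> r \<odot>\<^bsub>T\<^esub> e (x, c) \<in> tensor_relations R M K"
  unfolding tensor_relations_def Let_def T_def e_def
  subgoal by (rule UnI1, rule UnI1, rule UnI1, rule CollectI, intro exI conjI, rule refl) (use x c in auto)
  subgoal by (rule UnI1, rule UnI2, rule CollectI, intro exI conjI, rule refl) (use x c in auto)
  subgoal by (rule UnI2, rule CollectI, intro exI conjI, rule refl) (use x c in auto)
  done

lemma tensor_relationsE:
  assumes "f \<in> tensor_relations R M K"
  obtains (add1) x x' c where "x \<in> carrier M" "x' \<in> carrier M" "c \<in> carrier K"
      "f = free_gen R (x \<oplus>\<^bsub>M\<^esub> x', c) \<ominus>\<^bsub>tensor_free R M K\<^esub>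
        (free_gen R (x, c) \<oplus>\<^bsub>tensor_free R M K\<^esub> free_gen R (x', c))"
  | (add2) x c c' where "x \<in> carrier M" "c \<in> carrier K" "c' \<in> carrier K"
      "f = free_gen R (x, c \<oplus>\<^bsub>K\<^esub> c') \<ominus>\<^bsub>tensor_free R M K\<^esub>
        (free_gen R (x, c) \<oplus>\<^bsub>tensor_free R M K\<^esub> free_gen R (x, c'))"
  | (smult1) r x c where "r \<in> carrier R" "x \<in> carrier M" "c \<in> carrier K"
      "f = free_gen R (r \<odot>\<^bsub>M\<^esub> x, c) \<ominus>\<^bsub>tensor_free R M K\<^esub>
        r \<odot>\<^bsub>tensor_free R M K\<^esub> free_gen R (x, c)"
  | (smult2) r x c where "r \<in> carrier R" "x \<in> carrier M" "c \<in> carrier K"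
      "f = free_gen R (x, r \<odot>\<^bsub>K\<^esub> c) \<ominus>\<^bsub>tensor_free R M K\<^esub>
        r \<odot>\<^bsub>tensor_free R M K\<^esub> free_gen R (x, c)"
  using assms unfolding tensor_relations_def Let_def
  by (elim UnE CollectE exE conjE)
    (rule add1, assumption+ | rule add2, assumption+ | rule smult1, assumption+ | rule smult2, assumption+)+

text \<open>
  A ring \<open>R\<close> with a homomorphism \<open>aug\<close> to a field that is split by \<open>cst\<close>: for a polynomial ring, the
  constant term and the constant polynomials. The splitting makes every \<open>R\<close>-module a vector space.
  In the comments \<open>\<mm>\<close> denotes the kernel of \<open>aug\<close>.
\<close>

locale augmented_ring = cring R for R (structure) +
  fixes aug :: "'a \<Rightarrow> 'k::field" and cst :: "'k \<Rightarrow> 'a"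
  assumes aug_one: "aug \<one> = 1"
    and aug_add: "x \<in> carrier R \<Longrightarrow> y \<in> carrier R \<Longrightarrow> aug (x \<oplus> y) = aug x + aug y"
    and aug_mult: "x \<in> carrier R \<Longrightarrow> y \<in> carrier R \<Longrightarrow> aug (x \<otimes> y) = aug x * aug y"
    and cst_closed [simp]: "cst c \<in> carrier R"
    and cst_one [simp]: "cst 1 = \<one>"
    and cst_add: "cst (c + c') = cst c \<oplus> cst c'"
    and cst_mult: "cst (c * c') = cst c \<otimes> cst c'"
    and aug_cst [simp]: "aug (cst c) = c"
begin

lemma cst_zero [simp]: "cst 0 = \<zero>"
  using cst_add[of 0 0] by (metis add.l_cancel_one' add_0 cst_closed)

lemma aug_zero [simp]: "aug \<zero> = 0"
  using aug_cst[of 0] by simp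

lemma one_neq_zero: "\<one> \<noteq> \<zero>"
  using aug_one aug_zero by auto

lemma aug_minus: "x \<in> carrier R \<Longrightarrow> y \<in> carrier R \<Longrightarrow> aug (x \<ominus> y) = aug x - aug y"
  using aug_add[of "x \<ominus> y" y] by (simp add: a_minus_def a_assoc l_neg)

text \<open>
  The submodule \<open>\<mm>M\<close>, generated by adding multiples \<open>r \<odot> x\<close> with \<open>r\<close> in \<open>\<mm>\<close> one at a time.
\<close>

inductive_set aug_sub :: "('a, 'm, 'q) module_scheme \<Rightarrow> 'm set" for M where
  zero: "\<zero>\<^bsub>M\<^esub> \<in> aug_sub M"
| step: "r \<in> carrier R \<Longrightarrow> aug r = 0 \<Longrightarrow> x \<in> carrier M \<Longrightarrow> y \<in> aug_sub M \<Longrightarrow>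
    r \<odot>\<^bsub>M\<^esub> x \<oplus>\<^bsub>M\<^esub> y \<in> aug_sub M"

lemma aug_sub_carrier:
  assumes "Module.module R M" "x \<in> aug_sub M"
  shows "x \<in> carrier M"
proof -
  interpret M: Module.module R M by fact
  show ?thesis using assms(2) by induction auto
qed

lemma aug_sub_add:
  assumes M: "Module.module R M" and x: "x \<in> aug_sub M" and y: "y \<in> aug_sub M"
  shows "x \<oplus>\<^bsub>M\<^esub> y \<in> aug_sub M"
proof -
  interpret M: Module.module R M by fact
  have yM: "y \<in> carrier M" by (rule aug_sub_carrier[OF M y])
  show ?thesis using x
  proof induction
    case zero
    then show ?case using y yM by simp
  next
    case (step r x z)
    then show ?case using aug_sub.step[OF step(1-3,5)] yM aug_sub_carrier[OF M step(4)]
      by (simp add: M.a_assoc)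
  qed
qed

lemma aug_sub_smult:
  assumes M: "Module.module R M" and r: "r \<in> carrier R" "aug r = 0" and x: "x \<in> carrier M"
  shows "r \<odot>\<^bsub>M\<^esub> x \<in> aug_sub M"
proof -
  interpret M: Module.module R M by fact
  show ?thesis using aug_sub.step[OF r x aug_sub.zero] r x by simp
qed

lemma aug_sub_submodule:
  assumes M: "Module.module R M"
  shows "submodule R (aug_sub M) M"
proof -
  interpret M: Module.module R M by fact
  have sm: "s \<odot>\<^bsub>M\<^esub> x \<in> aug_sub M" if s: "s \<in> carrier R" and x: "x \<in> aug_sub M" for s x
    using x
  proof induction
    case zero
    then show ?case using s by (simp add: aug_sub.zero)
  next
    case (step r x z)
    have "s \<odot>\<^bsub>M\<^esub> (r \<odot>\<^bsub>M\<^esub> x \<oplus>\<^bsub>M\<^esub> z) = (s \<otimes> r) \<odot>\<^bsub>M\<^esub> x \<oplus>\<^bsub>M\<^esub> s \<odot>\<^bsub>M\<^esub> z"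
      using step s aug_sub_carrier[OF M step(4)] by (simp add: M.smult_r_distr M.smult_assoc1)
    then show ?case using step s by (auto intro!: aug_sub.step simp: aug_mult)
  qed
  show ?thesis
    by (rule submodule.intro[OF M])
      (auto intro: aug_sub.zero aug_sub_add[OF M] sm aug_sub_carrier[OF M])
qed

lemma aug_sub_minus:
  assumes M: "Module.module R M" and "x \<in> aug_sub M" "y \<in> aug_sub M"
  shows "x \<ominus>\<^bsub>M\<^esub> y \<in> aug_sub M"
proof -
  interpret A: abelian_subgroup "aug_sub M" M
    by (rule submodule_abelian_subgroup[OF aug_sub_submodule[OF M]])
  show ?thesis using assms by (simp add: a_minus_def)
qed

lemma aug_sub_hom:
  assumes f: "mod_hom R M N f" and x: "x \<in> aug_sub M"
  shows "f x \<in> aug_sub N"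
  using x
proof induction
  case zero
  then show ?case using mod_homD(6)[OF f] by (simp add: aug_sub.zero)
next
  case (step r x y)
  note [simp] = Module.module.smult_closed[OF mod_homD(1)[OF f]]
  have "f (r \<odot>\<^bsub>M\<^esub> x \<oplus>\<^bsub>M\<^esub> y) = r \<odot>\<^bsub>N\<^esub> f x \<oplus>\<^bsub>N\<^esub> f y"
    using step aug_sub_carrier[OF mod_homD(1)[OF f] step(4)] by (simp add: mod_homD[OF f])
  then show ?case using step mod_homD(3)[OF f] by (auto intro: aug_sub.step)
qed

abbreviation tfree where "tfree M \<equiv> tensor_free R M (residue aug)"
abbreviation trel where "trel M \<equiv> tensor_rel_module R M (residue aug)"
abbreviation tens where "tens M \<equiv> tensor R M (residue aug)"

text \<open>
  The class of \<open>x \<otimes> 1\<close>.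
\<close>

definition tensor_one :: "('a, 'm) module \<Rightarrow> 'm \<Rightarrow> ('m \<times> 'k \<Rightarrow> 'a) set" where
  "tensor_one M x = trel M +>\<^bsub>tfree M\<^esub> free_gen R (x, 1)"

context
  fixes M :: "('a, 'm) module"
  assumes M: "Module.module R M"
begin

lemma tfree_module: "Module.module R (tfree M)"
  unfolding tensor_free_def by (rule free_module_module[OF cring_axioms])

lemma tgen_closed: "x \<in> carrier M \<Longrightarrow> free_gen R (x, c) \<in> carrier (tfree M)"
  unfolding tensor_free_def by (rule free_gen_closed[OF cring_axioms]) simp

lemma trelations_carrier: "tensor_relations R M (residue aug) \<subseteq> carrier (tfree M)"
proof -
  interpret M: Module.module R M by (rule M)
  interpret T: Module.module R "tfree M" by (rule tfree_module)
  show ?thesis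
    unfolding tensor_relations_def Let_def
    by (auto intro!: T.minus_closed T.add.m_closed T.smult_closed tgen_closed)
qed

lemma trel_submodule: "submodule R (trel M) (tfree M)"
proof -
  interpret T: Module.module R "tfree M" by (rule tfree_module)
  show ?thesis
    unfolding tensor_rel_module_def by (rule T.span_is_submodule[OF trelations_carrier])
qed

lemma trel_base:
  assumes "f \<in> tensor_relations R M (residue aug)"
  shows "f \<in> trel M"
proof -
  interpret T: Module.module R "tfree M" by (rule tfree_module)
  show ?thesis
    unfolding tensor_rel_module_def using T.in_own_span[OF trelations_carrier] assms by blast
qed

abbreviation tclass where "tclass f \<equiv> trel M +>\<^bsub>tfree M\<^esub> f"

lemma tclass_hom: "mod_hom R (tfree M) (tens M) tclass"
  and tclass_surj: "tclass ` carrier (tfree M) = carrier (tens M)"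
  and tclass_zero: "f \<in> carrier (tfree M) \<Longrightarrow> tclass f = \<zero>\<^bsub>tens M\<^esub> \<longleftrightarrow> f \<in> trel M"
  using quot_module_hom[OF trel_submodule] by (simp_all add: tensor_def)

lemma tens_module: "Module.module R (tens M)"
  by (rule mod_homD(2)[OF tclass_hom])

lemma tclass_eq:
  assumes "f \<in> carrier (tfree M)" "g \<in> carrier (tfree M)" "f \<ominus>\<^bsub>tfree M\<^esub> g \<in> tensor_relations R M (residue aug)"
  shows "tclass f = tclass g"
proof -
  interpret T: Module.module R "tfree M" by (rule tfree_module)
  interpret Q: Module.module R "tens M" by (rule tens_module)
  have "tclass (f \<ominus>\<^bsub>tfree M\<^esub> g) = \<zero>\<^bsub>tens M\<^esub>"
    using assms tclass_zero[of "f \<ominus>\<^bsub>tfree M\<^esub> g"] trel_base by simp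
  then show ?thesis
    using assms mod_homD(3,7)[OF tclass_hom] by (simp add: Q.minus_eq_zero_iff)
qed

lemma tclass_add1:
  assumes "x \<in> carrier M" "x' \<in> carrier M"
  shows "tclass (free_gen R (x \<oplus>\<^bsub>M\<^esub> x', c)) = tclass (free_gen R (x, c)) \<oplus>\<^bsub>tens M\<^esub> tclass (free_gen R (x', c))"
proof -
  interpret M: Module.module R M by (rule M)
  interpret T: Module.module R "tfree M" by (rule tfree_module)
  note g = tgen_closed[OF assms(1), of c] tgen_closed[OF assms(2), of c]
  have "tclass (free_gen R (x \<oplus>\<^bsub>M\<^esub> x', c)) = tclass (free_gen R (x, c) \<oplus>\<^bsub>tfree M\<^esub> free_gen R (x', c))"
    by (rule tclass_eq)
      (use g assms tgen_closed tensor_relationsI(1)[of _ M c "residue aug" _ R] in auto)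
  then show ?thesis using mod_homD(4)[OF tclass_hom g] by simp
qed

lemma tclass_smult1:
  assumes "r \<in> carrier R" "x \<in> carrier M"
  shows "tclass (free_gen R (r \<odot>\<^bsub>M\<^esub> x, c)) = r \<odot>\<^bsub>tens M\<^esub> tclass (free_gen R (x, c))"
proof -
  interpret M: Module.module R M by (rule M)
  interpret T: Module.module R "tfree M" by (rule tfree_module)
  note g = tgen_closed[OF assms(2), of c]
  have "tclass (free_gen R (r \<odot>\<^bsub>M\<^esub> x, c)) = tclass (r \<odot>\<^bsub>tfree M\<^esub> free_gen R (x, c))"
    by (rule tclass_eq)
      (use g assms tgen_closed tensor_relationsI(2)[of _ M c "residue aug" _ R] in auto)
  then show ?thesis using mod_homD(5)[OF tclass_hom assms(1) g] by simp
qed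

lemma tclass_smult2:
  assumes "r \<in> carrier R" "x \<in> carrier M"
  shows "tclass (free_gen R (x, aug r * c)) = r \<odot>\<^bsub>tens M\<^esub> tclass (free_gen R (x, c))"
proof -
  interpret M: Module.module R M by (rule M)
  interpret T: Module.module R "tfree M" by (rule tfree_module)
  note g = tgen_closed[OF assms(2), of c]
  have "tclass (free_gen R (x, aug r * c)) = tclass (r \<odot>\<^bsub>tfree M\<^esub> free_gen R (x, c))"
    by (rule tclass_eq)
      (use g assms tgen_closed tensor_relationsI(3)[of _ M c "residue aug" _ R] in auto)
  then show ?thesis using mod_homD(5)[OF tclass_hom assms(1) g] by simp
qed

lemma tensor_one_hom: "mod_hom R M (tens M) (tensor_one M)"
proof -
  interpret M: Module.module R M by (rule M)
  interpret T: Module.module R "tfree M" by (rule tfree_module)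
  interpret Q: Module.module R "tens M" by (rule tens_module)
  show ?thesis
    by (rule mod_homI[OF M tens_module])
      (use mod_homD(3)[OF tclass_hom] tgen_closed in \<open>auto simp: tensor_one_def tclass_add1 tclass_smult1\<close>)
qed

text \<open>
  For \<open>r\<close> in \<open>\<mm>\<close> one has \<open>r x \<otimes> 1 = x \<otimes> aug r = x \<otimes> 0 = 0\<close>.
\<close>

lemma tensor_one_aug_sub:
  assumes "x \<in> aug_sub M"
  shows "tensor_one M x = \<zero>\<^bsub>tens M\<^esub>"
proof -
  interpret M: Module.module R M by (rule M)
  interpret Q: Module.module R "tens M" by (rule tens_module)
  show ?thesis
    using assms
  proof induction
    case zero
    then show ?case by (rule mod_homD(6)[OF tensor_one_hom])
  next
    case (step r x y)
    have yM: "y \<in> carrier M" by (rule aug_sub_carrier[OF M step(4)])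
    have "tclass (free_gen R (x, 0)) = \<zero> \<odot>\<^bsub>tens M\<^esub> tclass (free_gen R (x, 0))"
      using tclass_smult2[of \<zero> x 0] step(3) by simp
    also have "\<dots> = \<zero>\<^bsub>tens M\<^esub>" using step(3) mod_homD(3)[OF tclass_hom] tgen_closed by simp
    finally have "r \<odot>\<^bsub>tens M\<^esub> tensor_one M x = \<zero>\<^bsub>tens M\<^esub>"
      using tclass_smult2[of r x 1] step(1-3) by (simp add: tensor_one_def)
    then show ?case using step mod_homD[OF tensor_one_hom] yM by simp
  qed
qed

text \<open>
  The map \<open>x \<otimes> c \<mapsto> c x\<close> on the free module of formal sums, before any relations are imposed. It inverts
  \<open>tensor_one\<close> up to \<open>\<mm>M\<close>.
\<close>

definition contract :: "('m \<times> 'k \<Rightarrow> 'a) \<Rightarrow> 'm" where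
  "contract = free_ext R M (\<lambda>p. cst (snd p) \<odot>\<^bsub>M\<^esub> fst p)"

lemma contract_hom: "mod_hom R (tfree M) M contract"
proof -
  interpret M: Module.module R M by (rule M)
  show ?thesis
    unfolding contract_def tensor_free_def by (rule free_ext_hom[OF M]) auto
qed

lemma contract_gen:
  assumes "x \<in> carrier M"
  shows "contract (free_gen R (x, c)) = cst c \<odot>\<^bsub>M\<^esub> x"
proof -
  interpret M: Module.module R M by (rule M)
  show ?thesis
    unfolding contract_def
    by (subst free_ext_gen[OF M, where B = "carrier M \<times> UNIV"]) (use assms in auto)
qed

lemma tensor_free_hom_eqI:
  assumes "mod_hom R (tfree M) N h" "mod_hom R (tfree M) N h'"
    and "\<And>x c. x \<in> carrier M \<Longrightarrow> h (free_gen R (x, c)) = h' (free_gen R (x, c))"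
    and "f \<in> carrier (tfree M)"
  shows "h f = h' f"
  by (rule free_hom_eqI[OF assms(1,2)[unfolded tensor_free_def] _ assms(4)[unfolded tensor_free_def]])
    (use assms(3) in auto)

text \<open>
  Both sides are linear in \<open>f\<close>, and on a generator the claim is \<open>x \<otimes> c = c x \<otimes> 1\<close>.
\<close>

lemma tclass_contract:
  assumes "f \<in> carrier (tfree M)"
  shows "tclass f = tensor_one M (contract f)"
proof -
  interpret M: Module.module R M by (rule M)
  interpret Q: Module.module R "tens M" by (rule tens_module)
  show ?thesis
  proof (rule tensor_free_hom_eqI[OF tclass_hom mod_hom_comp[OF contract_hom tensor_one_hom] _ assms])
    fix x c assume x: "x \<in> carrier M"
    have "tclass (free_gen R (x, c)) = cst c \<odot>\<^bsub>tens M\<^esub> tclass (free_gen R (x, 1))"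
      using tclass_smult2[of "cst c" x 1] x by simp
    also have "\<dots> = tensor_one M (contract (free_gen R (x, c)))"
      using x by (simp add: contract_gen tensor_one_def tclass_smult1)
    finally show "tclass (free_gen R (x, c)) = tensor_one M (contract (free_gen R (x, c)))" .
  qed
qed

lemma tensor_one_surj: "tensor_one M ` carrier M = carrier (tens M)"
proof
  show "tensor_one M ` carrier M \<subseteq> carrier (tens M)" using mod_homD(3)[OF tensor_one_hom] by (rule image_subsetI)
  show "carrier (tens M) \<subseteq> tensor_one M ` carrier M"
  proof
    fix X assume "X \<in> carrier (tens M)"
    then obtain f where f: "f \<in> carrier (tfree M)" "X = tclass f"
      unfolding tclass_surj[symmetric] by (rule imageE)
    then show "X \<in> tensor_one M ` carrier M"
      using tclass_contract[OF f(1)] mod_homD(3)[OF contract_hom f(1)] by simp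
  qed
qed


text \<open>
  The bilinear relations contract to zero, except that the relation \<open>x \<otimes> r c = r (x \<otimes> c)\<close> contracts to
  \<open>(aug r - r) c x\<close>, which lies in \<open>\<mm>M\<close>.
\<close>

lemma contract_trel:
  assumes "f \<in> trel M"
  shows "contract f \<in> aug_sub M"
proof -
  interpret M: Module.module R M by (rule M)
  interpret T: Module.module R "tfree M" by (rule tfree_module)
  let ?S = "{f \<in> carrier (tfree M). contract f \<in> aug_sub M}"
  note U = mod_homD[OF contract_hom]
  have zero: "\<zero>\<^bsub>M\<^esub> \<in> aug_sub M" by (rule aug_sub.zero)
  have sub: "submodule R ?S (tfree M)"
    by (rule submodule.intro[OF tfree_module])
      (auto simp: U zero intro: aug_sub_add[OF M] submodule.smult_closed[OF aug_sub_submodule[OF M]])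
  have "f \<in> ?S" if "f \<in> tensor_relations R M (residue aug)" for f
  proof -
    have f: "f \<in> carrier (tfree M)" using that trelations_carrier by blast
    from that have "contract f \<in> aug_sub M"
    proof (cases rule: tensor_relationsE)
      case add1
      then have "contract f = \<zero>\<^bsub>M\<^esub>"
        by (simp add: U tgen_closed contract_gen M.smult_r_distr M.minus_eq_zero_iff)
      then show ?thesis using zero by simp
    next
      case add2
      then have "contract f = \<zero>\<^bsub>M\<^esub>"
        by (simp add: U tgen_closed contract_gen cst_add M.smult_l_distr M.minus_eq_zero_iff)
      then show ?thesis using zero by simp
    next
      case smult1
      then have "contract f = \<zero>\<^bsub>M\<^esub>"
        by (simp add: U tgen_closed contract_gen M.smult_assoc1[symmetric] M.minus_eq_zero_iff m_comm)
      then show ?thesis using zero by simp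
    next
      case (smult2 r x c)
      then have "contract f = cst (aug r * c) \<odot>\<^bsub>M\<^esub> x \<ominus>\<^bsub>M\<^esub> (r \<otimes> cst c) \<odot>\<^bsub>M\<^esub> x"
        by (simp add: U tgen_closed contract_gen M.smult_assoc1[symmetric])
      also have "\<dots> = (cst (aug r * c) \<ominus> r \<otimes> cst c) \<odot>\<^bsub>M\<^esub> x"
        using smult2 by (simp add: a_minus_def M.smult_l_distr M.smult_l_minus)
      finally have "contract f = (cst (aug r * c) \<ominus> r \<otimes> cst c) \<odot>\<^bsub>M\<^esub> x" .
      then show ?thesis using smult2 by (auto intro!: aug_sub_smult[OF M] simp: aug_minus aug_mult)
    qed
    then show ?thesis using f by simp
  qed
  then have "T.span (tensor_relations R M (residue aug)) \<subseteq> ?S"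
    by (intro T.span_is_subset sub) blast
  then show ?thesis using assms unfolding tensor_rel_module_def by blast
qed

text \<open>
  Together with \<open>tensor_one_surj\<close> this says that \<open>x \<mapsto> x \<otimes> 1\<close> induces an isomorphism from \<open>M / \<mm>M\<close> to the
  tensor product with the residue field. The nontrivial direction contracts \<open>x \<otimes> 1\<close> to \<open>x\<close>.
\<close>

lemma tensor_one_eq_zero_iff:
  assumes "x \<in> carrier M"
  shows "tensor_one M x = \<zero>\<^bsub>tens M\<^esub> \<longleftrightarrow> x \<in> aug_sub M"
proof -
  interpret M: Module.module R M by (rule M)
  show ?thesis
  proof
    assume "tensor_one M x = \<zero>\<^bsub>tens M\<^esub>"
    then have "free_gen R (x, 1) \<in> trel M"
      using tclass_zero[OF tgen_closed[OF assms]] by (simp add: tensor_one_def)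
    from contract_trel[OF this] show "x \<in> aug_sub M" using assms by (simp add: contract_gen)
  qed (rule tensor_one_aug_sub)
qed

end

text \<open>
  Naturality of the isomorphism with \<open>M / \<mm>M\<close>. The union in \<open>tensor_map\<close> ranges over all
  representatives \<open>f\<close> of \<open>x \<otimes> 1\<close>. These contract to elements congruent to \<open>x\<close> modulo \<open>\<mm>M\<close>, so their images
  all represent \<open>\<phi> x \<otimes> 1\<close>.
\<close>

lemma tensor_map_tensor_one:
  assumes phi: "mod_hom R M M' \<phi>" and x: "x \<in> carrier M"
  shows "tensor_map R (residue aug) M' \<phi> (tensor_one M x) = tensor_one M' (\<phi> x)"
proof -
  note M = mod_homD(1)[OF phi] and M' = mod_homD(2)[OF phi]
  interpret M: Module.module R M by (rule M)
  interpret T: abelian_subgroup "trel M" "tfree M"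
    by (rule submodule_abelian_subgroup[OF trel_submodule[OF M]])
  interpret Q: Module.module R "tens M" by (rule tens_module[OF M])
  interpret Q': Module.module R "tens M'" by (rule tens_module[OF M'])
  let ?U = "free_ext R (tfree M') (\<lambda>p. free_gen R (\<phi> (fst p), snd p))"
  have n: "free_gen R (\<phi> (fst p), snd p) \<in> carrier (tfree M')"
    if "p \<in> carrier M \<times> carrier (residue aug :: ('a, 'k) module)" for p
    using that by (auto intro!: tgen_closed[OF M'] mod_homD(3)[OF phi])
  have U: "mod_hom R (tfree M) (tfree M') ?U"
    unfolding tensor_free_def[of R M]
    by (rule free_ext_hom[OF tfree_module[OF M'] n])
  have UT: "trel M' +>\<^bsub>tfree M'\<^esub> ?U f = tensor_one M' (\<phi> (contract M f))" if "f \<in> carrier (tfree M)" for f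
  proof (rule tensor_free_hom_eqI[OF M mod_hom_comp[OF U tclass_hom[OF M']]
        mod_hom_comp[OF contract_hom[OF M] mod_hom_comp[OF phi tensor_one_hom[OF M']]] _ that])
    fix y c assume y: "y \<in> carrier M"
    have y': "\<phi> y \<in> carrier M'" by (rule mod_homD(3)[OF phi y])
    have "trel M' +>\<^bsub>tfree M'\<^esub> ?U (free_gen R (y, c)) = trel M' +>\<^bsub>tfree M'\<^esub> free_gen R (\<phi> y, c)"
      by (subst free_ext_gen[OF tfree_module[OF M'] n]) (use y in auto)
    also have "\<dots> = tensor_one M' (cst c \<odot>\<^bsub>M'\<^esub> \<phi> y)"
      by (subst tclass_contract[OF M' tgen_closed[OF M' y']]) (simp add: contract_gen[OF M' y'])
    also have "cst c \<odot>\<^bsub>M'\<^esub> \<phi> y = \<phi> (contract M (free_gen R (y, c)))"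
      by (simp add: y contract_gen[OF M] mod_homD[OF phi])
    finally show "trel M' +>\<^bsub>tfree M'\<^esub> ?U (free_gen R (y, c)) = tensor_one M' (\<phi> (contract M (free_gen R (y, c))))" .
  qed
  have e: "free_gen R (x, 1) \<in> carrier (tfree M)" by (rule tgen_closed[OF M x])
  have "tensor_one M' (\<phi> (contract M f)) = tensor_one M' (\<phi> x)" if f: "f \<in> tensor_one M x" for f
  proof -
    have fT: "f \<in> carrier (tfree M)"
      using f T.a_elemrcos_carrier[OF e] by (simp add: tensor_one_def)
    then have uf: "contract M f \<in> carrier M" by (rule mod_homD(3)[OF contract_hom[OF M]])
    have "tensor_one M (contract M f) = tensor_one M x"
      using tclass_contract[OF M fT] T.a_repr_independence'[OF f[unfolded tensor_one_def] e]
      by (simp add: tensor_one_def)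
    then have "contract M f \<ominus>\<^bsub>M\<^esub> x \<in> aug_sub M"
      using mod_homD[OF tensor_one_hom[OF M]] uf x
      by (subst tensor_one_eq_zero_iff[OF M, symmetric]) (simp_all add: Q.minus_eq_zero_iff)
    from aug_sub_hom[OF phi this] have "\<phi> (contract M f) \<ominus>\<^bsub>M'\<^esub> \<phi> x \<in> aug_sub M'"
      using uf x mod_homD[OF phi] by simp
    from tensor_one_aug_sub[OF M' this] show ?thesis
      using mod_homD[OF tensor_one_hom[OF M']] uf x mod_homD[OF phi] by (simp add: Q'.minus_eq_zero_iff)
  qed
  then have *: "trel M' +>\<^bsub>tfree M'\<^esub> ?U f = tensor_one M' (\<phi> x)" if "f \<in> tensor_one M x" for f
    using UT T.a_elemrcos_carrier[OF e, of f] that by (simp add: tensor_one_def)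
  have "free_gen R (x, 1) \<in> tensor_one M x" unfolding tensor_one_def by (rule T.a_rcos_self[OF e])
  then have "(\<Union>f\<in>tensor_one M x. trel M' +>\<^bsub>tfree M'\<^esub> ?U f) = tensor_one M' (\<phi> x)"
    by (rule UN_constant_eq[OF _ ballI[OF *]])
  then show ?thesis by (simp only: tensor_map_def Let_def free_ext_def)
qed

section \<open>Homology modulo the augmentation ideal\<close>

text \<open>
  A null-homotopic chain map sends a cycle modulo \<open>\<mm>\<close> to a boundary modulo \<open>\<mm>\<close>: in \<open>u = d' h + h d\<close> the
  second summand maps the cycle into \<open>\<mm>\<close>. In degree zero every element is a cycle.
\<close>

lemma null_homotopic_mod_aug_sub:
  assumes F: "free_resolution R M F d \<epsilon>" and G: "free_resolution R N G d' \<epsilon>'"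
    and u: "\<And>i. mod_hom R (F i) (G i) (u i)"
    and u0: "\<And>x. x \<in> carrier (F 0) \<Longrightarrow> \<epsilon>' (u 0 x) = \<zero>\<^bsub>N\<^esub>"
    and ud: "\<And>i x. x \<in> carrier (F (Suc i)) \<Longrightarrow> d' i (u (Suc i) x) = u i (d i x)"
    and x: "x \<in> carrier (F i)" and cyc: "\<And>j. i = Suc j \<Longrightarrow> d j x \<in> aug_sub (F j)"
  shows "\<exists>y\<in>carrier (G (Suc i)). u i x \<ominus>\<^bsub>G i\<^esub> d' i y \<in> aug_sub (G i)"
proof -
  obtain h where h: "\<And>i. mod_hom R (F i) (G (Suc i)) (h i)"
    and h0: "\<And>x. x \<in> carrier (F 0) \<Longrightarrow> u 0 x = d' 0 (h 0 x)"
    and hS: "\<And>i x. x \<in> carrier (F (Suc i)) \<Longrightarrow>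
      u (Suc i) x \<ominus>\<^bsub>G (Suc i)\<^esub> h i (d i x) = d' (Suc i) (h (Suc i) x)"
    by (rule resolution_homotopy[OF F G u u0 ud]) blast+
  interpret G: Module.module R "G i" by (rule mod_homD(2)[OF u])
  have ux: "u i x \<in> carrier (G i)" by (rule mod_homD(3)[OF u x])
  have "u i x \<ominus>\<^bsub>G i\<^esub> d' i (h i x) \<in> aug_sub (G i)"
  proof (cases i)
    case 0
    then have "u i x = d' i (h i x)" using h0 x by simp
    then have "u i x \<ominus>\<^bsub>G i\<^esub> d' i (h i x) = \<zero>\<^bsub>G i\<^esub>"
      using ux by (metis G.minus_eq_zero_iff)
    then show ?thesis by (simp add: aug_sub.zero)
  next
    case (Suc j)
    have "h j (d j x) \<in> aug_sub (G i)"
      unfolding Suc by (rule aug_sub_hom[OF h cyc[OF Suc]])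
    moreover from this have "h j (d j x) \<in> carrier (G i)"
      by (rule aug_sub_carrier[OF mod_homD(2)[OF u]])
    ultimately show ?thesis
      using hS[of x j] x ux G.minus_minus_cancel[of "u i x" "h j (d j x)"] by (simp add: Suc)
  qed
  then show ?thesis using mod_homD(3)[OF h x] by blast
qed

lemma aug_sub_free_moduleD:
  assumes "w \<in> aug_sub (free_module R B)"
  shows "aug (w b) = 0"
  using assms
proof induction
  case (step r x y)
  then have "y \<in> carrier (free_module R B)"
    by (intro aug_sub_carrier[OF free_module_module[OF cring_axioms]])
  then show ?case using step free_moduleD(1)[of x R B b] free_moduleD(1)[of y R B b]
    by (simp add: aug_add aug_mult)
qed simp

text \<open>
  The constant vectors represent all classes modulo \<open>\<mm>\<close>; this uses that \<open>r - cst (aug r)\<close> lies in \<open>\<mm>\<close>.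
\<close>

lemma free_module_aug_decomp:
  assumes "w \<in> carrier (free_module R B)"
  shows "\<exists>m\<in>aug_sub (free_module R B). w = m \<oplus>\<^bsub>free_module R B\<^esub> (\<lambda>b. cst (aug (w b)))"
  using cring_axioms assms
proof (induction rule: free_module_induct)
  case zero
  then show ?case by (intro bexI[OF _ aug_sub.zero]) simp
next
  case (step r b g)
  then obtain m where m: "m \<in> aug_sub (free_module R B)"
    and g: "\<And>c. g c = m c \<oplus> cst (aug (g c))" by (auto simp: fun_eq_iff)
  note e = free_gen_closed[OF cring_axioms step(2)]
  have mR: "m c \<in> carrier R" for c
    by (rule free_moduleD(1)[OF aug_sub_carrier[OF free_module_module[OF cring_axioms] m]])
  have gR: "g c \<in> carrier R" for c by (rule free_moduleD(1)[OF step(3)])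
  let ?m = "(r \<ominus> cst (aug r)) \<odot>\<^bsub>free_module R B\<^esub> free_gen R b \<oplus>\<^bsub>free_module R B\<^esub> m"
  have "?m \<in> aug_sub (free_module R B)"
    using step(1) e m by (intro aug_sub.step) (simp_all add: aug_minus)
  moreover have "r \<otimes> free_gen R b c \<oplus> g c =
      (r \<ominus> cst (aug r)) \<otimes> free_gen R b c \<oplus> m c \<oplus> cst (aug (r \<otimes> free_gen R b c \<oplus> g c))" for c
  proof (cases "c = b")
    case True
    have "r \<oplus> g c = r \<oplus> (m c \<oplus> cst (aug (g c)))" using g[of c] by simp
    also have "\<dots> = r \<ominus> cst (aug r) \<oplus> m c \<oplus> (cst (aug r) \<oplus> cst (aug (g c)))"
    proof -
      have "\<ominus> k \<oplus> m c \<oplus> (k \<oplus> l) = m c \<oplus> l" if "k \<in> carrier R" "l \<in> carrier R" for k l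
      proof -
        have "\<ominus> k \<oplus> m c \<oplus> (k \<oplus> l) = (\<ominus> k \<oplus> k) \<oplus> (m c \<oplus> l)"
          using that mR by (simp only: a_ac add.inv_closed a_closed)
        then show ?thesis using that mR by (simp add: l_neg)
      qed
      then show ?thesis using step(1) mR by (simp add: a_minus_def a_assoc)
    qed
    also have "cst (aug r) \<oplus> cst (aug (g c)) = cst (aug (r \<oplus> g c))"
      using step(1) gR by (simp add: aug_add cst_add)
    finally have "r \<oplus> g c = r \<ominus> cst (aug r) \<oplus> m c \<oplus> cst (aug (r \<oplus> g c))" .
    moreover have "r \<otimes> free_gen R b c = r" "(r \<ominus> cst (aug r)) \<otimes> free_gen R b c = r \<ominus> cst (aug r)"
      using True step(1) by (simp_all add: free_gen_def)
    ultimately show ?thesis by (simp only:)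
  next
    case False
    then show ?thesis using step(1) gR mR g[of c] by (simp add: free_gen_def)
  qed
  ultimately show ?case by (intro bexI[of _ ?m]) simp_all
qed

lemma restrict_scalars_cst_module:
  assumes "Module.module R H"
  shows "Module.module class_ring (restrict_scalars cst H)"
proof -
  interpret H: Module.module R H by fact
  show ?thesis
  proof (rule module_criteria, goal_cases)
    case 4
    show ?case
    proof
      fix v assume "v \<in> carrier (restrict_scalars cst H)"
      then show "\<exists>neg_v\<in>carrier (restrict_scalars cst H).
          v \<oplus>\<^bsub>restrict_scalars cst H\<^esub> neg_v = \<zero>\<^bsub>restrict_scalars cst H\<^esub>"
        by (intro bexI[of _ "\<ominus>\<^bsub>H\<^esub> v"]) (simp_all add: H.r_neg)
    qed
  qed (auto simp: class_cring.cring_axioms H.add.m_ac cst_mult cst_add H.smult_assoc1 H.smult_l_distr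
      H.smult_r_distr)
qed

text \<open>
  The elements of \<open>F\<^sub>i\<close> whose classes are cycles in the complex \<open>F / \<mm>F\<close>.
\<close>

definition tcycles :: "(nat \<Rightarrow> ('a, 'f) module) \<Rightarrow> (nat \<Rightarrow> 'f \<Rightarrow> 'f) \<Rightarrow> nat \<Rightarrow> 'f set" where
  "tcycles F d i = {x \<in> carrier (F i). \<forall>j. i = Suc j \<longrightarrow> d j x \<in> aug_sub (F j)}"

text \<open>
  Since \<open>M \<otimes> K\<close> is \<open>M / \<mm>M\<close> for the residue field \<open>K\<close>, the homology of \<open>F \<otimes> K\<close> consists of the cycles modulo
  \<open>\<mm>\<close> up to boundaries modulo \<open>\<mm>\<close>. The map \<open>\<kappa>\<close> takes \<open>x\<close> to the homology class of \<open>x \<otimes> 1\<close>.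
\<close>

lemma homology_tensor_residue:
  fixes F :: "nat \<Rightarrow> ('a, 'f) module"
    and d :: "nat \<Rightarrow> 'f \<Rightarrow> 'f"
    and i :: nat
  assumes d: "\<And>i. mod_hom R (F (Suc i)) (F i) (d i)"
    and dd: "\<And>i x. x \<in> carrier (F (Suc (Suc i))) \<Longrightarrow> d i (d (Suc i) x) = \<zero>\<^bsub>F i\<^esub>"
  defines "H \<equiv> homology (\<lambda>j. tens (F j)) (\<lambda>j. tensor_map R (residue aug) (F j) (d j)) i"
  obtains \<kappa> where "mod_hom R (F i\<lparr>carrier := tcycles F d i\<rparr>) H \<kappa>" "\<kappa> ` tcycles F d i = carrier H"
    "\<And>x. x \<in> tcycles F d i \<Longrightarrow>
      \<kappa> x = \<zero>\<^bsub>H\<^esub> \<longleftrightarrow> (\<exists>y\<in>carrier (F (Suc i)). x \<ominus>\<^bsub>F i\<^esub> d i y \<in> aug_sub (F i))"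
proof -
  have Fm: "Module.module R (F j)" for j by (rule mod_homD(2)[OF d])
  let ?Z = "tcycles F d i"
  let ?C = "\<lambda>j. tens (F j)"
  let ?D = "\<lambda>j. tensor_map R (residue aug) (F j) (d j)"
  let ?t = "tensor_one (F i)"
  note t = mod_homD[OF tensor_one_hom[OF Fm]]
  note dh = mod_homD[OF d]
  have Zsub: "submodule R ?Z (F i)"
  proof (rule submodule.intro[OF Fm])
    interpret F: Module.module R "F i" by (rule Fm)
    show "?Z \<subseteq> carrier (F i)" by (auto simp: tcycles_def)
    show "\<zero>\<^bsub>F i\<^esub> \<in> ?Z"
      by (auto simp: tcycles_def dh intro: aug_sub.zero)
    show "v \<oplus>\<^bsub>F i\<^esub> w \<in> ?Z" if "v \<in> ?Z" "w \<in> ?Z" for v w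
      using that by (auto simp: tcycles_def dh intro: aug_sub_add[OF Fm])
    show "c \<odot>\<^bsub>F i\<^esub> v \<in> ?Z" if "c \<in> carrier R" "v \<in> ?Z" for c v
      using that by (auto simp: tcycles_def dh intro: submodule.smult_closed[OF aug_sub_submodule[OF Fm]])
  qed
  have Zm: "Module.module R (F i\<lparr>carrier := ?Z\<rparr>)"
    by (rule module.submodule_is_module[OF Fm Zsub])
  have Zc: "x \<in> carrier (F i)" if "x \<in> ?Z" for x using that by (simp add: tcycles_def)
  define Z' where "Z' = (case i of 0 \<Rightarrow> carrier (?C 0) | Suc j \<Rightarrow> a_kernel (?C (Suc j)) (?C j) (?D j))"
  have Z': "Z' = ?t ` ?Z"
  proof (cases i)
    case 0
    then show ?thesis using tensor_one_surj[OF Fm, of 0] by (simp add: Z'_def tcycles_def)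
  next
    case (Suc j)
    have "tensor_one (F i) x \<in> Z' \<longleftrightarrow> x \<in> ?Z" if x: "x \<in> carrier (F i)" for x
    proof -
      have "tensor_one (F i) x \<in> Z' \<longleftrightarrow> tensor_one (F j) (d j x) = \<zero>\<^bsub>?C j\<^esub>"
        using x tensor_map_tensor_one[OF d, of x j] t(3)[OF x]
        by (simp add: Z'_def Suc a_kernel_def')
      also have "\<dots> \<longleftrightarrow> x \<in> ?Z"
        using x tensor_one_eq_zero_iff[OF Fm dh(3), of x j] by (simp add: tcycles_def Suc)
      finally show ?thesis .
    qed
    moreover have "Z' \<subseteq> tensor_one (F i) ` carrier (F i)"
      unfolding tensor_one_surj[OF Fm] by (auto simp: Z'_def Suc a_kernel_def')
    ultimately show ?thesis using Zc by blast
  qed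
  let ?C' = "?C i\<lparr>carrier := Z'\<rparr>"
  have tZ: "mod_hom R (F i\<lparr>carrier := ?Z\<rparr>) ?C' ?t"
    by (rule module_image[OF Zm]) (auto simp: Z' t Zc)
  let ?I = "?D i ` carrier (?C (Suc i))"
  have I: "?I = (\<lambda>y. ?t (d i y)) ` carrier (F (Suc i))"
    unfolding tensor_one_surj[OF Fm, symmetric] image_image
    by (intro image_cong refl tensor_map_tensor_one[OF d])
  have dZ: "d i y \<in> ?Z" if "y \<in> carrier (F (Suc i))" for y
    using that dd by (auto simp: tcycles_def dh intro: aug_sub.zero)
  have bd: "mod_hom R (F (Suc i)) ?C' (\<lambda>y. ?t (d i y))"
    by (rule mod_homI[OF Fm mod_homD(2)[OF tZ]]) (auto simp: Z' t dh dZ)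
  have sub: "submodule R ?I ?C'"
    unfolding I using mod_hom.im_is_submodule[OF bd] unfolding mod_hom.im_def[OF bd] .
  have H: "H = quot_module ?C' ?I"
    unfolding H_def homology_def Z'_def ..
  let ?p = "\<lambda>X. ?I +>\<^bsub>?C'\<^esub> X"
  note q = quot_module_hom[OF sub, folded H]
  show thesis
  proof (rule that[of "\<lambda>x. ?p (?t x)"])
    show "mod_hom R (F i\<lparr>carrier := ?Z\<rparr>) H (\<lambda>x. ?p (?t x))"
      by (rule mod_hom_comp[OF tZ q(1)])
    show "(\<lambda>x. ?p (?t x)) ` ?Z = carrier H"
      using q(2) by (simp add: Z' image_image)
    fix x assume x: "x \<in> ?Z"
    interpret F: Module.module R "F i" by (rule Fm)
    interpret C: Module.module R "?C i" by (rule tens_module[OF Fm])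
    have "?p (?t x) = \<zero>\<^bsub>H\<^esub> \<longleftrightarrow> ?t x \<in> ?I"
      by (rule q(3)) (use x Z' in auto)
    also have "\<dots> \<longleftrightarrow> (\<exists>y\<in>carrier (F (Suc i)). ?t x = ?t (d i y))"
      unfolding I by blast
    also have "\<dots> \<longleftrightarrow> (\<exists>y\<in>carrier (F (Suc i)). x \<ominus>\<^bsub>F i\<^esub> d i y \<in> aug_sub (F i))"
    proof (rule bex_cong[OF refl])
      fix y assume "y \<in> carrier (F (Suc i))"
      then have y: "d i y \<in> carrier (F i)" by (rule dh)
      show "?t x = ?t (d i y) \<longleftrightarrow> x \<ominus>\<^bsub>F i\<^esub> d i y \<in> aug_sub (F i)"
        using Zc[OF x] y t by (subst tensor_one_eq_zero_iff[OF Fm, symmetric]) (simp_all add: C.minus_eq_zero_iff)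
    qed
    finally show "?p (?t x) = \<zero>\<^bsub>H\<^esub> \<longleftrightarrow> (\<exists>y\<in>carrier (F (Suc i)). x \<ominus>\<^bsub>F i\<^esub> d i y \<in> aug_sub (F i))" .
  qed
qed

text \<open>
  Let \<open>f : F \<rightarrow> G\<close> and \<open>g : G \<rightarrow> F\<close> be chain maps over the identity. The isomorphism sends a constant vector
  \<open>c\<close> of \<open>G\<^sub>i\<close> to the class of \<open>g c\<close>; minimality of \<open>G\<close> makes \<open>g c\<close> a cycle modulo \<open>\<mm>\<close>. If this class is
  zero, then \<open>f g c\<close> lies in \<open>\<mm>G\<close>, again by minimality, and so does \<open>c\<close>, because \<open>f g\<close> is homotopic to
  the identity. A constant vector in \<open>\<mm>G\<close> is zero. Conversely a cycle \<open>x\<close> has the same class as \<open>g f x\<close>,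
  hence as \<open>g c\<close> for the constant part \<open>c\<close> of \<open>f x\<close>.
\<close>

lemma edim_homology_minimal:
  fixes F :: "nat \<Rightarrow> ('a, 'f) module" and B :: "nat \<Rightarrow> 'g set"
  assumes F: "free_resolution R M F d \<epsilon>"
    and G: "free_resolution R M (\<lambda>i. free_module R (B i)) d' \<epsilon>'"
    and min: "\<And>i w. w \<in> carrier (free_module R (B (Suc i))) \<Longrightarrow> d' i w \<in> aug_sub (free_module R (B i))"
    and fin: "finite (B i)"
  shows "edim class_ring (restrict_scalars cst
      (homology (\<lambda>j. tens (F j)) (\<lambda>j. tensor_map R (residue aug) (F j) (d j)) i)) = enat (card (B i))"
proof -
  let ?G = "\<lambda>i. free_module R (B i)"
  let ?H = "homology (\<lambda>j. tens (F j)) (\<lambda>j. tensor_map R (residue aug) (F j) (d j)) i"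
  note DF = free_resolutionD[OF F] and DG = free_resolutionD[OF G]
  have M: "Module.module R M" by (rule mod_homD(2)[OF DF(3)])
  have Fm: "Module.module R (F j)" for j by (rule mod_homD(2)[OF DF(2)])
  have Gm: "Module.module R (?G j)" for j by (rule free_module_module[OF cring_axioms])
  interpret Fi: Module.module R "F i" by (rule Fm)
  interpret Gi: Module.module R "?G i" by (rule Gm)
  obtain f where f: "\<And>i. mod_hom R (F i) (?G i) (f i)"
    and f0: "\<And>x. x \<in> carrier (F 0) \<Longrightarrow> \<epsilon>' (f 0 x) = \<epsilon> x"
    and fd: "\<And>i x. x \<in> carrier (F (Suc i)) \<Longrightarrow> d' i (f (Suc i) x) = f i (d i x)"
    by (rule resolution_lift[OF F G mod_hom_id[OF M]]) blast
  obtain g where g: "\<And>i. mod_hom R (?G i) (F i) (g i)"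
    and g0: "\<And>x. x \<in> carrier (?G 0) \<Longrightarrow> \<epsilon> (g 0 x) = \<epsilon>' x"
    and gd: "\<And>i x. x \<in> carrier (?G (Suc i)) \<Longrightarrow> d i (g (Suc i) x) = g i (d' i x)"
    by (rule resolution_lift[OF G F mod_hom_id[OF M]]) blast
  note fh = mod_homD[OF f] and gh = mod_homD[OF g]
  note dh = mod_homD[OF DF(2)] and dh' = mod_homD[OF DG(2)]
  have gf: "\<exists>y\<in>carrier (F (Suc i)). (g i (f i x) \<ominus>\<^bsub>F i\<^esub> x) \<ominus>\<^bsub>F i\<^esub> d i y \<in> aug_sub (F i)"
    if x: "x \<in> tcycles F d i" for x
  proof (rule null_homotopic_mod_aug_sub[OF F F, where u = "\<lambda>i x. g i (f i x) \<ominus>\<^bsub>F i\<^esub> x"])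
    show "mod_hom R (F i) (F i) (\<lambda>x. g i (f i x) \<ominus>\<^bsub>F i\<^esub> x)" for i
      by (rule mod_hom_diff[OF mod_hom_comp[OF f g] mod_hom_id[OF Fm]])
    show "\<epsilon> (g 0 (f 0 x) \<ominus>\<^bsub>F 0\<^esub> x) = \<zero>\<^bsub>M\<^esub>" if x: "x \<in> carrier (F 0)" for x
    proof -
      interpret M: Module.module R M by (rule M)
      show ?thesis using x mod_homD(3,7)[OF DF(3)] f0 g0 fh gh
        by (simp add: M.minus_eq_zero_iff)
    qed
    show "d i (g (Suc i) (f (Suc i) x) \<ominus>\<^bsub>F (Suc i)\<^esub> x) = g i (f i (d i x)) \<ominus>\<^bsub>F i\<^esub> d i x"
      if "x \<in> carrier (F (Suc i))" for i x
      using that by (simp add: dh(7) fh(3) gh(3) gd fd)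
  qed (use x in \<open>auto simp: tcycles_def\<close>)
  have fg: "\<exists>y\<in>carrier (?G (Suc i)). (f i (g i x) \<ominus>\<^bsub>?G i\<^esub> x) \<ominus>\<^bsub>?G i\<^esub> d' i y \<in> aug_sub (?G i)"
    if x: "x \<in> carrier (?G i)" for x
  proof (rule null_homotopic_mod_aug_sub[OF G G, where u = "\<lambda>i x. f i (g i x) \<ominus>\<^bsub>?G i\<^esub> x"])
    show "mod_hom R (?G i) (?G i) (\<lambda>x. f i (g i x) \<ominus>\<^bsub>?G i\<^esub> x)" for i
      by (rule mod_hom_diff[OF mod_hom_comp[OF g f] mod_hom_id[OF Gm]])
    show "\<epsilon>' (f 0 (g 0 x) \<ominus>\<^bsub>?G 0\<^esub> x) = \<zero>\<^bsub>M\<^esub>" if x: "x \<in> carrier (?G 0)" for x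
    proof -
      interpret M: Module.module R M by (rule M)
      show ?thesis using x mod_homD(3,7)[OF DG(3)] f0 g0 fh(3) gh(3)
        by (simp add: M.minus_eq_zero_iff)
    qed
    show "d' i (f (Suc i) (g (Suc i) x) \<ominus>\<^bsub>?G (Suc i)\<^esub> x) = f i (g i (d' i x)) \<ominus>\<^bsub>?G i\<^esub> d' i x"
      if "x \<in> carrier (?G (Suc i))" for i x
      using that by (simp add: dh'(7) fh(3) gh(3) gd fd)
  qed (use x min in auto)
  obtain \<kappa> where k: "mod_hom R (F i\<lparr>carrier := tcycles F d i\<rparr>) ?H \<kappa>" "\<kappa> ` tcycles F d i = carrier ?H"
    "\<And>x. x \<in> tcycles F d i \<Longrightarrow>
      \<kappa> x = \<zero>\<^bsub>?H\<^esub> \<longleftrightarrow> (\<exists>y\<in>carrier (F (Suc i)). x \<ominus>\<^bsub>F i\<^esub> d i y \<in> aug_sub (F i))"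
    by (rule homology_tensor_residue[of F d i, OF DF(2) DF(6)]) blast+
  note kh = mod_homD[OF k(1), simplified]
  interpret H: Module.module R ?H by (rule kh)
  have gZ: "g i w \<in> tcycles F d i" if "w \<in> carrier (?G i)" for w
    using that by (auto simp: tcycles_def gh(3) gd intro!: aug_sub_hom[OF g] min)
  let ?K = "free_module (class_ring :: 'k ring) (B i)"
  have Km: "Module.module class_ring ?K" by (rule free_module_module) (rule class_cring.cring_axioms)
  interpret K: Module.module "class_ring :: 'k ring" ?K by (rule Km)
  let ?l = "\<lambda>c b. cst (c b)"
  have l: "?l c \<in> carrier (?G i)" if "c \<in> carrier ?K" for c
    using free_moduleD[OF that] by (intro free_moduleI[of _ _ "{b. c b \<noteq> 0}"]) auto
  let ?\<Omega> = "\<lambda>c. \<kappa> (g i (?l c))"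
  have hom: "mod_hom class_ring ?K (restrict_scalars cst ?H) ?\<Omega>"
  proof (rule mod_homI[OF Km restrict_scalars_cst_module[OF H.module_axioms]])
    show "?\<Omega> c \<in> carrier (restrict_scalars cst ?H)" if "c \<in> carrier ?K" for c
      using kh(3)[OF gZ[OF l[OF that]]] by simp
    show "?\<Omega> (c \<oplus>\<^bsub>?K\<^esub> c') = ?\<Omega> c \<oplus>\<^bsub>restrict_scalars cst ?H\<^esub> ?\<Omega> c'"
      if "c \<in> carrier ?K" "c' \<in> carrier ?K" for c c'
      using kh(4)[OF gZ[OF l[OF that(1)]] gZ[OF l[OF that(2)]]] gh(4)[OF l[OF that(1)] l[OF that(2)]]
      by (simp add: cst_add)
    show "?\<Omega> (r \<odot>\<^bsub>?K\<^esub> c) = r \<odot>\<^bsub>restrict_scalars cst ?H\<^esub> ?\<Omega> c"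
      if "c \<in> carrier ?K" for r c
      using kh(5)[OF cst_closed gZ[OF l[OF that]]] gh(5)[OF cst_closed l[OF that]]
      by (simp add: cst_mult)
  qed
  note \<Omega> = mod_homD[OF hom]
  have inj: "c = \<zero>\<^bsub>?K\<^esub>" if c: "c \<in> carrier ?K" and 0: "?\<Omega> c = \<zero>\<^bsub>?H\<^esub>" for c
  proof -
    let ?w = "?l c"
    note w = l[OF c]
    obtain y where y: "y \<in> carrier (F (Suc i))" "g i ?w \<ominus>\<^bsub>F i\<^esub> d i y \<in> aug_sub (F i)"
      using k(3)[OF gZ[OF w]] 0 by blast
    have 1: "f i (g i ?w) \<ominus>\<^bsub>?G i\<^esub> d' i (f (Suc i) y) \<in> aug_sub (?G i)"
      using aug_sub_hom[OF f y(2)] y(1) w by (simp add: fh(7) gh(3) dh(3) fd)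
    have 2: "d' i (f (Suc i) y) \<in> aug_sub (?G i)" by (rule min[OF fh(3)[OF y(1)]])
    obtain z where z: "z \<in> carrier (?G (Suc i))"
      "(f i (g i ?w) \<ominus>\<^bsub>?G i\<^esub> ?w) \<ominus>\<^bsub>?G i\<^esub> d' i z \<in> aug_sub (?G i)"
      using fg[OF w] by blast
    have 3: "d' i z \<in> aug_sub (?G i)" by (rule min[OF z(1)])
    have c1: "f i (g i ?w) \<in> carrier (?G i)" "d' i (f (Suc i) y) \<in> carrier (?G i)" "d' i z \<in> carrier (?G i)"
      using w y(1) z(1) by (simp_all add: fh(3) gh(3) dh'(3))
    have cancel: "a \<ominus>\<^bsub>?G i\<^esub> b \<oplus>\<^bsub>?G i\<^esub> b = a" if "a \<in> carrier (?G i)" "b \<in> carrier (?G i)" for a b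
      using that by (simp only: a_minus_def Gi.a_assoc Gi.l_neg Gi.r_zero Gi.add.inv_closed)
    have 4: "f i (g i ?w) \<in> aug_sub (?G i)"
      using aug_sub_add[OF Gm 1 2] c1 cancel by metis
    have 5: "f i (g i ?w) \<ominus>\<^bsub>?G i\<^esub> ?w \<in> aug_sub (?G i)"
      using aug_sub_add[OF Gm z(2) 3] c1 w cancel Gi.minus_closed by metis
    have "?w \<in> aug_sub (?G i)"
      using aug_sub_minus[OF Gm 4 5] Gi.minus_minus_cancel[OF c1(1) w] by metis
    from aug_sub_free_moduleD[OF this] show "c = \<zero>\<^bsub>?K\<^esub>" by (simp add: fun_eq_iff)
  qed
  have surj: "X \<in> ?\<Omega> ` carrier ?K" if "X \<in> carrier ?H" for X
  proof -
    from that[folded k(2)] obtain x where x: "X = \<kappa> x" "x \<in> tcycles F d i" by (rule imageE)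
    note x = x(2,1)
    have xF: "x \<in> carrier (F i)" using x(1) by (simp add: tcycles_def)
    have fx: "f i x \<in> carrier (?G i)" by (rule fh(3)[OF xF])
    let ?c = "\<lambda>b. aug (f i x b)"
    have c: "?c \<in> carrier ?K"
      by (rule free_moduleI[of _ _ "{b. f i x b \<noteq> \<zero>}"]) (use free_moduleD[OF fx] in auto)
    obtain m where m: "m \<in> aug_sub (?G i)" "f i x = m \<oplus>\<^bsub>?G i\<^esub> ?l ?c"
      using free_module_aug_decomp[OF fx] by blast
    have mG: "m \<in> carrier (?G i)" by (rule aug_sub_carrier[OF Gm m(1)])
    have zero: "\<kappa> z = \<zero>\<^bsub>?H\<^esub>" if "z \<in> tcycles F d i" "z \<in> aug_sub (F i)" for z
    proof -
      have "z \<in> carrier (F i)" using that(1) by (simp add: tcycles_def)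
      then have "z \<ominus>\<^bsub>F i\<^esub> d i \<zero>\<^bsub>F (Suc i)\<^esub> \<in> aug_sub (F i)"
        using that(2) by (simp add: dh(6) Fi.minus_zero_right)
      moreover have "\<zero>\<^bsub>F (Suc i)\<^esub> \<in> carrier (F (Suc i))"
        using Fm by (metis Module.module.axioms(2) abelian_group.axioms(1) abelian_monoid.zero_closed)
      ultimately show ?thesis unfolding k(3)[OF that(1)] by (rule bexI)
    qed
    have gc: "g i (?l ?c) \<in> tcycles F d i" "g i m \<in> tcycles F d i" "g i (f i x) \<in> tcycles F d i"
      using gZ l[OF c] mG fx by auto
    have "\<kappa> (g i (f i x)) = \<kappa> (g i m) \<oplus>\<^bsub>?H\<^esub> \<kappa> (g i (?l ?c))"
      using m(2) gh(4)[OF mG l[OF c]] kh(4)[OF gc(2,1)] by simp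
    also have "\<kappa> (g i m) = \<zero>\<^bsub>?H\<^esub>" by (rule zero[OF gc(2) aug_sub_hom[OF g m(1)]])
    finally have 1: "\<kappa> (g i (f i x)) = ?\<Omega> ?c" using kh(3)[OF gc(1)] by simp
    obtain y where y: "y \<in> carrier (F (Suc i))"
      "(g i (f i x) \<ominus>\<^bsub>F i\<^esub> x) \<ominus>\<^bsub>F i\<^esub> d i y \<in> aug_sub (F i)" using gf[OF x(1)] by blast
    interpret Z: Module.module R "F i\<lparr>carrier := tcycles F d i\<rparr>" by (rule mod_homD(1)[OF k(1)])
    have sub: "g i (f i x) \<ominus>\<^bsub>F i\<^esub> x = g i (f i x) \<ominus>\<^bsub>F i\<lparr>carrier := tcycles F d i\<rparr>\<^esub> x"
    proof -
      have "\<ominus>\<^bsub>F i\<lparr>carrier := tcycles F d i\<rparr>\<^esub> x = \<ominus>\<^bsub>F i\<^esub> x"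
      proof (rule sym, rule Fi.minus_equality)
        show "\<ominus>\<^bsub>F i\<lparr>carrier := tcycles F d i\<rparr>\<^esub> x \<oplus>\<^bsub>F i\<^esub> x = \<zero>\<^bsub>F i\<^esub>"
          using Z.l_neg[of x] x(1) by simp
        show "\<ominus>\<^bsub>F i\<lparr>carrier := tcycles F d i\<rparr>\<^esub> x \<in> carrier (F i)"
          using Z.add.inv_closed[of x] x(1) by (simp add: tcycles_def)
      qed (rule xF)
      then show ?thesis by (simp add: a_minus_def)
    qed
    have "g i (f i x) \<ominus>\<^bsub>F i\<^esub> x \<in> tcycles F d i"
      using Z.minus_closed[of "g i (f i x)" x] gc(3) x(1) unfolding sub by simp
    from k(3)[OF this] have "\<kappa> (g i (f i x) \<ominus>\<^bsub>F i\<^esub> x) = \<zero>\<^bsub>?H\<^esub>"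
      by (rule iffD2) (rule bexI, rule y(2), rule y(1))
    then have "\<kappa> (g i (f i x)) \<ominus>\<^bsub>?H\<^esub> \<kappa> x = \<zero>\<^bsub>?H\<^esub>"
      using kh(7)[OF gc(3) x(1)] unfolding sub by simp
    then have "\<kappa> (g i (f i x)) = \<kappa> x"
      by (subst (asm) H.minus_eq_zero_iff[OF kh(3)[OF gc(3)] kh(3)[OF x(1)]])
    then have "X = ?\<Omega> ?c" using 1 x(2) by simp
    then show ?thesis using c by (rule image_eqI)
  qed
  have "inj_on ?\<Omega> (carrier ?K)"
  proof (rule inj_onI)
    fix c c' assume c: "c \<in> carrier ?K" "c' \<in> carrier ?K" "?\<Omega> c = ?\<Omega> c'"
    interpret H': Module.module class_ring "restrict_scalars cst ?H" by (rule \<Omega>(2))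
    have "?\<Omega> (c \<ominus>\<^bsub>?K\<^esub> c') = \<zero>\<^bsub>?H\<^esub>"
      using \<Omega>(7)[OF c(1,2)] c(3) \<Omega>(3)[OF c(2)] H'.minus_eq_zero_iff by simp
    then have "c \<ominus>\<^bsub>?K\<^esub> c' = \<zero>\<^bsub>?K\<^esub>" by (rule inj[OF K.minus_closed[OF c(1,2)]])
    then show "c = c'" by (subst (asm) K.minus_eq_zero_iff[OF c(1,2)])
  qed
  then have "bij_betw ?\<Omega> (carrier ?K) (carrier (restrict_scalars cst ?H))"
    unfolding bij_betw_def
  proof (intro conjI equalityI)
    show "?\<Omega> ` carrier ?K \<subseteq> carrier (restrict_scalars cst ?H)" using \<Omega>(3) by (rule image_subsetI)
    show "carrier (restrict_scalars cst ?H) \<subseteq> ?\<Omega> ` carrier ?K"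
      unfolding restrict_scalars_simps using surj by (rule subsetI)
  qed
  from edim_eq_card_basis[OF hom this fin] show ?thesis .
qed

end

section \<open>Mapping cones\<close>

text \<open>
  Three finite rank free modules with index sets of natural numbers have a direct sum of the same
  kind: the residue class modulo 3 tells the summand. Keeping the index type fixed allows the
  construction of cones to be iterated.
\<close>

definition join3 :: "nat set \<Rightarrow> nat set \<Rightarrow> nat set \<Rightarrow> nat set" where
  "join3 A B C = (\<lambda>j. 3 * j) ` A \<union> (\<lambda>j. 3 * j + 1) ` B \<union> (\<lambda>j. 3 * j + 2) ` C"

definition proj3 :: "nat \<Rightarrow> (nat \<Rightarrow> 'a) \<Rightarrow> nat \<Rightarrow> 'a" where
  "proj3 k v = (\<lambda>j. v (3 * j + k))"

definition tuple3 :: "(nat \<Rightarrow> 'a) \<Rightarrow> (nat \<Rightarrow> 'a) \<Rightarrow> (nat \<Rightarrow> 'a) \<Rightarrow> nat \<Rightarrow> 'a" where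
  "tuple3 u v w = (\<lambda>j. if j mod 3 = 0 then u (j div 3) else if j mod 3 = 1 then v (j div 3) else w (j div 3))"

lemma mod3_cases:
  fixes j :: nat
  obtains (0) i where "j = 3 * i" | (1) i where "j = Suc (3 * i)" | (2) i where "j = Suc (Suc (3 * i))"
proof -
  have "j = 3 * (j div 3) + j mod 3" "j mod 3 < 3" by simp_all
  then have "j = 3 * (j div 3) \<or> j = Suc (3 * (j div 3)) \<or> j = Suc (Suc (3 * (j div 3)))" by linarith
  then show thesis using that by blast
qed

lemma tuple3_simps [simp]:
  "tuple3 u v w (3 * j) = u j" "tuple3 u v w (Suc (3 * j)) = v j" "tuple3 u v w (Suc (Suc (3 * j))) = w j"
proof -
  have "Suc (3 * j) mod 3 = 1" "Suc (3 * j) div 3 = j" "Suc (Suc (3 * j)) mod 3 = 2"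
    "Suc (Suc (3 * j)) div 3 = j" by presburger+
  then show "tuple3 u v w (3 * j) = u j" "tuple3 u v w (Suc (3 * j)) = v j"
    "tuple3 u v w (Suc (Suc (3 * j))) = w j" by (simp_all add: tuple3_def)
qed

lemma proj3_tuple3 [simp]:
  "proj3 0 (tuple3 u v w) = u" "proj3 (Suc 0) (tuple3 u v w) = v" "proj3 2 (tuple3 u v w) = w"
  by (simp_all add: proj3_def fun_eq_iff numeral_2_eq_2)

lemma tuple3_proj3: "tuple3 (proj3 0 v) (proj3 (Suc 0) v) (proj3 2 v) = v"
proof
  fix j
  show "tuple3 (proj3 0 v) (proj3 (Suc 0) v) (proj3 2 v) j = v j"
    by (cases j rule: mod3_cases) (simp_all add: proj3_def)
qed

lemma join3_simps [simp]:
  "3 * j \<in> join3 A B C \<longleftrightarrow> j \<in> A" "Suc (3 * j) \<in> join3 A B C \<longleftrightarrow> j \<in> B"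
  "Suc (Suc (3 * j)) \<in> join3 A B C \<longleftrightarrow> j \<in> C"
proof -
  have "3 * j \<noteq> Suc (3 * i)" "3 * j \<noteq> Suc (Suc (3 * i))" "Suc (3 * j) \<noteq> Suc (Suc (3 * i))"
    "Suc (3 * i) \<noteq> 3 * j" "Suc (Suc (3 * i)) \<noteq> 3 * j" "Suc (Suc (3 * i)) \<noteq> Suc (3 * j)" for i j :: nat by presburger+
  then show "3 * j \<in> join3 A B C \<longleftrightarrow> j \<in> A" "Suc (3 * j) \<in> join3 A B C \<longleftrightarrow> j \<in> B"
    "Suc (Suc (3 * j)) \<in> join3 A B C \<longleftrightarrow> j \<in> C"
    by (auto simp: join3_def image_iff)
qed

lemma finite_join3: "finite A \<Longrightarrow> finite B \<Longrightarrow> finite C \<Longrightarrow> finite (join3 A B C)"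
  by (simp add: join3_def)

lemma card_join3:
  assumes "finite A" "finite B" "finite C"
  shows "card (join3 A B C) = card A + card B + card C"
proof -
  have d: "(\<lambda>j. 3 * j) ` A \<inter> (\<lambda>j. 3 * j + 1) ` B = {}"
    "((\<lambda>j. 3 * j) ` A \<union> (\<lambda>j. 3 * j + 1) ` B) \<inter> (\<lambda>j. 3 * j + 2) ` C = {}" by (auto, presburger+)
  show ?thesis unfolding join3_def
    using assms d by (subst card_Un_disjoint, simp, simp, simp)+ (simp add: card_image inj_on_def)
qed

lemma proj3_hom:
  assumes "cring R"
  shows "mod_hom R (free_module R (join3 A B C)) (free_module R A) (proj3 0)"
    "mod_hom R (free_module R (join3 A B C)) (free_module R B) (proj3 (Suc 0))"
    "mod_hom R (free_module R (join3 A B C)) (free_module R C) (proj3 2)"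
proof -
  note m = free_module_module[OF assms]
  have *: "proj3 k v \<in> carrier (free_module R D)"
    if v: "v \<in> carrier (free_module R (join3 A B C))" and D: "\<And>j. 3 * j + k \<in> join3 A B C \<Longrightarrow> j \<in> D" for k v D
  proof (rule free_moduleI)
    note V = free_moduleD[OF v]
    show "finite ((\<lambda>j. 3 * j + k) -` {b. v b \<noteq> \<zero>\<^bsub>R\<^esub>})"
      using V(2) by (rule finite_vimageI) (simp add: inj_def)
  qed (use free_moduleD[OF v] D in \<open>auto simp: proj3_def\<close>)
  show "mod_hom R (free_module R (join3 A B C)) (free_module R A) (proj3 0)"
    by (rule mod_homI[OF m m *]) (auto simp: proj3_def)
  show "mod_hom R (free_module R (join3 A B C)) (free_module R B) (proj3 (Suc 0))"
    by (rule mod_homI[OF m m *]) (auto simp: proj3_def)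
  show "mod_hom R (free_module R (join3 A B C)) (free_module R C) (proj3 2)"
    by (rule mod_homI[OF m m *]) (auto simp: proj3_def)
qed

lemma tuple3_closed:
  assumes "u \<in> carrier (free_module R A)" "v \<in> carrier (free_module R B)" "w \<in> carrier (free_module R C)"
  shows "tuple3 u v w \<in> carrier (free_module R (join3 A B C))"
proof -
  note U = free_moduleD[OF assms(1)] and V = free_moduleD[OF assms(2)] and W = free_moduleD[OF assms(3)]
  let ?S = "join3 {b. u b \<noteq> \<zero>\<^bsub>R\<^esub>} {b. v b \<noteq> \<zero>\<^bsub>R\<^esub>} {b. w b \<noteq> \<zero>\<^bsub>R\<^esub>}"
  show ?thesis
  proof (rule free_moduleI[of _ _ ?S])
    show "finite ?S" by (rule finite_join3[OF U(2) V(2) W(2)])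
    show "tuple3 u v w j \<in> carrier R" for j
      by (cases j rule: mod3_cases) (use U(1) V(1) W(1) in simp_all)
    show "j \<notin> ?S \<Longrightarrow> tuple3 u v w j = \<zero>\<^bsub>R\<^esub>" for j
      by (cases j rule: mod3_cases) simp_all
    show "j \<notin> join3 A B C \<Longrightarrow> tuple3 u v w j = \<zero>\<^bsub>R\<^esub>" for j
      by (cases j rule: mod3_cases) (use U(4) V(4) W(4) in simp_all)
  qed
qed

lemma tuple3_hom:
  assumes f: "mod_hom R M (free_module R A) f" and g: "mod_hom R M (free_module R B) g"
    and h: "mod_hom R M (free_module R C) h"
  shows "mod_hom R M (free_module R (join3 A B C)) (\<lambda>x. tuple3 (f x) (g x) (h x))"
proof -
  interpret M: Module.module R M by (rule mod_homD[OF f])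
  show ?thesis
  proof (rule mod_homI[OF mod_homD(1)[OF f] free_module_module[OF M.R.cring_axioms]])
    show "tuple3 (f x) (g x) (h x) \<in> carrier (free_module R (join3 A B C))" if "x \<in> carrier M" for x
      by (intro tuple3_closed mod_homD(3)[OF f that] mod_homD(3)[OF g that] mod_homD(3)[OF h that])
  next
    fix x y assume "x \<in> carrier M" "y \<in> carrier M"
    then show "tuple3 (f (x \<oplus>\<^bsub>M\<^esub> y)) (g (x \<oplus>\<^bsub>M\<^esub> y)) (h (x \<oplus>\<^bsub>M\<^esub> y)) =
      tuple3 (f x) (g x) (h x) \<oplus>\<^bsub>free_module R (join3 A B C)\<^esub> tuple3 (f y) (g y) (h y)"
      by (simp add: mod_homD(4)[OF f] mod_homD(4)[OF g] mod_homD(4)[OF h]) (simp add: tuple3_def fun_eq_iff)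
  next
    fix r x assume "r \<in> carrier R" "x \<in> carrier M"
    then show "tuple3 (f (r \<odot>\<^bsub>M\<^esub> x)) (g (r \<odot>\<^bsub>M\<^esub> x)) (h (r \<odot>\<^bsub>M\<^esub> x)) =
      r \<odot>\<^bsub>free_module R (join3 A B C)\<^esub> tuple3 (f x) (g x) (h x)"
      by (simp add: mod_homD(5)[OF f] mod_homD(5)[OF g] mod_homD(5)[OF h]) (simp add: tuple3_def fun_eq_iff)
  qed
qed


text \<open>
  One component of \<open>d d = 0\<close> in the mapping cone of a chain map \<open>u\<close>: the mixed terms \<open>d u'\<close> and \<open>u e\<close>
  cancel because of the sign in front of \<open>e\<close>.
\<close>

lemma cone_differential_square:
  assumes F: "free_resolution R M F d \<epsilon>" and e: "mod_hom R L' L e"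
    and u: "mod_hom R L (F i) u" and u': "mod_hom R L' (F (Suc i)) u'"
    and ud: "\<And>x. x \<in> carrier L' \<Longrightarrow> d i (u' x) = u (e x)"
    and p: "p \<in> carrier (F (Suc (Suc i)))" and q: "q \<in> carrier L'"
  shows "d i (d (Suc i) p \<oplus>\<^bsub>F (Suc i)\<^esub> u' q) \<oplus>\<^bsub>F i\<^esub> u (\<ominus>\<^bsub>L\<^esub> e q) = \<zero>\<^bsub>F i\<^esub>"
proof -
  note D = free_resolutionD[OF F]
  note dh = mod_homD[OF D(2)]
  interpret F: Module.module R "F i" by (rule mod_homD(2)[OF u])
  have ue: "u (e q) \<in> carrier (F i)" by (rule mod_homD(3)[OF u mod_homD(3)[OF e q]])
  have "d i (d (Suc i) p \<oplus>\<^bsub>F (Suc i)\<^esub> u' q) = \<zero>\<^bsub>F i\<^esub> \<oplus>\<^bsub>F i\<^esub> u (e q)"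
    using p q by (simp add: dh D(6) mod_homD(3)[OF u'] ud)
  moreover have "u (\<ominus>\<^bsub>L\<^esub> e q) = \<ominus>\<^bsub>F i\<^esub> u (e q)"
    by (rule mod_hom.f_neg[OF u mod_homD(3)[OF e q]])
  ultimately show ?thesis using ue by (simp add: F.r_neg)
qed

text \<open>
  One component of exactness of the mapping cone: if the component \<open>x = e w\<close> in the source complex is a
  boundary, then \<open>d v + u x = d (v + u w)\<close>, and so \<open>v + u w\<close> is a boundary.
\<close>

lemma cone_exact_component:
  assumes F: "free_resolution R M F d \<epsilon>" and u: "mod_hom R L (F (Suc i)) u"
    and v: "v \<in> carrier (F (Suc i))" and w: "w \<in> carrier L"
    and 0: "d i v \<oplus>\<^bsub>F i\<^esub> d i (u w) = \<zero>\<^bsub>F i\<^esub>"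
  shows "\<exists>y\<in>carrier (F (Suc (Suc i))). v = d (Suc i) y \<oplus>\<^bsub>F (Suc i)\<^esub> u (\<ominus>\<^bsub>L\<^esub> w)"
proof -
  note D = free_resolutionD[OF F]
  interpret F: Module.module R "F (Suc i)" by (rule mod_homD(2)[OF u])
  have uw: "u w \<in> carrier (F (Suc i))" by (rule mod_homD(3)[OF u w])
  have "d i (v \<oplus>\<^bsub>F (Suc i)\<^esub> u w) = \<zero>\<^bsub>F i\<^esub>" using 0 by (simp add: mod_homD(4)[OF D(2) v uw])
  from D(8)[OF F.add.m_closed[OF v uw] this]
  obtain y where y: "v \<oplus>\<^bsub>F (Suc i)\<^esub> u w = d (Suc i) y" "y \<in> carrier (F (Suc (Suc i)))" by (rule imageE)
  have "d (Suc i) y \<oplus>\<^bsub>F (Suc i)\<^esub> u (\<ominus>\<^bsub>L\<^esub> w) = v \<oplus>\<^bsub>F (Suc i)\<^esub> (u w \<oplus>\<^bsub>F (Suc i)\<^esub> \<ominus>\<^bsub>F (Suc i)\<^esub> u w)"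
    using v uw by (simp add: y(1)[symmetric] mod_hom.f_neg[OF u w] F.a_assoc)
  also have "\<dots> = v" using v uw by (simp add: F.r_neg)
  finally show ?thesis using y(2) by (intro bexI[of _ y]) simp_all
qed

text \<open>
  The corresponding statement at the augmentation.
\<close>

lemma cone_exact_component0:
  assumes F: "free_resolution R M F d \<epsilon>" and u: "mod_hom R L (F 0) u"
    and v: "v \<in> carrier (F 0)" and w: "w \<in> carrier L" and eq: "\<epsilon> v = \<epsilon> (u w)"
  shows "\<exists>y\<in>carrier (F (Suc 0)). v = d 0 y \<oplus>\<^bsub>F 0\<^esub> u w"
proof -
  note D = free_resolutionD[OF F]
  interpret F: Module.module R "F 0" by (rule mod_homD(2)[OF u])
  interpret M: Module.module R M by (rule mod_homD(2)[OF D(3)])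
  have uw: "u w \<in> carrier (F 0)" by (rule mod_homD(3)[OF u w])
  have "\<epsilon> (v \<ominus>\<^bsub>F 0\<^esub> u w) = \<zero>\<^bsub>M\<^esub>"
    using eq mod_homD(3)[OF D(3) uw] by (simp add: mod_homD(7)[OF D(3) v uw] M.minus_eq_zero_iff)
  from D(7)[OF F.minus_closed[OF v uw] this]
  obtain y where y: "v \<ominus>\<^bsub>F 0\<^esub> u w = d 0 y" "y \<in> carrier (F (Suc 0))" by (rule imageE)
  have "d 0 y \<oplus>\<^bsub>F 0\<^esub> u w = v"
    using v uw by (simp add: y(1)[symmetric] a_minus_def F.a_assoc F.l_neg)
  then show ?thesis using y(2) by (intro bexI[of _ y]) simp_all
qed

context augmented_ring
begin

text \<open>
  \<open>B i\<close> is the index set of a basis in degree \<open>i\<close>. Minimality says that the differentials have entries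
  in \<open>\<mm>\<close>.
\<close>

definition minimal_resolution :: "('a, 'm) module \<Rightarrow> (nat \<Rightarrow> nat set) \<Rightarrow> bool" where
  "minimal_resolution M B \<longleftrightarrow> (\<forall>i. finite (B i)) \<and>
     (\<exists>d \<epsilon>. free_resolution R M (\<lambda>i. free_module R (B i)) d \<epsilon> \<and>
       (\<forall>i. \<forall>w\<in>carrier (free_module R (B (Suc i))). d i w \<in> aug_sub (free_module R (B i))))"

lemma is_free_free_module: "is_free_module R (free_module R B)"
  by (rule is_free_moduleI[OF mod_hom_id[OF free_module_module[OF cring_axioms]] _ one_neq_zero])
    (simp add: bij_betw_def)

lemma aug_sub_free_moduleI:
  assumes "w \<in> carrier (free_module R B)" "\<And>b. aug (w b) = 0"
  shows "w \<in> aug_sub (free_module R B)"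
proof -
  from free_module_aug_decomp[OF assms(1)] obtain m where m: "m \<in> aug_sub (free_module R B)"
    "w = m \<oplus>\<^bsub>free_module R B\<^esub> (\<lambda>b. cst (aug (w b)))" by blast
  have "m b \<in> carrier R" for b
    by (rule free_moduleD(1)[OF aug_sub_carrier[OF free_module_module[OF cring_axioms] m(1)]])
  then have "w = m" using fun_cong[OF m(2)] by (simp add: assms(2) fun_eq_iff)
  then show ?thesis using m(1) by simp
qed

lemma aug_sub_tuple3:
  assumes "u \<in> aug_sub (free_module R A)" "v \<in> aug_sub (free_module R B)" "w \<in> aug_sub (free_module R C)"
    and "tuple3 u v w \<in> carrier (free_module R (join3 A B C))"
  shows "tuple3 u v w \<in> aug_sub (free_module R (join3 A B C))"
proof (rule aug_sub_free_moduleI[OF assms(4)])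
  fix j show "aug (tuple3 u v w j) = 0"
    by (cases j rule: mod3_cases) (simp_all add: aug_sub_free_moduleD[OF assms(1)]
      aug_sub_free_moduleD[OF assms(2)] aug_sub_free_moduleD[OF assms(3)])
qed

text \<open>
  For an exact sequence \<open>0 \<rightarrow> L \<rightarrow> M1 \<oplus> M2 \<rightarrow> C \<rightarrow> 0\<close> the mapping cone of the lifts of the two
  components of the first map resolves \<open>C\<close>. These components are \<open>m1 p1\<close> and \<open>m2 p2\<close> with \<open>m1\<close> and \<open>m2\<close>
  in \<open>\<mm>\<close>. Lifting \<open>p1\<close> and \<open>p2\<close> first and multiplying the lifts afterwards makes all entries of the new
  blocks of the differential lie in \<open>\<mm>\<close>.
\<close>

lemma minimal_resolution_cone:
  fixes L :: "('a, 'l) module" and M1 :: "('a, 'm1) module" and M2 :: "('a, 'm2) module"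
    and C :: "('a, 'c) module"
  assumes L: "minimal_resolution L BL" and M1: "minimal_resolution M1 B1" and M2: "minimal_resolution M2 B2"
    and p1: "mod_hom R L M1 p1" and p2: "mod_hom R L M2 p2"
    and m1: "m1 \<in> carrier R" "aug m1 = 0" and m2: "m2 \<in> carrier R" "aug m2 = 0"
    and c1: "mod_hom R M1 C c1" and c2: "mod_hom R M2 C c2"
    and surj: "\<And>z. z \<in> carrier C \<Longrightarrow> \<exists>x\<in>carrier M1. \<exists>y\<in>carrier M2. z = c1 x \<oplus>\<^bsub>C\<^esub> c2 y"
    and exact: "\<And>x y. x \<in> carrier M1 \<Longrightarrow> y \<in> carrier M2 \<Longrightarrow> c1 x \<oplus>\<^bsub>C\<^esub> c2 y = \<zero>\<^bsub>C\<^esub> \<longleftrightarrow>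
      (\<exists>a\<in>carrier L. x = m1 \<odot>\<^bsub>M1\<^esub> p1 a \<and> y = m2 \<odot>\<^bsub>M2\<^esub> p2 a)"
    and inj: "\<And>a. a \<in> carrier L \<Longrightarrow> m1 \<odot>\<^bsub>M1\<^esub> p1 a = \<zero>\<^bsub>M1\<^esub> \<Longrightarrow> a = \<zero>\<^bsub>L\<^esub>"
  shows "minimal_resolution C (\<lambda>i. join3 (B1 i) (B2 i) (case i of 0 \<Rightarrow> {} | Suc j \<Rightarrow> BL j))"
proof -
  note [simp del] = free_module_simps
  let ?L = "\<lambda>i. free_module R (BL i)" and ?F1 = "\<lambda>i. free_module R (B1 i)" and ?F2 = "\<lambda>i. free_module R (B2 i)"
  obtain dL \<epsilon>L where rL: "free_resolution R L ?L dL \<epsilon>L"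
    and minL: "\<And>i w. w \<in> carrier (?L (Suc i)) \<Longrightarrow> dL i w \<in> aug_sub (?L i)"
    using L unfolding minimal_resolution_def by blast
  obtain d1 \<epsilon>1 where r1: "free_resolution R M1 ?F1 d1 \<epsilon>1"
    and min1: "\<And>i w. w \<in> carrier (?F1 (Suc i)) \<Longrightarrow> d1 i w \<in> aug_sub (?F1 i)"
    using M1 unfolding minimal_resolution_def by blast
  obtain d2 \<epsilon>2 where r2: "free_resolution R M2 ?F2 d2 \<epsilon>2"
    and min2: "\<And>i w. w \<in> carrier (?F2 (Suc i)) \<Longrightarrow> d2 i w \<in> aug_sub (?F2 i)"
    using M2 unfolding minimal_resolution_def by blast
  have fin: "finite (BL i)" "finite (B1 i)" "finite (B2 i)" for i
    using L M1 M2 unfolding minimal_resolution_def by blast+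
  note DL = free_resolutionD[OF rL] and D1 = free_resolutionD[OF r1] and D2 = free_resolutionD[OF r2]
  have fm: "Module.module R (free_module R X)" for X :: "nat set"
    by (rule free_module_module[OF cring_axioms])
  obtain f1 where f1: "\<And>i. mod_hom R (?L i) (?F1 i) (f1 i)"
    and f1e: "\<And>x. x \<in> carrier (?L 0) \<Longrightarrow> \<epsilon>1 (f1 0 x) = p1 (\<epsilon>L x)"
    and f1d: "\<And>i x. x \<in> carrier (?L (Suc i)) \<Longrightarrow> d1 i (f1 (Suc i) x) = f1 i (dL i x)"
    by (rule resolution_lift[OF rL r1 p1]) blast
  obtain f2 where f2: "\<And>i. mod_hom R (?L i) (?F2 i) (f2 i)"
    and f2e: "\<And>x. x \<in> carrier (?L 0) \<Longrightarrow> \<epsilon>2 (f2 0 x) = p2 (\<epsilon>L x)"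
    and f2d: "\<And>i x. x \<in> carrier (?L (Suc i)) \<Longrightarrow> d2 i (f2 (Suc i) x) = f2 i (dL i x)"
    by (rule resolution_lift[OF rL r2 p2]) blast
  define u1 where "u1 = (\<lambda>i x. m1 \<odot>\<^bsub>?F1 i\<^esub> f1 i x)"
  define u2 where "u2 = (\<lambda>i x. m2 \<odot>\<^bsub>?F2 i\<^esub> f2 i x)"
  have u1: "mod_hom R (?L i) (?F1 i) (u1 i)" and u2: "mod_hom R (?L i) (?F2 i) (u2 i)" for i
    unfolding u1_def u2_def by (intro mod_hom_smult f1 f2 m1 m2)+
  have u1e: "\<epsilon>1 (u1 0 x) = m1 \<odot>\<^bsub>M1\<^esub> p1 (\<epsilon>L x)" and u2e: "\<epsilon>2 (u2 0 x) = m2 \<odot>\<^bsub>M2\<^esub> p2 (\<epsilon>L x)"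
    if "x \<in> carrier (?L 0)" for x
    unfolding u1_def u2_def using that m1 m2
    by (simp_all add: mod_homD(5)[OF D1(3)] mod_homD(5)[OF D2(3)] mod_homD(3)[OF f1] mod_homD(3)[OF f2] f1e f2e)
  have u1d: "d1 i (u1 (Suc i) x) = u1 i (dL i x)" and u2d: "d2 i (u2 (Suc i) x) = u2 i (dL i x)"
    if "x \<in> carrier (?L (Suc i))" for i x
    unfolding u1_def u2_def using that m1 m2
    by (simp_all add: mod_homD(5)[OF D1(2)] mod_homD(5)[OF D2(2)] mod_homD(3)[OF f1] mod_homD(3)[OF f2] f1d f2d)
  have u1m: "u1 i x \<in> aug_sub (?F1 i)" and u2m: "u2 i x \<in> aug_sub (?F2 i)" if "x \<in> carrier (?L i)" for i x
    unfolding u1_def u2_def using that m1 m2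
    by (auto intro!: aug_sub_smult fm mod_homD(3)[OF f1] mod_homD(3)[OF f2])
  \<comment> \<open>The third summand is the resolution of \<open>L\<close> shifted by one, so it is empty in degree zero.\<close>
  define BT where "BT = (\<lambda>i. case i of 0 \<Rightarrow> {} | Suc j \<Rightarrow> BL j)"
  have BT [simp]: "BT 0 = {}" "BT (Suc i) = BL i" for i by (simp_all add: BT_def)
  define d3 where "d3 = (\<lambda>i x. case i of 0 \<Rightarrow> \<zero>\<^bsub>free_module R ({} :: nat set)\<^esub> | Suc j \<Rightarrow> \<ominus>\<^bsub>?L j\<^esub> dL j x)"
  have d3_simps [simp]: "d3 0 x = \<zero>\<^bsub>free_module R ({} :: nat set)\<^esub>" "d3 (Suc j) x = \<ominus>\<^bsub>?L j\<^esub> dL j x" for j x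
    by (simp_all add: d3_def)
  have d3: "mod_hom R (?L i) (free_module R (BT i)) (d3 i)" for i
    by (cases i) (simp_all add: mod_hom_zero[OF fm fm] mod_hom_neg[OF DL(2)] d3_def)
  have d3m: "d3 i x \<in> aug_sub (free_module R (BT i))" if x: "x \<in> carrier (?L i)" for i x
  proof (cases i)
    case 0
    then show ?thesis by (simp add: aug_sub.zero)
  next
    case (Suc j)
    interpret A: abelian_subgroup "aug_sub (?L j)" "?L j"
      by (rule submodule_abelian_subgroup[OF aug_sub_submodule[OF fm]])
    show ?thesis using minL[of x j] x by (simp add: Suc)
  qed
  let ?B = "\<lambda>i. join3 (B1 i) (B2 i) (BT i)"
  let ?F = "\<lambda>i. free_module R (?B i)"
  let ?P0 = "proj3 0 :: (nat \<Rightarrow> 'a) \<Rightarrow> _" and ?P1 = "proj3 (Suc 0) :: (nat \<Rightarrow> 'a) \<Rightarrow> _"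
    and ?P2 = "proj3 2 :: (nat \<Rightarrow> 'a) \<Rightarrow> _"
  have P0: "mod_hom R (?F i) (?F1 i) ?P0" and P1: "mod_hom R (?F i) (?F2 i) ?P1"
    and P2': "mod_hom R (?F i) (free_module R (BT i)) ?P2" for i
    by (rule proj3_hom[OF cring_axioms])+
  have P2: "mod_hom R (?F (Suc i)) (?L i) ?P2" for i using P2'[of "Suc i"] by simp
  let ?e1 = "\<lambda>i v. d1 i (?P0 v) \<oplus>\<^bsub>?F1 i\<^esub> u1 i (?P2 v)"
  let ?e2 = "\<lambda>i v. d2 i (?P1 v) \<oplus>\<^bsub>?F2 i\<^esub> u2 i (?P2 v)"
  let ?e3 = "\<lambda>i v. d3 i (?P2 v)"
  have e1: "mod_hom R (?F (Suc i)) (?F1 i) (?e1 i)" for i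
    by (rule mod_hom_add[OF mod_hom_comp[OF P0 D1(2)] mod_hom_comp[OF P2 u1]])
  have e2: "mod_hom R (?F (Suc i)) (?F2 i) (?e2 i)" for i
    by (rule mod_hom_add[OF mod_hom_comp[OF P1 D2(2)] mod_hom_comp[OF P2 u2]])
  have e3: "mod_hom R (?F (Suc i)) (free_module R (BT i)) (?e3 i)" for i
    by (rule mod_hom_comp[OF P2 d3])
  define d where "d = (\<lambda>i v. tuple3 (?e1 i v) (?e2 i v) (?e3 i v))"
  have d: "mod_hom R (?F (Suc i)) (?F i) (d i)" for i
    unfolding d_def by (rule tuple3_hom[OF e1 e2 e3])
  define \<epsilon> where "\<epsilon> = (\<lambda>v. c1 (\<epsilon>1 (?P0 v)) \<oplus>\<^bsub>C\<^esub> c2 (\<epsilon>2 (?P1 v)))"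
  have eps: "mod_hom R (?F 0) C \<epsilon>" unfolding \<epsilon>_def
    by (rule mod_hom_add[OF mod_hom_comp[OF mod_hom_comp[OF P0 D1(3)] c1] mod_hom_comp[OF mod_hom_comp[OF P1 D2(3)] c2]])
  have Pd [simp]: "?P0 (d i v) = ?e1 i v" "?P1 (d i v) = ?e2 i v" "?P2 (d i v) = ?e3 i v" for i v
    by (simp_all add: d_def)
  have d0: "d i v = \<zero>\<^bsub>?F i\<^esub> \<longleftrightarrow>
      ?e1 i v = \<zero>\<^bsub>?F1 i\<^esub> \<and> ?e2 i v = \<zero>\<^bsub>?F2 i\<^esub> \<and> ?e3 i v = \<zero>\<^bsub>free_module R (BT i)\<^esub>" for i v
  proof
    assume "d i v = \<zero>\<^bsub>?F i\<^esub>"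
    then show "?e1 i v = \<zero>\<^bsub>?F1 i\<^esub> \<and> ?e2 i v = \<zero>\<^bsub>?F2 i\<^esub> \<and> ?e3 i v = \<zero>\<^bsub>free_module R (BT i)\<^esub>"
      using Pd[of i v] mod_homD(6)[OF P0[of i]] mod_homD(6)[OF P1[of i]] mod_homD(6)[OF P2'[of i]] by simp
  next
    assume "?e1 i v = \<zero>\<^bsub>?F1 i\<^esub> \<and> ?e2 i v = \<zero>\<^bsub>?F2 i\<^esub> \<and> ?e3 i v = \<zero>\<^bsub>free_module R (BT i)\<^esub>"
    then have "d i v = tuple3 \<zero>\<^bsub>?F1 i\<^esub> \<zero>\<^bsub>?F2 i\<^esub> \<zero>\<^bsub>free_module R (BT i)\<^esub>" by (simp add: d_def)
    then show "d i v = \<zero>\<^bsub>?F i\<^esub>" by (simp add: tuple3_def free_module_simps fun_eq_iff)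
  qed
  have "free_resolution R C ?F d \<epsilon>"
    unfolding free_resolution_def
  proof (intro conjI allI)
    show "is_free_module R (?F i)" for i by (rule is_free_free_module)
    show "mod_hom R (?F (Suc i)) (?F i) (d i)" for i by (rule d)
    show "mod_hom R (?F 0) C \<epsilon>" by (rule eps)
    show "\<epsilon> ` carrier (?F 0) = carrier C"
    proof
      show "\<epsilon> ` carrier (?F 0) \<subseteq> carrier C" using mod_homD(3)[OF eps] by (rule image_subsetI)
      show "carrier C \<subseteq> \<epsilon> ` carrier (?F 0)"
      proof
        fix z assume "z \<in> carrier C"
        then obtain x y where xy: "x \<in> carrier M1" "y \<in> carrier M2" "z = c1 x \<oplus>\<^bsub>C\<^esub> c2 y" using surj by blast
        from xy(1) obtain v where v: "x = \<epsilon>1 v" "v \<in> carrier (?F1 0)" unfolding D1(4)[symmetric] by (rule imageE)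
        from xy(2) obtain w where w: "y = \<epsilon>2 w" "w \<in> carrier (?F2 0)" unfolding D2(4)[symmetric] by (rule imageE)
        have "z = \<epsilon> (tuple3 v w \<zero>\<^bsub>free_module R {}\<^esub>)" by (simp add: \<epsilon>_def xy(3) v(1) w(1))
        moreover have "tuple3 v w \<zero>\<^bsub>free_module R {}\<^esub> \<in> carrier (?F 0)"
          unfolding BT using v(2) w(2) aug_sub_carrier[OF fm aug_sub.zero] by (rule tuple3_closed)
        ultimately show "z \<in> \<epsilon> ` carrier (?F 0)" by (rule image_eqI)
      qed
    qed
    show "d 0 ` carrier (?F (Suc 0)) = a_kernel (?F 0) C \<epsilon>"
    proof (intro equalityI subsetI)
      fix z assume "z \<in> d 0 ` carrier (?F (Suc 0))"
      then obtain v where v: "z = d 0 v" "v \<in> carrier (?F (Suc 0))" by (rule imageE)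
      have V: "?P0 v \<in> carrier (?F1 (Suc 0))" "?P1 v \<in> carrier (?F2 (Suc 0))" "?P2 v \<in> carrier (?L 0)"
        by (rule mod_homD(3)[OF P0 v(2)] mod_homD(3)[OF P1 v(2)] mod_homD(3)[OF P2 v(2)])+
      have a: "\<epsilon>L (?P2 v) \<in> carrier L" by (rule mod_homD(3)[OF DL(3) V(3)])
      interpret M1: Module.module R M1 by (rule mod_homD(2)[OF p1])
      interpret M2: Module.module R M2 by (rule mod_homD(2)[OF p2])
      have ap: "m1 \<odot>\<^bsub>M1\<^esub> p1 (\<epsilon>L (?P2 v)) \<in> carrier M1" "m2 \<odot>\<^bsub>M2\<^esub> p2 (\<epsilon>L (?P2 v)) \<in> carrier M2"
        using m1 m2 mod_homD(3)[OF p1 a] mod_homD(3)[OF p2 a] by auto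
      have "\<epsilon>1 (?e1 0 v) = m1 \<odot>\<^bsub>M1\<^esub> p1 (\<epsilon>L (?P2 v))" "\<epsilon>2 (?e2 0 v) = m2 \<odot>\<^bsub>M2\<^esub> p2 (\<epsilon>L (?P2 v))"
        using V ap by (simp_all add: mod_homD(4)[OF D1(3)] mod_homD(4)[OF D2(3)] mod_homD(3)[OF D1(2)]
            mod_homD(3)[OF D2(2)] mod_homD(3)[OF u1] mod_homD(3)[OF u2] D1(5) D2(5) u1e u2e)
      then have "\<epsilon> z = c1 (m1 \<odot>\<^bsub>M1\<^esub> p1 (\<epsilon>L (?P2 v))) \<oplus>\<^bsub>C\<^esub> c2 (m2 \<odot>\<^bsub>M2\<^esub> p2 (\<epsilon>L (?P2 v)))"
        by (simp add: \<epsilon>_def v(1))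
      also have "\<dots> = \<zero>\<^bsub>C\<^esub>" using exact[OF ap] a by blast
      finally show "z \<in> a_kernel (?F 0) C \<epsilon>"
        using mod_homD(3)[OF d v(2)] by (simp add: a_kernel_def' v(1))
    next
      fix v assume "v \<in> a_kernel (?F 0) C \<epsilon>"
      then have v: "v \<in> carrier (?F 0)" "\<epsilon> v = \<zero>\<^bsub>C\<^esub>" by (simp_all add: a_kernel_def')
      have V: "?P0 v \<in> carrier (?F1 0)" "?P1 v \<in> carrier (?F2 0)" "?P2 v \<in> carrier (free_module R (BT 0))"
        by (rule mod_homD(3)[OF P0 v(1)] mod_homD(3)[OF P1 v(1)] mod_homD(3)[OF P2' v(1)])+
      obtain a where a: "a \<in> carrier L" "\<epsilon>1 (?P0 v) = m1 \<odot>\<^bsub>M1\<^esub> p1 a" "\<epsilon>2 (?P1 v) = m2 \<odot>\<^bsub>M2\<^esub> p2 a"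
        using exact[OF mod_homD(3)[OF D1(3) V(1)] mod_homD(3)[OF D2(3) V(2)]] v(2) unfolding \<epsilon>_def by blast
      from a(1) obtain x where x: "a = \<epsilon>L x" "x \<in> carrier (?L 0)" unfolding DL(4)[symmetric] by (rule imageE)
      obtain y1 where y1: "y1 \<in> carrier (?F1 (Suc 0))" "?P0 v = d1 0 y1 \<oplus>\<^bsub>?F1 0\<^esub> u1 0 x"
        using cone_exact_component0[where F = ?F1 and u = "u1 0" and L = "?L 0", OF r1 u1 V(1) x(2)] a(2) u1e[OF x(2)] x(1) by auto
      obtain y2 where y2: "y2 \<in> carrier (?F2 (Suc 0))" "?P1 v = d2 0 y2 \<oplus>\<^bsub>?F2 0\<^esub> u2 0 x"
        using cone_exact_component0[where F = ?F2 and u = "u2 0" and L = "?L 0", OF r2 u2 V(2) x(2)] a(3) u2e[OF x(2)] x(1) by auto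
      have y: "tuple3 y1 y2 x \<in> carrier (?F (Suc 0))"
        unfolding BT using y1(1) y2(1) x(2) by (rule tuple3_closed)
      have "?P2 v = \<zero>\<^bsub>free_module R (BT 0)\<^esub>"
        using free_moduleD(4)[OF V(3)] by (simp add: fun_eq_iff free_module_simps)
      then have "d 0 (tuple3 y1 y2 x) = tuple3 (?P0 v) (?P1 v) (?P2 v)"
        by (simp add: d_def y1(2) y2(2))
      also have "\<dots> = v" by (rule tuple3_proj3)
      finally show "v \<in> d 0 ` carrier (?F (Suc 0))" using y by (intro image_eqI) simp_all
    qed
    show "d (Suc i) ` carrier (?F (Suc (Suc i))) = a_kernel (?F (Suc i)) (?F i) (d i)" for i
    proof (intro equalityI subsetI)
      fix z assume "z \<in> d (Suc i) ` carrier (?F (Suc (Suc i)))"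
      then obtain v where v: "z = d (Suc i) v" "v \<in> carrier (?F (Suc (Suc i)))" by (rule imageE)
      have V: "?P0 v \<in> carrier (?F1 (Suc (Suc i)))" "?P1 v \<in> carrier (?F2 (Suc (Suc i)))" "?P2 v \<in> carrier (?L (Suc i))"
        by (rule mod_homD(3)[OF P0 v(2)] mod_homD(3)[OF P1 v(2)] mod_homD(3)[OF P2 v(2)])+
      have z1: "?e1 i z = \<zero>\<^bsub>?F1 i\<^esub>"
        using cone_differential_square[where i = i and F = ?F1 and d = d1 and u = "u1 i" and u' = "u1 (Suc i)"
            and e = "dL i" and L = "?L i" and L' = "?L (Suc i)", OF r1 DL(2) u1 u1 u1d V(1,3)] by (simp add: v(1))
      have z2: "?e2 i z = \<zero>\<^bsub>?F2 i\<^esub>"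
        using cone_differential_square[where i = i and F = ?F2 and d = d2 and u = "u2 i" and u' = "u2 (Suc i)"
            and e = "dL i" and L = "?L i" and L' = "?L (Suc i)", OF r2 DL(2) u2 u2 u2d V(2,3)] by (simp add: v(1))
      have z3: "?e3 i z = \<zero>\<^bsub>free_module R (BT i)\<^esub>"
      proof (cases i)
        case (Suc j)
        interpret Lj: Module.module R "?L j" by (rule fm)
        have "dL j (\<ominus>\<^bsub>?L (Suc j)\<^esub> dL (Suc j) (?P2 v)) = \<ominus>\<^bsub>?L j\<^esub> dL j (dL (Suc j) (?P2 v))"
          using V(3) by (intro mod_hom.f_neg[OF DL(2)] mod_homD(3)[OF DL(2)]) (simp add: Suc)
        also have "dL j (dL (Suc j) (?P2 v)) = \<zero>\<^bsub>?L j\<^esub>" using V(3) by (intro DL(6)) (simp add: Suc)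
        finally show ?thesis
          using Lj.minus_zero_right[of "\<zero>\<^bsub>?L j\<^esub>"] by (simp add: v(1) Suc a_minus_def)
      qed simp
      show "z \<in> a_kernel (?F (Suc i)) (?F i) (d i)"
        using mod_homD(3)[OF d v(2)] d0[of i z] z1 z2 z3 by (simp add: a_kernel_def' v(1))
    next
      fix v assume "v \<in> a_kernel (?F (Suc i)) (?F i) (d i)"
      then have v: "v \<in> carrier (?F (Suc i))" "d i v = \<zero>\<^bsub>?F i\<^esub>" by (simp_all add: a_kernel_def')
      have V: "?P0 v \<in> carrier (?F1 (Suc i))" "?P1 v \<in> carrier (?F2 (Suc i))" "?P2 v \<in> carrier (?L i)"
        by (rule mod_homD(3)[OF P0 v(1)] mod_homD(3)[OF P1 v(1)] mod_homD(3)[OF P2 v(1)])+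
      have e: "?e1 i v = \<zero>\<^bsub>?F1 i\<^esub>" "?e2 i v = \<zero>\<^bsub>?F2 i\<^esub>" "?e3 i v = \<zero>\<^bsub>free_module R (BT i)\<^esub>"
        using v(2) d0[of i v] by blast+
      interpret Li: Module.module R "?L i" by (rule fm)
      \<comment> \<open>In degree one the third component of the differential is no condition; there injectivity of \<open>L \<rightarrow> M1\<close> is used.\<close>
      have "?P2 v \<in> dL i ` carrier (?L (Suc i))"
      proof (cases i)
        case 0
        have V0: "?P0 v \<in> carrier (?F1 (Suc 0))" "?P2 v \<in> carrier (?L 0)" using V by (simp_all add: 0)
        interpret M1: Module.module R M1 by (rule mod_homD(2)[OF p1])
        have a: "\<epsilon>L (?P2 v) \<in> carrier L" by (rule mod_homD(3)[OF DL(3) V0(2)])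
        have "m1 \<odot>\<^bsub>M1\<^esub> p1 (\<epsilon>L (?P2 v)) = \<epsilon>1 (?e1 0 v)"
          using V0 m1 mod_homD(3)[OF p1 a]
          by (simp add: mod_homD(4)[OF D1(3)] mod_homD(3)[OF D1(2)] mod_homD(3)[OF u1] D1(5) u1e)
        also have "\<dots> = \<zero>\<^bsub>M1\<^esub>" using e(1) mod_homD(6)[OF D1(3)] by (simp add: 0)
        finally have "\<epsilon>L (?P2 v) = \<zero>\<^bsub>L\<^esub>" by (rule inj[OF a])
        from DL(7)[OF V0(2) this] show ?thesis by (simp add: 0)
      next
        case (Suc j)
        interpret Lj: Module.module R "?L j" by (rule fm)
        have V2: "?P2 v \<in> carrier (?L (Suc j))" using V(3) by (simp add: Suc)
        have c: "dL j (?P2 v) \<in> carrier (?L j)" by (rule mod_homD(3)[OF DL(2) V2])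
        have "\<ominus>\<^bsub>?L j\<^esub> dL j (?P2 v) = \<zero>\<^bsub>?L j\<^esub>" using e(3) by (simp add: Suc)
        then have "dL j (?P2 v) = \<zero>\<^bsub>?L j\<^esub>"
          using Lj.r_neg[OF c] c by simp
        from DL(8)[OF V2 this] show ?thesis by (simp add: Suc)
      qed
      then obtain w where w: "?P2 v = dL i w" "w \<in> carrier (?L (Suc i))" by (rule imageE)
      interpret LS: Module.module R "?L (Suc i)" by (rule fm)
      obtain y1 where y1: "y1 \<in> carrier (?F1 (Suc (Suc i)))"
        "?P0 v = d1 (Suc i) y1 \<oplus>\<^bsub>?F1 (Suc i)\<^esub> u1 (Suc i) (\<ominus>\<^bsub>?L (Suc i)\<^esub> w)"
        using cone_exact_component[where i = i and F = ?F1 and d = d1 and u = "u1 (Suc i)" and L = "?L (Suc i)",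
            OF r1 u1 V(1) w(2)] e(1) u1d[OF w(2)] w(1) by auto
      obtain y2 where y2: "y2 \<in> carrier (?F2 (Suc (Suc i)))"
        "?P1 v = d2 (Suc i) y2 \<oplus>\<^bsub>?F2 (Suc i)\<^esub> u2 (Suc i) (\<ominus>\<^bsub>?L (Suc i)\<^esub> w)"
        using cone_exact_component[where i = i and F = ?F2 and d = d2 and u = "u2 (Suc i)" and L = "?L (Suc i)",
            OF r2 u2 V(2) w(2)] e(2) u2d[OF w(2)] w(1) by auto
      have y: "tuple3 y1 y2 (\<ominus>\<^bsub>?L (Suc i)\<^esub> w) \<in> carrier (?F (Suc (Suc i)))"
        unfolding BT using y1(1) y2(1) LS.add.inv_closed[OF w(2)] by (rule tuple3_closed)
      have "\<ominus>\<^bsub>?L i\<^esub> dL i (\<ominus>\<^bsub>?L (Suc i)\<^esub> w) = ?P2 v"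
        using mod_hom.f_neg[OF DL(2) w(2)] w(1) V(3) by (simp add: Li.minus_minus)
      then have "d (Suc i) (tuple3 y1 y2 (\<ominus>\<^bsub>?L (Suc i)\<^esub> w)) = tuple3 (?P0 v) (?P1 v) (?P2 v)"
        by (simp add: d_def y1(2) y2(2))
      also have "\<dots> = v" by (rule tuple3_proj3)
      finally show "v \<in> d (Suc i) ` carrier (?F (Suc (Suc i)))" using y by (intro image_eqI) simp_all
    qed
  qed
  moreover have "d i v \<in> aug_sub (?F i)" if v: "v \<in> carrier (?F (Suc i))" for i v
  proof -
    have V: "?P0 v \<in> carrier (?F1 (Suc i))" "?P1 v \<in> carrier (?F2 (Suc i))" "?P2 v \<in> carrier (?L i)"
      by (rule mod_homD(3)[OF P0 v] mod_homD(3)[OF P1 v] mod_homD(3)[OF P2 v])+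
    show ?thesis unfolding d_def
      by (rule aug_sub_tuple3[OF aug_sub_add[OF fm min1[OF V(1)] u1m[OF V(3)]]
            aug_sub_add[OF fm min2[OF V(2)] u2m[OF V(3)]] d3m[OF V(3)] mod_homD(3)[OF d v, unfolded d_def]])
  qed
  moreover have "finite (?B i)" for i
    by (intro finite_join3 fin) (cases i, simp_all add: fin)
  ultimately show ?thesis unfolding minimal_resolution_def BT_def by blast
qed

end

section \<open>Polynomial rings\<close>

abbreviation "keys \<equiv> Poly_Mapping.keys"
abbreviation "lookup \<equiv> Poly_Mapping.lookup"
abbreviation "single \<equiv> Poly_Mapping.single"

lemma poly_ring_simps [simp]:
  "\<one>\<^bsub>poly_ring V\<^esub> = 1" "\<zero>\<^bsub>poly_ring V\<^esub> = 0" "p \<otimes>\<^bsub>poly_ring V\<^esub> q = p * q" "p \<oplus>\<^bsub>poly_ring V\<^esub> q = p + q"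
  by (simp_all add: poly_ring_def)

lemma mem_poly_ring: "p \<in> carrier (poly_ring V) \<longleftrightarrow> (\<forall>m\<in>keys p. keys m \<subseteq> V)"
  by (simp add: poly_ring_def)

lemma keys_add_nat: "keys (m + m' :: nat \<Rightarrow>\<^sub>0 nat) = keys m \<union> keys m'"
  by (auto simp: in_keys_iff lookup_add)

lemma keys_multE:
  assumes "m \<in> keys (p * q)"
  obtains a b where "a \<in> keys p" "b \<in> keys q" "m = a + b"
  using assms keys_mult[of p q] by blast

lemma keys_addE:
  assumes "m \<in> keys (p + q)"
  obtains "m \<in> keys p" | "m \<in> keys q"
  using assms keys_add[of p q] by blast

lemma poly_ring_mult_closed:
  assumes "p \<in> carrier (poly_ring V)" "q \<in> carrier (poly_ring V)"
  shows "p * q \<in> carrier (poly_ring V)"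
  unfolding mem_poly_ring
proof
  fix m assume "m \<in> keys (p * q)"
  then show "keys m \<subseteq> V"
    by (rule keys_multE) (use assms in \<open>simp add: mem_poly_ring keys_add_nat\<close>)
qed

lemma poly_ring_cring: "cring (poly_ring V :: 'k::field mpoly ring)"
proof (rule cringI)
  show "abelian_group (poly_ring V :: 'k mpoly ring)"
  proof (rule abelian_groupI, goal_cases)
    case (6 x)
    then show ?case by (intro bexI[of _ "- x"]) (simp_all add: mem_poly_ring)
  qed (auto simp: mem_poly_ring add_ac elim!: keys_addE)
  show "comm_monoid (poly_ring V :: 'k mpoly ring)"
    by (rule comm_monoidI) (simp_all add: poly_ring_mult_closed mult_ac, simp add: mem_poly_ring)
qed (simp add: distrib_right)

text \<open>
  A product of two monomials is constant only if both are, so the constant term is multiplicative.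
\<close>

lemma lookup_times_zero:
  fixes p q :: "'k::field mpoly"
  shows "lookup (p * q) 0 = lookup p 0 * lookup q 0"
proof -
  have zero: "0 = l + r \<longleftrightarrow> l = 0 \<and> r = 0" for l r :: "nat \<Rightarrow>\<^sub>0 nat"
    by (auto simp: poly_mapping_eq_iff lookup_add fun_eq_iff)
  have "(\<Sum>r. lookup q r when 0 = l + r) = (lookup q 0 when l = 0)" for l
  proof (cases "l = 0")
    case True
    then show ?thesis by (simp add: zero)
  qed (simp add: zero)
  then show ?thesis by (simp add: lookup_mult mult_when)
qed

interpretation poly: augmented_ring "poly_ring V :: 'k::field mpoly ring" "\<lambda>p. lookup p 0" "single 0" for V
proof -
  interpret cring "poly_ring V :: 'k mpoly ring" by (rule poly_ring_cring)
  show "augmented_ring (poly_ring V :: 'k mpoly ring) (\<lambda>p. lookup p 0) (single 0)"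
    by unfold_locales (simp_all add: lookup_one lookup_add lookup_times_zero mem_poly_ring single_add mult_single)
qed

lemma residue_module_eq: "residue_module = residue (\<lambda>p. lookup p 0)"
  by (simp add: residue_module_def residue_def)

lemma (in augmented_ring) minimal_resolution_unit_ideal:
  "minimal_resolution (ideal_module R (carrier R)) (\<lambda>i. case i of 0 \<Rightarrow> {0} | Suc _ \<Rightarrow> {})"
proof -
  let ?B = "\<lambda>i. case i of 0 \<Rightarrow> {0 :: nat} | Suc _ \<Rightarrow> {}"
  let ?F = "\<lambda>i. free_module R (?B i)"
  let ?d = "\<lambda>(i :: nat) (v :: nat \<Rightarrow> 'a) (_ :: nat). \<zero>"
  have fm: "Module.module R (free_module R X)" for X :: "nat set"
    by (rule free_module_module[OF cring_axioms])
  have zero: "carrier (free_module R ({} :: nat set)) = {\<lambda>_. \<zero>}"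
  proof -
    have "v = (\<lambda>_. \<zero>)" if "v \<in> carrier (free_module R ({} :: nat set))" for v
      using free_moduleD(4)[OF that] by (intro ext) simp
    then show ?thesis by (auto intro: free_moduleI[of _ _ "{}"])
  qed
  have I: "Module.module R (ideal_module R (carrier R))"
    by (rule ideal_module_module[OF cring_axioms oneideal])
  have e: "mod_hom R (?F 0) (ideal_module R (carrier R)) (\<lambda>v. v 0)"
    by (rule mod_homI[OF fm I]) (auto simp: free_moduleD(1))
  have d: "mod_hom R (?F (Suc i)) (?F i) (?d i)" for i
    using mod_hom_zero[OF fm[of "?B (Suc i)"] fm[of "?B i"]] by simp
  have "free_resolution R (ideal_module R (carrier R)) ?F ?d (\<lambda>v. v 0)"
    unfolding free_resolution_def
  proof (intro conjI allI)
    show "(\<lambda>v. v 0) ` carrier (?F 0) = carrier (ideal_module R (carrier R))"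
    proof
      show "carrier (ideal_module R (carrier R)) \<subseteq> (\<lambda>v. v 0) ` carrier (?F 0)"
      proof
        fix x assume "x \<in> carrier (ideal_module R (carrier R))"
        then have "(\<lambda>b. if b = 0 then x else \<zero>) \<in> carrier (?F 0)"
          by (intro free_moduleI[of _ _ "{0}"]) auto
        then show "x \<in> (\<lambda>v. v 0) ` carrier (?F 0)" by (rule rev_image_eqI) simp
      qed
    qed (auto simp: free_moduleD(1))
    have "v = (\<lambda>_. \<zero>)" if "v \<in> carrier (?F 0)" "v 0 = \<zero>" for v
    proof
      fix b show "v b = \<zero>" using free_moduleD(4)[OF that(1), of b] that(2) by (cases "b = 0") auto
    qed
    then show "?d 0 ` carrier (?F (Suc 0)) = a_kernel (?F 0) (ideal_module R (carrier R)) (\<lambda>v. v 0)"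
      by (auto simp: a_kernel_def' zero intro: free_moduleI[of _ _ "{}"])
    show "?d (Suc i) ` carrier (?F (Suc (Suc i))) = a_kernel (?F (Suc i)) (?F i) (?d i)" for i
      by (auto simp: a_kernel_def' zero)
  qed (rule is_free_free_module e d)+
  moreover have "finite (?B i)" for i by (cases i) simp_all
  moreover have "?d i w \<in> aug_sub (?F i)" for i w
    using aug_sub.zero[of "?F i"] by simp
  ultimately show ?thesis unfolding minimal_resolution_def by blast
qed

section \<open>Multiplication and division by monomials\<close>

definition monomial :: "(nat \<Rightarrow>\<^sub>0 nat) \<Rightarrow> 'k::field mpoly" where
  "monomial e = single e 1"

lemma var_eq_monomial: "var i = monomial (single i 1)"
  by (simp add: var_def monomial_def)

lemma single_eq_zero_iff: "single k v = 0 \<longleftrightarrow> v = 0"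
  by (metis lookup_single_eq lookup_zero single_zero)

lemma monomial_mult: "monomial e * monomial f = monomial (e + f)"
  by (simp add: monomial_def mult_single)

lemma monomial_mult_assoc: "monomial e * (monomial f * p) = monomial (e + f) * p"
  by (simp add: monomial_mult mult.assoc[symmetric])

lemma monomial_mem: "keys e \<subseteq> V \<Longrightarrow> monomial e \<in> carrier (poly_ring V)"
  by (simp add: monomial_def mem_poly_ring)

lemma lookup_monomial_mult: "lookup (monomial e * p) (e + m) = lookup p m"
proof -
  have "lookup (monomial e * p) (e + m) = (\<Sum>l. (\<Sum>q. lookup p q when e + m = l + q) when e = l)"
    unfolding monomial_def lookup_mult
    by (intro Sum_any.cong) (simp add: lookup_single when_mult)
  also have "\<dots> = (\<Sum>q. lookup p q when e + m = e + q)" by simp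
  also have "\<dots> = lookup p m" by simp
  finally show ?thesis .
qed

lemma monomial_mult_keys: "m \<in> keys p \<Longrightarrow> e + m \<in> keys (monomial e * p)"
  by (simp add: in_keys_iff lookup_monomial_mult)

lemma monomial_mult_keysE:
  assumes "m \<in> keys (monomial e * p)"
  obtains m' where "m' \<in> keys p" "m = e + m'"
  using assms by (elim keys_multE) (auto simp: monomial_def)

lemma monomial_mult_cancel:
  fixes p q :: "'k::field mpoly"
  shows "monomial e * p = monomial e * q \<longleftrightarrow> p = q"
proof -
  have "monomial e \<noteq> (0 :: 'k::field mpoly)"
    unfolding monomial_def by (metis lookup_single_eq lookup_zero one_neq_zero)
  then show ?thesis by simp
qed

lemma sum_single_keys: "p = (\<Sum>m\<in>keys p. single m (lookup p m))"
proof (rule poly_mapping_eqI)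
  fix k
  have "lookup (\<Sum>m\<in>keys p. single m (lookup p m)) k = (\<Sum>m\<in>keys p. if m = k then lookup p m else 0)"
    unfolding lookup_sum by (intro sum.cong) (simp_all add: lookup_single when_def)
  also have "\<dots> = lookup p k" by (simp add: in_keys_iff)
  finally show "lookup p k = lookup (\<Sum>m\<in>keys p. single m (lookup p m)) k" by simp
qed

lemma monomial_dvdE:
  assumes "\<And>m. m \<in> keys p \<Longrightarrow> \<exists>m'. m = e + m'"
  obtains q where "p = monomial e * q"
proof
  show "p = monomial e * (\<Sum>m\<in>keys p. single (m - e) (lookup p m))"
    unfolding sum_distrib_left
  proof (subst sum_single_keys[of p], rule sum.cong[OF refl])
    fix m assume "m \<in> keys p"
    then obtain m' where "m = e + m'" using assms by blast
    then show "single m (lookup p m) = monomial e * single (m - e) (lookup p m)"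
      by (simp add: monomial_def mult_single)
  qed
qed

text \<open>
  The exponent of the squarefree monomial with support \<open>A\<close>.
\<close>

definition expo :: "nat set \<Rightarrow> nat \<Rightarrow>\<^sub>0 nat" where
  "expo A = (\<Sum>j\<in>A. single j 1)"

lemma lookup_expo: "finite A \<Longrightarrow> lookup (expo A) j = (if j \<in> A then 1 else 0)"
  by (simp add: expo_def lookup_sum lookup_single when_def)

lemma keys_expo: "finite A \<Longrightarrow> keys (expo A) = A"
  by (auto simp: in_keys_iff lookup_expo split: if_splits)

lemma prod_var: "finite A \<Longrightarrow> (\<Prod>j\<in>A. var j) = monomial (expo A)"
  by (induction A rule: finite_induct) (simp_all add: expo_def var_eq_monomial monomial_mult, simp add: monomial_def)

lemma exponent_le_add:
  fixes m e :: "nat \<Rightarrow>\<^sub>0 nat"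
  assumes "\<And>j. lookup e j \<le> lookup m j"
  shows "\<exists>m'. m = e + m'"
proof
  show "m = e + (m - e)"
    by (rule poly_mapping_eqI) (simp add: lookup_add lookup_minus assms)
qed

section \<open>Monomial description of the powers\<close>

text \<open>
  Truncated subtraction is intended: only the variables with exponent below \<open>s\<close> count. A product of
  \<open>s\<close> generators in which the one omitting \<open>X\<^sub>i\<close> occurs \<open>a\<^sub>i\<close> times has exponent \<open>s - a\<^sub>i\<close> at \<open>X\<^sub>i\<close>. It divides
  the monomial with exponents \<open>m\<close> iff \<open>s - m\<^sub>i \<le> a\<^sub>i\<close> for all \<open>i\<close>, and suitable \<open>a\<^sub>i\<close> with sum \<open>s\<close> exist iff
  the deficit is at most \<open>s\<close>.
\<close>

definition deficit :: "nat \<Rightarrow> nat \<Rightarrow> (nat \<Rightarrow>\<^sub>0 nat) \<Rightarrow> nat" where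
  "deficit k s m = (\<Sum>j=1..k. s - lookup m j)"

text \<open>
  The ideal \<open>I(k, s)\<close>. Variables in \<open>V\<close> beyond the first \<open>k\<close> are not restricted.
\<close>

definition cover_power :: "nat set \<Rightarrow> nat \<Rightarrow> nat \<Rightarrow> 'k::field mpoly set" where
  "cover_power V k s = {p \<in> carrier (poly_ring V). \<forall>m\<in>keys p. deficit k s m \<le> s}"

lemma deficit_add: "deficit k s (e + m) \<le> deficit k s m"
  unfolding deficit_def by (intro sum_mono) (simp add: lookup_add)

lemma deficit_Suc: "deficit (Suc k) s m = deficit k s m + (s - lookup m (Suc k))"
  by (simp add: deficit_def)

lemma deficit_zero [simp]: "deficit k 0 m = 0"
  by (simp add: deficit_def)

lemma deficit_one: "deficit (Suc 0) s m = s - lookup m (Suc 0)"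
  by (simp add: deficit_def)

lemma deficit_add_expo: "deficit k (Suc s) (expo {Suc 0..k} + m) = deficit k s m"
  unfolding deficit_def by (intro sum.cong) (simp_all add: lookup_add lookup_expo)

lemma deficit_add_single: "deficit k s (single (Suc k) c + m) = deficit k s m"
  unfolding deficit_def by (intro sum.cong) (simp_all add: lookup_add lookup_single)

lemma cover_power_ideal: "ideal (cover_power V k s :: 'k::field mpoly set) (poly_ring V)"
proof (rule idealI[OF poly.ring_axioms])
  let ?I = "cover_power V k s :: 'k mpoly set" and ?R = "poly_ring V :: 'k mpoly ring"
  have sub: "?I \<subseteq> carrier ?R" by (auto simp: cover_power_def)
  have add: "a + b \<in> ?I" if "a \<in> ?I" "b \<in> ?I" for a b
    using that by (auto simp: cover_power_def mem_poly_ring elim!: keys_addE)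
  have neg: "\<ominus>\<^bsub>?R\<^esub> a \<in> ?I" if "a \<in> ?I" for a
  proof -
    have "- a \<in> ?I" using that by (simp add: cover_power_def mem_poly_ring)
    moreover from this have "\<ominus>\<^bsub>?R\<^esub> a = - a"
      using that sub by (intro abelian_group.minus_equality[OF poly.abelian_group_axioms]) auto
    ultimately show ?thesis by simp
  qed
  have zero: "0 \<in> ?I" by (simp add: cover_power_def mem_poly_ring)
  show "subgroup ?I (add_monoid ?R)"
    by (rule subgroup.intro) (use sub add neg zero in \<open>auto simp: a_inv_def\<close>)
  show l: "x \<otimes>\<^bsub>poly_ring V\<^esub> a \<in> cover_power V k s"
      if a: "a \<in> cover_power V k s" and x: "x \<in> carrier (poly_ring V)" for a x :: "'k mpoly"
    proof -
      have "x * a \<in> carrier (poly_ring V)" using a poly.m_closed[OF x, of a] by (simp add: cover_power_def)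
      moreover have "deficit k s m \<le> s" if m: "m \<in> keys (x * a)" for m
        using m
      proof (rule keys_multE)
        fix b c assume "b \<in> keys x" "c \<in> keys a" "m = b + c"
        then show ?thesis using a deficit_add[of k s b c] by (auto simp: cover_power_def intro: le_trans)
      qed
      ultimately show ?thesis by (simp add: cover_power_def)
    qed
    show "a \<otimes>\<^bsub>poly_ring V\<^esub> x \<in> cover_power V k s"
      if "a \<in> cover_power V k s" "x \<in> carrier (poly_ring V)" for a x :: "'k mpoly"
      using l[OF that] by (simp add: mult.commute)
qed

lemma monomial_mult_cover_power:
  assumes "p \<in> cover_power V k s" "keys e \<subseteq> V"
    and "\<And>m. deficit k s m \<le> s \<Longrightarrow> deficit k' s' (e + m) \<le> s'"
  shows "monomial e * p \<in> cover_power V k' s'"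
proof -
  have "monomial e * p \<in> carrier (poly_ring V)"
    using assms(1) by (intro poly_ring_mult_closed monomial_mem assms(2)) (simp add: cover_power_def)
  moreover have "deficit k' s' m \<le> s'" if "m \<in> keys (monomial e * p)" for m
    using that by (rule monomial_mult_keysE) (use assms(1,3) in \<open>simp add: cover_power_def\<close>)
  ultimately show ?thesis by (simp add: cover_power_def)
qed

lemma cover_power_one: "cover_power V (Suc 0) s = carrier (poly_ring V)"
  by (auto simp: cover_power_def deficit_one)

lemma cover_power_zero: "cover_power V k 0 = carrier (poly_ring V)"
  by (auto simp: cover_power_def)

lemma cover_power_quotient:
  assumes "monomial e * q \<in> cover_power V k s"
    and "\<And>m. deficit k s (e + m) \<le> s \<Longrightarrow> deficit k' s' m \<le> s'"
  shows "q \<in> cover_power V k' s'"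
  using assms(1) monomial_mult_keys[of _ q e] assms(2)
  by (fastforce simp: cover_power_def mem_poly_ring keys_add_nat)

text \<open>
  The monomials of \<open>I(k + 1, t + 1)\<close> are sorted by the exponent of the last variable. If it exceeds \<open>t\<close>,
  a factor \<open>X\<^sub>k\<^sub>+\<^sub>1\<^sup>t\<^sup>+\<^sup>1\<close> splits off and the last variable no longer contributes to the deficit.
  Otherwise it contributes at least one, the other deficits add up to at most \<open>t\<close>, and each of
  \<open>X\<^sub>1, \<dots>, X\<^sub>k\<close> divides the monomial.
\<close>

lemma cover_power_split:
  assumes p: "p \<in> cover_power V (Suc k) (Suc t)"
  obtains x y where "x \<in> cover_power V (Suc k) t" "y \<in> cover_power V k (Suc t)"
    "p = monomial (expo {1..k}) * x + monomial (single (Suc k) (Suc t)) * y"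
proof -
  let ?P = "expo {1..k}" and ?y = "single (Suc k) (Suc t)"
  let ?S = "{m \<in> keys p. lookup m (Suc k) \<le> t}" and ?T = "{m \<in> keys p. \<not> lookup m (Suc k) \<le> t}"
  define a where "a = (\<Sum>m\<in>?S. single m (lookup p m))"
  define b where "b = (\<Sum>m\<in>?T. single m (lookup p m))"
  have "p = (\<Sum>m\<in>?S \<union> ?T. single m (lookup p m))"
    by (subst sum_single_keys[of p]) (rule sum.cong, auto)
  also have "\<dots> = a + b" unfolding a_def b_def by (rule sum.union_disjoint) auto
  finally have p_eq: "p = a + b" .
  have ka: "keys a \<subseteq> ?S" and kb: "keys b \<subseteq> ?T"
    unfolding a_def b_def using keys_sum by (fastforce split: if_splits)+
  have aS: "a \<in> cover_power V (Suc k) (Suc t)" and bT: "b \<in> cover_power V (Suc k) (Suc t)"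
    using ka kb p by (auto simp: cover_power_def mem_poly_ring)
  have "\<exists>m'. m = ?P + m'" if "m \<in> keys a" for m
  proof (rule exponent_le_add)
    fix j
    have m: "deficit (Suc k) (Suc t) m \<le> Suc t" "lookup m (Suc k) \<le> t"
      using that ka aS by (auto simp: cover_power_def)
    then have d: "deficit k (Suc t) m \<le> t" by (simp add: deficit_Suc)
    show "lookup ?P j \<le> lookup m j"
    proof (cases "j \<in> {1..k}")
      case True
      have "Suc t - lookup m j \<le> deficit k (Suc t) m"
        unfolding deficit_def by (rule member_le_sum) (use True in auto)
      then have "1 \<le> lookup m j" using d by linarith
      then show ?thesis by (simp add: lookup_expo)
    next
      case False
      then show ?thesis by (auto simp: lookup_expo)
    qed
  qed
  then obtain x where x: "a = monomial ?P * x" by (rule monomial_dvdE)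
  have "\<exists>m'. m = ?y + m'" if "m \<in> keys b" for m
    using that kb by (intro exponent_le_add) (auto simp: lookup_single when_def)
  then obtain y where y: "b = monomial ?y * y" by (rule monomial_dvdE)
  have "x \<in> cover_power V (Suc k) t"
  proof -
    have "deficit (Suc k) t m \<le> t"
      if "m \<in> keys x" for m
    proof -
      have "?P + m \<in> keys a" unfolding x by (rule monomial_mult_keys[OF that])
      then have "deficit (Suc k) (Suc t) (?P + m) \<le> Suc t" "lookup (?P + m) (Suc k) \<le> t"
        using ka aS by (auto simp: cover_power_def)
      then show ?thesis by (simp add: deficit_Suc deficit_add_expo lookup_add lookup_expo)
    qed
    moreover have "x \<in> carrier (poly_ring V)"
      using aS monomial_mult_keys[of _ x ?P] by (fastforce simp: x cover_power_def mem_poly_ring keys_add_nat)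
    ultimately show ?thesis by (simp add: cover_power_def)
  qed
  moreover have "y \<in> cover_power V k (Suc t)"
    by (rule cover_power_quotient[of ?y y V "Suc k" "Suc t"])
      (use bT y in \<open>simp_all add: deficit_Suc deficit_add_single\<close>)
  ultimately show thesis using that p_eq x y by blast
qed

lemma deficit_add_expo_tail:
  assumes "k \<ge> 1" "deficit k t m \<le> t"
  shows "deficit k (Suc t) (expo {2..k} + m) \<le> Suc t"
proof -
  have split: "deficit k s m = (s - lookup m 1) + (\<Sum>j=2..k. s - lookup m j)" for s m
    unfolding deficit_def using assms(1) by (subst sum.atLeast_Suc_atMost) (simp_all add: numeral_2_eq_2)
  have "(\<Sum>j=2..k. Suc t - lookup (expo {2..k} + m) j) = (\<Sum>j=2..k. t - lookup m j)"
    by (intro sum.cong) (simp_all add: lookup_add lookup_expo)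
  then show ?thesis using assms(2) by (simp add: split lookup_add lookup_expo)
qed

text \<open>
  The product \<open>P\<close> of the first \<open>k\<close> variables does not involve the next one, so the relation forces
  \<open>X\<^sub>k\<^sub>+\<^sub>1\<^sup>t\<^sup>+\<^sup>1\<close> to divide every monomial of \<open>x\<close>. The quotient \<open>a\<close> determines \<open>y\<close> by cancellation.
\<close>

lemma cover_power_syzygy:
  fixes x y :: "'k::field mpoly"
  assumes x: "x \<in> cover_power V (Suc k) t"
    and 0: "monomial (expo {1..k}) * x + monomial (single (Suc k) (Suc t)) * y = 0"
  obtains a where "a \<in> cover_power V k t" "x = monomial (single (Suc k) (Suc t)) * a"
    "y = - (monomial (expo {1..k}) * a)"
proof -
  let ?P = "expo {1..k}" and ?y = "single (Suc k) (Suc t)"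
  have eq: "monomial ?P * x = monomial ?y * (- y)" using 0 by (simp add: eq_neg_iff_add_eq_0)
  have "\<exists>m'. m = ?y + m'" if "m \<in> keys x" for m
  proof -
    have "?P + m \<in> keys (monomial ?y * (- y))" unfolding eq[symmetric] by (rule monomial_mult_keys[OF that])
    then obtain m' where "?P + m = ?y + m'" by (rule monomial_mult_keysE)
    then have "lookup ?P (Suc k) + lookup m (Suc k) = lookup ?y (Suc k) + lookup m' (Suc k)"
      by (metis lookup_add)
    then show ?thesis by (intro exponent_le_add) (auto simp: lookup_single when_def lookup_expo)
  qed
  then obtain a where a: "x = monomial ?y * a" by (rule monomial_dvdE)
  have "monomial ?y * (monomial ?P * a) = monomial ?y * (- y)"
    using eq by (simp add: a monomial_mult_assoc add.commute)
  then have "- y = monomial ?P * a" by (simp only: monomial_mult_cancel)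
  then have "y = - (monomial ?P * a)" by (metis minus_minus)
  moreover have "a \<in> cover_power V k t"
    by (rule cover_power_quotient[of ?y a V "Suc k" t])
      (use x a in \<open>simp_all add: deficit_Suc deficit_add_single\<close>)
  ultimately show thesis using that a by blast
qed

text \<open>
  The short exact sequence for \<open>I(k, t)\<close>, \<open>I(k + 1, t)\<close>, \<open>I(k, t + 1)\<close> and \<open>I(k + 1, t + 1)\<close>. The first map
  is split as \<open>X\<^sub>k\<^sub>+\<^sub>1 \<cdot> X\<^sub>k\<^sub>+\<^sub>1\<^sup>t\<close> and \<open>- X\<^sub>1 \<cdot> (X\<^sub>2 \<cdots> X\<^sub>k)\<close>; for the second component it matters that \<open>k \<ge> 1\<close>.
\<close>

lemma minimal_resolution_cover_power_step:
  fixes V :: "nat set" and k t :: nat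
  defines "I \<equiv> \<lambda>k s. ideal_module (poly_ring V) (cover_power V k s :: 'k::field mpoly set)"
  assumes k: "k \<ge> 1" and V: "{1..Suc k} \<subseteq> V"
    and BL: "poly.minimal_resolution V (I k t) BL"
    and B1: "poly.minimal_resolution V (I (Suc k) t) B1"
    and B2: "poly.minimal_resolution V (I k (Suc t)) B2"
  shows "poly.minimal_resolution V (I (Suc k) (Suc t))
    (\<lambda>i. join3 (B1 i) (B2 i) (case i of 0 \<Rightarrow> {} | Suc j \<Rightarrow> BL j))"
proof -
  let ?P = "expo {1..k}" and ?y = "single (Suc k) (Suc t)"
  let ?R = "poly_ring V :: 'k mpoly ring"
  have hom: "mod_hom ?R (I k1 s1) (I k2 s2) (\<lambda>p. monomial e * p)"
    if "keys e \<subseteq> V" "\<And>m. deficit k1 s1 m \<le> s1 \<Longrightarrow> deficit k2 s2 (e + m) \<le> s2" for k1 s1 k2 s2 e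
  proof -
    have "monomial e * p \<in> cover_power V k2 s2" if "p \<in> cover_power V k1 s1" for p :: "'k mpoly"
      by (rule monomial_mult_cover_power[OF that]) fact+
    then have "mod_hom ?R (I k1 s1) (I k2 s2) (\<lambda>p. monomial e \<otimes>\<^bsub>?R\<^esub> p)"
      unfolding I_def
      by (intro mult_mod_hom poly_ring_cring cover_power_ideal monomial_mem[OF that(1)]) simp
    then show ?thesis by simp
  qed
  have y1: "var (Suc k) * (monomial (single (Suc k) t) * a) = monomial ?y * a" for a :: "'k mpoly"
    by (simp add: var_eq_monomial monomial_mult_assoc single_add[symmetric])
  have "single 1 1 + expo {2..k} = ?P"
    unfolding expo_def using k by (subst sum.atLeast_Suc_atMost[of 1]) (simp_all add: numeral_2_eq_2)
  then have P1: "(- var 1) * (monomial (expo {2..k}) * a) = - (monomial ?P * a)" for a :: "'k mpoly"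
    by (simp add: var_eq_monomial monomial_mult_assoc)
  show ?thesis
  proof (rule poly.minimal_resolution_cone[OF BL B1 B2])
    show "mod_hom ?R (I k t) (I (Suc k) t) (\<lambda>p. monomial (single (Suc k) t) * p)"
      by (rule hom) (use V in \<open>auto simp: deficit_Suc deficit_add_single lookup_add\<close>)
    show "mod_hom ?R (I k t) (I k (Suc t)) (\<lambda>p. monomial (expo {2..k}) * p)"
      by (rule hom) (use V k in \<open>auto simp: keys_expo deficit_add_expo_tail\<close>)
    show "mod_hom ?R (I (Suc k) t) (I (Suc k) (Suc t)) (\<lambda>p. monomial ?P * p)"
      by (rule hom) (use V in \<open>auto simp: keys_expo deficit_Suc deficit_add_expo lookup_add lookup_expo\<close>)
    show "mod_hom ?R (I k (Suc t)) (I (Suc k) (Suc t)) (\<lambda>p. monomial ?y * p)"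
      by (rule hom) (use V in \<open>auto simp: deficit_Suc deficit_add_single lookup_add\<close>)
    show "var (Suc k) \<in> carrier ?R" "lookup (var (Suc k) :: 'k mpoly) 0 = 0"
      using V by (auto simp: var_def mem_poly_ring lookup_single when_def single_eq_zero_iff)
    show "- var 1 \<in> carrier ?R" "lookup (- var 1 :: 'k mpoly) 0 = 0"
      using V by (auto simp: var_def mem_poly_ring lookup_single when_def single_eq_zero_iff)
    show "\<exists>x\<in>carrier (I (Suc k) t). \<exists>y\<in>carrier (I k (Suc t)).
        z = monomial ?P * x \<oplus>\<^bsub>I (Suc k) (Suc t)\<^esub> monomial ?y * y"
      if "z \<in> carrier (I (Suc k) (Suc t))" for z
    proof -
      have "z \<in> cover_power V (Suc k) (Suc t)" using that by (simp add: I_def)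
      then obtain x y where "x \<in> cover_power V (Suc k) t" "y \<in> cover_power V k (Suc t)"
        "z = monomial ?P * x + monomial ?y * y" by (rule cover_power_split)
      then show ?thesis by (auto simp: I_def)
    qed
    show "monomial ?P * x \<oplus>\<^bsub>I (Suc k) (Suc t)\<^esub> monomial ?y * y = \<zero>\<^bsub>I (Suc k) (Suc t)\<^esub> \<longleftrightarrow>
      (\<exists>a\<in>carrier (I k t). x = var (Suc k) \<odot>\<^bsub>I (Suc k) t\<^esub> (monomial (single (Suc k) t) * a) \<and>
        y = (- var 1) \<odot>\<^bsub>I k (Suc t)\<^esub> (monomial (expo {2..k}) * a))"
      if "x \<in> carrier (I (Suc k) t)" "y \<in> carrier (I k (Suc t))" for x y
    proof -
      have "monomial ?P * x + monomial ?y * y = 0 \<longleftrightarrow>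
          (\<exists>a\<in>cover_power V k t. x = monomial ?y * a \<and> y = - (monomial ?P * a))"
      proof
        assume 0: "monomial ?P * x + monomial ?y * y = 0"
        have "x \<in> cover_power V (Suc k) t" using that(1) by (simp add: I_def)
        from cover_power_syzygy[OF this 0] show "\<exists>a\<in>cover_power V k t. x = monomial ?y * a \<and> y = - (monomial ?P * a)"
          by blast
      qed (auto simp: monomial_mult_assoc add.commute)
      then show ?thesis by (simp only: I_def ideal_module_simps poly_ring_simps y1 P1)
    qed
    show "a = \<zero>\<^bsub>I k t\<^esub>"
      if "var (Suc k) \<odot>\<^bsub>I (Suc k) t\<^esub> (monomial (single (Suc k) t) * a) = \<zero>\<^bsub>I (Suc k) t\<^esub>" for a
      using that monomial_mult_cancel[of ?y a 0] by (simp only: I_def ideal_module_simps poly_ring_simps y1) simp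
  qed
qed

section \<open>Betti numbers of the powers\<close>

text \<open>
  For \<open>i = j + 1\<close> and \<open>j < k\<close> the upper entries of the second factors are \<open>N = k - j + t\<close> or \<open>N + 1\<close>, and the
  identity is Pascal's rule applied in both factors. For \<open>j = k\<close> it is a single instance of Pascal's
  rule, and for \<open>j > k\<close> all terms vanish.
\<close>

lemma rank_recursion:
  "(Suc k choose i) * (Suc k - i + Suc t choose Suc k) =
     (Suc k choose i) * (Suc k - i + t choose Suc k) + (k choose i) * (k - i + Suc t choose k)
       + (case i of 0 \<Rightarrow> 0 | Suc j \<Rightarrow> (k choose j) * (k - j + t choose k))"
proof (cases i)
  case 0
  then show ?thesis by simp
next
  case (Suc j)
  consider "j < k" | "j = k" | "j > k" by linarith
  then show ?thesis
  proof cases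
    case 1
    define N where "N = k - j + t"
    have N: "Suc k - i + Suc t = Suc N" "Suc k - i + t = N" "k - i + Suc t = N" "k - j + t = N"
      using 1 by (simp_all add: Suc N_def)
    show ?thesis
      unfolding N unfolding Suc nat.case N(4) binomial_Suc_Suc by (simp add: algebra_simps)
  qed (simp_all add: Suc binomial_eq_0)
qed

text \<open>
  Double induction, outer on the number of vertices and inner on the power. The initial ideals are
  all equal to the ring.
\<close>

lemma minimal_resolution_cover_power:
  assumes "{1..Suc k} \<subseteq> V"
  shows "\<exists>B. poly.minimal_resolution V
      (ideal_module (poly_ring V) (cover_power V (Suc k) s :: 'k::field mpoly set)) B \<and>
    (\<forall>i. card (B i) = (k choose i) * (k - i + s choose k))"
  using assms
proof (induction k arbitrary: s)
  case 0
  show ?case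
    by (intro exI[of _ "\<lambda>i. case i of 0 \<Rightarrow> {0} | Suc _ \<Rightarrow> {}"] conjI allI)
      (auto simp: cover_power_one poly.minimal_resolution_unit_ideal split: nat.splits)
next
  case (Suc k)
  have V: "{1..Suc k} \<subseteq> V" using Suc.prems by auto
  note IHk = Suc.IH[OF V]
  note prems = Suc.prems
  show ?case
  proof (induction s)
    case 0
    have "(Suc k choose i) * (Suc k - i + 0 choose Suc k) = (case i of 0 \<Rightarrow> 1 | Suc _ \<Rightarrow> 0)" for i
      by (cases i) (auto simp: binomial_eq_0_iff)
    then show ?case
      by (intro exI[of _ "\<lambda>i. case i of 0 \<Rightarrow> {0} | Suc _ \<Rightarrow> {}"] conjI allI)
        (auto simp: cover_power_zero poly.minimal_resolution_unit_ideal split: nat.splits)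
  next
    case (Suc t)
    let ?I = "\<lambda>k s. ideal_module (poly_ring V) (cover_power V k s :: 'k mpoly set)"
    obtain B1 where B1: "poly.minimal_resolution V (?I (Suc (Suc k)) t) B1"
      "\<And>i. card (B1 i) = (Suc k choose i) * (Suc k - i + t choose Suc k)" using Suc.IH by blast
    obtain B2 where B2: "poly.minimal_resolution V (?I (Suc k) (Suc t)) B2"
      "\<And>i. card (B2 i) = (k choose i) * (k - i + Suc t choose k)" using IHk[of "Suc t"] by blast
    obtain BL where BL: "poly.minimal_resolution V (?I (Suc k) t) BL"
      "\<And>i. card (BL i) = (k choose i) * (k - i + t choose k)" using IHk[of t] by blast
    let ?B = "\<lambda>i. join3 (B1 i) (B2 i) (case i of 0 \<Rightarrow> {} | Suc j \<Rightarrow> BL j)"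
    have fin: "finite (B1 i)" "finite (B2 i)" "finite (BL i)" for i
      using B1(1) B2(1) BL(1) unfolding poly.minimal_resolution_def by blast+
    have "card (?B i) = card (B1 i) + card (B2 i) + (case i of 0 \<Rightarrow> 0 | Suc j \<Rightarrow> card (BL j))" for i
      using fin by (subst card_join3) (auto split: nat.split)
    then have "card (?B i) = (Suc k choose i) * (Suc k - i + Suc t choose Suc k)" for i
      using rank_recursion[of k i t] by (simp only: B1(2) B2(2) BL(2))
    moreover have "poly.minimal_resolution V (?I (Suc (Suc k)) (Suc t)) ?B"
      by (rule minimal_resolution_cover_power_step[OF _ prems BL(1) B1(1) B2(1)]) simp
    ultimately show ?case by blast
  qed
qed

lemma ideal_sum_closed:
  fixes f :: "'x \<Rightarrow> 'k::field mpoly"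
  assumes I: "ideal I (poly_ring V)" and "finite A" "\<And>x. x \<in> A \<Longrightarrow> f x \<in> I"
  shows "sum f A \<in> I"
proof -
  interpret I: ideal I "poly_ring V" by fact
  show ?thesis using assms(2,3)
  proof (induction A rule: finite_induct)
    case empty
    then show ?case using I.zero_closed by simp
  next
    case (insert x A)
    then show ?case using I.a_closed[of "f x" "sum f A"] by simp
  qed
qed

text \<open>
  A monomial ideal is spanned by its terms.
\<close>

lemma cover_power_subset:
  fixes I :: "'k::field mpoly set"
  assumes I: "ideal I (poly_ring V)"
    and single: "\<And>m c. keys m \<subseteq> V \<Longrightarrow> deficit k s m \<le> s \<Longrightarrow> single m c \<in> I"
  shows "cover_power V k s \<subseteq> I"
proof
  fix p :: "'k mpoly"
  assume p: "p \<in> cover_power V k s"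
  have "(\<Sum>m\<in>keys p. single m (lookup p m)) \<in> I"
    by (rule ideal_sum_closed[OF I]) (use p in \<open>auto simp: cover_power_def mem_poly_ring intro: single\<close>)
  then show "p \<in> I" by (simp add: sum_single_keys[symmetric])
qed

text \<open>
  Peeling off one generator. The omitted variable \<open>X\<^sub>i\<close> is chosen with exponent at most \<open>s\<close>, so that its own
  deficit drops by one when \<open>s + 1\<close> is replaced by \<open>s\<close>; the other deficits do not change, since their
  exponents drop as well. If all exponents exceed \<open>s\<close>, then any \<open>i\<close> does.
\<close>

lemma exponent_split:
  assumes n: "n \<ge> 1" and m: "deficit n (Suc s) m \<le> Suc s"
  obtains i m' where "i \<in> {1..n}" "m = expo ({1..n} - {i}) + m'" "deficit n s m' \<le> s"
proof -
  have split: "deficit n r q = (r - lookup q i) + (\<Sum>j\<in>{1..n} - {i}. r - lookup q j)" if "i \<in> {1..n}" for r q i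
    unfolding deficit_def by (rule sum.remove) (use that in auto)
  obtain i where i: "i \<in> {1..n}" "lookup m i \<le> s \<or> (\<forall>j\<in>{1..n}. Suc s \<le> lookup m j)"
    using n by (cases "\<exists>i\<in>{1..n}. lookup m i \<le> s") (auto simp: not_le Suc_le_eq)
  let ?e = "expo ({1..n} - {i})"
  have pos: "1 \<le> lookup m j" if j: "j \<in> {1..n} - {i}" for j
  proof -
    have "Suc s - lookup m j \<le> (\<Sum>j\<in>{1..n} - {i}. Suc s - lookup m j)"
      by (rule member_le_sum) (use j in auto)
    then have "(Suc s - lookup m i) + (Suc s - lookup m j) \<le> Suc s"
      using m split[OF i(1), of "Suc s" m] by linarith
    then show ?thesis using i(2) j by fastforce
  qed
  have "lookup ?e j \<le> lookup m j" for j
    using pos[of j] by (auto simp: lookup_expo)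
  then obtain m' where m': "m = ?e + m'" using exponent_le_add by blast
  have "(\<Sum>j\<in>{1..n} - {i}. s - lookup m' j) = (\<Sum>j\<in>{1..n} - {i}. Suc s - lookup m j)"
    by (rule sum.cong) (auto simp: m' lookup_add lookup_expo)
  moreover have "lookup m' i = lookup m i" by (simp add: m' lookup_add lookup_expo)
  ultimately have d: "deficit n s m' = (s - lookup m i) + (\<Sum>j\<in>{1..n} - {i}. Suc s - lookup m j)"
    by (simp add: split[OF i(1)])
  have "deficit n s m' \<le> s"
  proof (cases "lookup m i \<le> s")
    case True
    then show ?thesis using d m split[OF i(1), of "Suc s" m] by simp
  next
    case False
    then have "(\<Sum>j\<in>{1..n} - {i}. Suc s - lookup m j) = 0" using i(2) by simp
    then show ?thesis using d by simp
  qed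
  then show thesis using that i(1) m' by blast
qed

lemma deficit_expo_minus: "deficit n 1 (expo ({1..n} - {i})) \<le> 1"
proof -
  have "deficit n 1 (expo ({1..n} - {i})) = (\<Sum>j=1..n. if j = i then 1 else 0)"
    unfolding deficit_def by (rule sum.cong) (auto simp: lookup_expo)
  also have "\<dots> \<le> 1" by (subst sum.delta) auto
  finally show ?thesis .
qed

lemma monomial_expo_mem: "monomial (expo ({1..n} - {i})) \<in> cover_power {1..n} n 1"
  using deficit_expo_minus[of n i]
  by (auto simp: cover_power_def mem_poly_ring monomial_def keys_expo)

lemma single_eq_monomial_mult: "single (e + m) c = monomial e * single m c"
  by (simp add: monomial_def mult_single)

lemma cover_ideal_complete_graph_eq:
  assumes n: "n \<ge> 1"
  shows "cover_ideal {1..n} (complete_graph {1..n}) = (cover_power {1..n} n 1 :: 'k::field mpoly set)"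
proof -
  let ?V = "{1..n}"
  let ?R = "poly_ring ?V :: 'k mpoly ring"
  let ?S = "{\<Prod>j\<in>?V - {i}. var j |i. i \<in> ?V} :: 'k mpoly set"
  have V: "?V \<noteq> {}" using n by simp
  have prod: "(\<Prod>j\<in>?V - {i}. var j) = (monomial (expo (?V - {i})) :: 'k mpoly)" for i
    by (rule prod_var) simp
  have S: "?S \<subseteq> cover_power ?V n 1"
  proof
    fix p assume "p \<in> ?S"
    then obtain i where "p = (\<Prod>j\<in>?V - {i}. var j)" by blast
    then show "p \<in> cover_power ?V n 1" using monomial_expo_mem by (simp only: prod)
  qed
  have S': "?S \<subseteq> carrier ?R" using S by (auto simp: cover_power_def)
  have ideal: "ideal (genideal ?R ?S) ?R" by (rule poly.genideal_ideal[OF S'])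
  have "genideal ?R ?S = cover_power ?V n 1"
  proof
    show "genideal ?R ?S \<subseteq> cover_power ?V n 1"
      by (rule poly.genideal_minimal[OF cover_power_ideal S])
    show "cover_power ?V n 1 \<subseteq> genideal ?R ?S"
    proof (rule cover_power_subset[OF ideal])
      fix m and c :: 'k assume mV: "keys m \<subseteq> ?V" and m: "deficit n 1 m \<le> 1"
      obtain i m' where i: "i \<in> ?V" "m = expo (?V - {i}) + m'"
        using exponent_split[OF n, of 0 m] m by auto
      have g: "monomial (expo (?V - {i})) \<in> genideal ?R ?S"
        unfolding prod[symmetric] using i(1) by (intro subsetD[OF poly.genideal_self[OF S']]) blast
      have "keys m' \<subseteq> ?V" using mV i(2) by (simp add: keys_add_nat)
      then have "single m' c \<in> carrier ?R" by (simp add: mem_poly_ring)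
      from ideal.I_r_closed[OF ideal g this] show "single m c \<in> genideal ?R ?S"
        by (simp add: i(2) single_eq_monomial_mult)
    qed
  qed
  then show ?thesis by (simp only: cover_ideal_complete_graph[OF V])
qed

lemma deficit_mult: "deficit n (Suc s) (a + b) \<le> deficit n s a + deficit n 1 b"
  unfolding deficit_def sum.distrib[symmetric] by (rule sum_mono) (simp add: lookup_add)

text \<open>
  The deficits of two factors add up to a bound for the deficit of the product; the reverse inclusion
  is \<open>exponent_split\<close>.
\<close>

lemma cover_power_Suc:
  assumes n: "n \<ge> 1"
  shows "ideal_prod (poly_ring {1..n}) (cover_power {1..n} n s) (cover_power {1..n} n 1) =
    (cover_power {1..n} n (Suc s) :: 'k::field mpoly set)"
proof
  let ?V = "{1..n}"
  let ?R = "poly_ring ?V :: 'k mpoly ring"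
  let ?P = "ideal_prod ?R (cover_power ?V n s) (cover_power ?V n 1)"
  show "?P \<subseteq> cover_power ?V n (Suc s)"
  proof
    fix p assume "p \<in> ?P"
    then show "p \<in> cover_power ?V n (Suc s)"
    proof (induction rule: ideal_prod.induct)
      case (prod p q)
      have "p * q \<in> carrier ?R"
        using prod by (intro poly_ring_mult_closed) (simp_all add: cover_power_def)
      moreover have "deficit n (Suc s) m \<le> Suc s" if "m \<in> keys (p * q)" for m
        using that
      proof (rule keys_multE)
        fix a b assume ab: "a \<in> keys p" "b \<in> keys q" "m = a + b"
        then have "deficit n s a \<le> s" "deficit n 1 b \<le> 1"
          using prod by (simp_all add: cover_power_def)
        then show ?thesis using deficit_mult[of n s a b] ab(3) by simp
      qed
      ultimately show ?case by (simp add: cover_power_def)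
    next
      case (sum p q)
      interpret I: ideal "cover_power ?V n (Suc s)" ?R by (rule cover_power_ideal)
      show ?case using sum.IH by (rule I.a_closed)
    qed
  qed
  show "cover_power ?V n (Suc s) \<subseteq> ?P"
  proof (rule cover_power_subset[OF poly.ideal_prod_is_ideal[OF cover_power_ideal cover_power_ideal]])
    fix m and c :: 'k assume mV: "keys m \<subseteq> ?V" and m: "deficit n (Suc s) m \<le> Suc s"
    obtain i m' where i: "i \<in> ?V" "m = expo (?V - {i}) + m'" "deficit n s m' \<le> s"
      using exponent_split[OF n m] by blast
    have "single m' c \<in> cover_power ?V n s"
      using mV i by (auto simp: cover_power_def mem_poly_ring keys_add_nat)
    from ideal_prod.prod[OF this monomial_expo_mem[of n i], of ?R] show "single m c \<in> ?P"
      by (simp add: i(2) single_eq_monomial_mult mult.commute)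
  qed
qed

lemma ideal_power_cover_power:
  assumes n: "n \<ge> 1"
  shows "ideal_power (poly_ring {1..n}) (cover_power {1..n} n 1) s = (cover_power {1..n} n s :: 'k::field mpoly set)"
proof (induction s)
  case 0
  then show ?case by (simp add: ideal_power_def nat_pow_def ideals_set_def cover_power_zero)
next
  case (Suc s)
  have "ideal_power (poly_ring {1..n}) (cover_power {1..n} n 1 :: 'k mpoly set) (Suc s) =
      ideal_prod (poly_ring {1..n}) (ideal_power (poly_ring {1..n}) (cover_power {1..n} n 1) s)
        (cover_power {1..n} n 1)"
    by (simp add: ideal_power_def nat_pow_def ideals_set_def)
  then show ?case by (simp only: Suc cover_power_Suc[OF n])
qed

text \<open>
  The choice operator in \<open>Tor\<close> returns a resolution only if one exists whose terms consist of lists over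
  the given type. Listing the finitely many coordinates of a vector moves the minimal resolution there.
  The resolution that is chosen may be a different one.
\<close>

lemma betti_minimal_resolution:
  fixes M :: "('k::field mpoly, 'm) module"
  assumes "poly.minimal_resolution V M B"
  shows "betti V M i = enat (card (B i))"
proof -
  let ?R = "poly_ring V :: 'k mpoly ring"
  let ?G = "\<lambda>i. free_module ?R (B i)"
  have fin: "finite (B i)" for i using assms unfolding poly.minimal_resolution_def by blast
  obtain d' \<epsilon>' where G: "free_resolution ?R M ?G d' \<epsilon>'"
    and min: "\<And>i w. w \<in> carrier (?G (Suc i)) \<Longrightarrow> d' i w \<in> poly.aug_sub V (?G i)"
    using assms unfolding poly.minimal_resolution_def by blast
  define e :: "nat \<Rightarrow> (nat \<Rightarrow> 'k mpoly) \<Rightarrow> ('k mpoly + 'm) list"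
    where "e = (\<lambda>i v. map (\<lambda>b. Inl (v b)) (sorted_list_of_set (B i)))"
  have inj: "inj_on (e i) (carrier (?G i))" for i
  proof (rule inj_onI, rule ext)
    fix v w b assume v: "v \<in> carrier (?G i)" and w: "w \<in> carrier (?G i)" and eq: "e i v = e i w"
    show "v b = w b"
    proof (cases "b \<in> B i")
      case True
      then show ?thesis using eq fin[of i] by (simp add: e_def)
    next
      case False
      then show ?thesis using free_moduleD(4)[OF v] free_moduleD(4)[OF w] by simp
    qed
  qed
  define P where "P = (\<lambda>(F :: nat \<Rightarrow> ('k mpoly, ('k mpoly + 'm) list) module, d, \<epsilon>). free_resolution ?R M F d \<epsilon>)"
  from free_resolution_transport[OF G inj poly.one_neq_zero] have "\<exists>x. P x" by (auto simp: P_def)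
  then have P: "P (Eps P)" by (rule someI_ex)
  obtain F d \<epsilon> where eq: "Eps P = (F, d, \<epsilon>)" by (cases "Eps P") auto
  have F: "free_resolution ?R M F d \<epsilon>" using P by (simp add: eq) (simp add: P_def)
  have "Tor ?R M residue_module i =
      homology (\<lambda>j. tensor ?R (F j) residue_module) (\<lambda>j. tensor_map ?R residue_module (F j) (d j)) i"
    using eq by (simp add: Tor_def P_def)
  then show ?thesis
    using poly.edim_homology_minimal[where F = F and B = B and d = d and d' = d' and i = i, OF F G min fin] by (simp add: betti_def residue_module_eq)
qed

theorem theorem4p3:
  fixes n s i :: nat
    and J :: "('k::field) mpoly set"
  assumes "n \<ge> 1" and "s \<ge> 1"
    and "J = cover_ideal {1..n} (complete_graph {1..n})"
  shows "betti {1..n} (ideal_module (poly_ring {1..n}) (ideal_power (poly_ring {1..n}) J s)) i =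
         enat ((n - 1 choose i) * (n - 1 - i + s choose (n - 1)))"
proof -
  obtain k where k: "n = Suc k" using assms(1) by (cases n) auto
  have J: "ideal_power (poly_ring {1..n}) J s = cover_power {1..n} n s"
    unfolding assms(3) cover_ideal_complete_graph_eq[OF assms(1)] by (rule ideal_power_cover_power[OF assms(1)])
  obtain B where B: "poly.minimal_resolution {1..n}
      (ideal_module (poly_ring {1..n}) (cover_power {1..n} n s :: 'k mpoly set)) B"
    and card: "\<And>i. card (B i) = (k choose i) * (k - i + s choose k)"
    using minimal_resolution_cover_power[of k "{1..n}" s] unfolding k by blast
  show ?thesis
    unfolding J betti_minimal_resolution[OF B] by (simp add: card k)
qed

end
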